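(* Let $k$ be a positive integer. Among all simple connected graphs on $n=3k+1$ vertices with diameter $2k$, the graphs of minimum spectral radius are exactly the open quipus $P^{(i,j)}_{(i,\,i+j-1,\,j)}$ for all integers $0\le i\le j$ with $i+j=k$.
   Context: All graphs are finite, simple and undirected. The spectral radius $\rho(G)$ of a graph $G$ is the largest eigenvalue of its adjacency matrix. A pendent path of length $m\ge 0$ attached at a vertex $v$ consists of $m$ new vertices $w_1,\dots,w_m$ with edges $vw_1, w_1w_2,\dots,w_{m-1}w_m$. For integers $r\ge 0$ and $k_0,\dots,k_{r+1},m_0,\dots,m_r\ge 0$, the open quipu $P^{(m_0,m_1,\dots,m_r)}_{(k_0,k_1,\dots,k_r,k_{r+1})}$ is the tree obtained as follows: take vertices $v_0,v_1,\dots,v_r$; for each $1\le i\le r$ join $v_{i-1}$ and $v_i$ by a path having exactly $k_i$ internal vertices; attach a pendent path of length $k_0$ at $v_0$ and a pendent path of length $k_{r+1}$ at $v_r$ (these lie along the main path, on the side of $v_0$ away from $v_1$ and on the side of $v_r$ away from $v_{r-1}$ respectively); and attach a pendent path of length $m_i$ at $v_i$ for each $0\le i\le r$. In particular $P^{(i,j)}_{(i,i+j-1,j)}$ has vertices $v_0,v_1$ joined by a path with $i+j-1$ internal vertices, pendent paths of lengths $i$ and $i$ at $v_0$, and pendent paths of lengths $j$ and $j$ at $v_1$; it has $3(i+j)+1$ vertices. *)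

theory Defs
  imports "Jordan_Normal_Form.Char_Poly"
begin

definition simple_graph :: "nat \<Rightarrow> (nat \<Rightarrow> nat \<Rightarrow> bool) \<Rightarrow> bool" where
  "simple_graph n E \<longleftrightarrow> (\<forall>u v. E u v \<longrightarrow> u < n \<and> v < n \<and> u \<noteq> v \<and> E v u)"

inductive walk :: "(nat \<Rightarrow> nat \<Rightarrow> bool) \<Rightarrow> nat \<Rightarrow> nat \<Rightarrow> nat \<Rightarrow> bool" for E where
  walk0: "walk E 0 u u"
| walkS: "E u w \<Longrightarrow> walk E k w v \<Longrightarrow> walk E (Suc k) u v"

definition connected_graph :: "nat \<Rightarrow> (nat \<Rightarrow> nat \<Rightarrow> bool) \<Rightarrow> bool" where
  "connected_graph n E \<longleftrightarrow> (\<forall>u<n. \<forall>v<n. \<exists>k. walk E k u v)"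

definition graph_dist :: "(nat \<Rightarrow> nat \<Rightarrow> bool) \<Rightarrow> nat \<Rightarrow> nat \<Rightarrow> nat" where
  "graph_dist E u v = (LEAST k. walk E k u v)"

definition diameter :: "nat \<Rightarrow> (nat \<Rightarrow> nat \<Rightarrow> bool) \<Rightarrow> nat" where
  "diameter n E = Max {graph_dist E u v | u v. u < n \<and> v < n}"

definition adj_matrix :: "nat \<Rightarrow> (nat \<Rightarrow> nat \<Rightarrow> bool) \<Rightarrow> real mat" where
  "adj_matrix n E = mat n n (\<lambda>(i, j). if E i j then 1 else 0)"

definition spectral_radius_graph :: "nat \<Rightarrow> (nat \<Rightarrow> nat \<Rightarrow> bool) \<Rightarrow> real" where
  "spectral_radius_graph n E = Max {r. eigenvalue (adj_matrix n E) r}"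

definition graph_iso :: "nat \<Rightarrow> (nat \<Rightarrow> nat \<Rightarrow> bool) \<Rightarrow> (nat \<Rightarrow> nat \<Rightarrow> bool) \<Rightarrow> bool" where
  "graph_iso n E F \<longleftrightarrow> (\<exists>f. bij_betw f {0..<n} {0..<n} \<and>
      (\<forall>u<n. \<forall>v<n. E u v \<longleftrightarrow> F (f u) (f v)))"

text \<open>The open quipu P^{(i,j)}_{(i,i+j-1,j)} on vertices {0..<3(i+j)+1}, with k = i+j.
  Main path 0 - 1 - ... - 2k; v0 = i, v1 = 2i+j (so v0,v1 are joined by a path with
  i+j-1 internal vertices, and the main path contributes pendant paths of length i at v0
  and j at v1). Extra pendant path of length i at v0: vertices 2k+1,...,2k+i;
  extra pendant path of length j at v1: vertices 2k+i+1,...,2k+i+j = 3k.\<close>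
definition quipu_base :: "nat \<Rightarrow> nat \<Rightarrow> nat \<Rightarrow> nat \<Rightarrow> bool" where
  "quipu_base i j u v \<longleftrightarrow> (let k = i + j in
       (v = u + 1 \<and> v \<le> 2*k)
     \<or> (1 \<le> i \<and> u = i \<and> v = 2*k + 1)
     \<or> (v = u + 1 \<and> 2*k + 1 \<le> u \<and> v \<le> 2*k + i)
     \<or> (1 \<le> j \<and> u = 2*i + j \<and> v = 2*k + i + 1)
     \<or> (v = u + 1 \<and> 2*k + i + 1 \<le> u \<and> v \<le> 2*k + i + j))"

definition quipu :: "nat \<Rightarrow> nat \<Rightarrow> nat \<Rightarrow> nat \<Rightarrow> bool" where
  "quipu i j u v \<longleftrightarrow> quipu_base i j u v \<or> quipu_base i j v u"

end

theory Submission
  imports Defs "HOL-Analysis.Function_Topology"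
begin

text \<open>
  Let \<open>lam\<close> be the spectral radius of the starlike tree with three legs of length \<open>k\<close>; all the quipus in
  question have a positive eigenvector for \<open>lam\<close>. Conversely, let \<open>G\<close> have spectral radius at most \<open>lam\<close>,
  with Perron vector \<open>x\<close>, and let \<open>P\<close> be a geodesic of length \<open>2 * k\<close>, so that \<open>k\<close> vertices lie outside
  \<open>P\<close>. A local estimate at the vertices of \<open>P\<close> shows that the breadth-first tree from the centre of \<open>P\<close>
  has height at most \<open>k\<close> and that everything hanging off \<open>P\<close> in it is a path. Following the ratios of
  consecutive values of \<open>x\<close> along \<open>P\<close> from both ends, a potential function relates the total length of
  the branches passed to the distance covered; the two estimates are compatible only if there are at most
  two branches, of the lengths and in the positions of a quipu. Hence \<open>G\<close> contains a spanning quipu, and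
  pairing \<open>x\<close> with the positive eigenvector of that quipu excludes further edges.
\<close>

section \<open>The potential along the main path\<close>

text \<open>The only spectral information taken from \<open>G\<close> is the inequality
  \<open>A x \<le> lam x\<close> for a positive \<open>x\<close>. It survives the omission of
  neighbours, so it can be applied along any path of \<open>G\<close>, even one lying on a cycle.
  With \<open>lam = t + 1 / t\<close> and \<open>T = t * t\<close>, solutions along a path are
  combinations of \<open>t ^ d\<close> and its inverse, and the centre of the starlike tree, where
  three legs of length \<open>k\<close> meet, gives
  \<open>T ^ (k + 1) * (2 - T) = 2 * T - 1\<close>. The root \<open>T = 1\<close> is always present;
  a root above 1 is available for \<open>k \<ge> 3\<close>, while \<open>k = 1\<close> and
  \<open>k = 2\<close> have \<open>lam \<le> 2\<close> and are settled by explicit values. The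
  obstacle is that a whole family attains the minimum, so the estimates must lose nothing on it: the
  bounds from the two ends multiply to exactly the value that the edge between them permits. The
  factors \<open>qexc\<close>, which depend on how the mass is divided between the two sides, cancel
  in this product, and every branch after the first on either side costs a strict loss.\<close>

primrec qnum :: "real \<Rightarrow> nat \<Rightarrow> real" where
  "qnum T 0 = 0"
| "qnum T (Suc m) = 1 + T * qnum T m"

lemma qnum_closed: "(T - 1) * qnum T m = T ^ m - 1"
  by (induction m) (auto simp: algebra_simps)

lemma qnum_nonneg: "T \<ge> 0 \<Longrightarrow> qnum T m \<ge> 0"
  by (induction m) auto

lemma qnum_add: "qnum T (a + m) = qnum T m + T ^ m * qnum T a"
  by (induction m) (auto simp: algebra_simps)

lemma qnum_strict_mono: "T > 0 \<Longrightarrow> a < b \<Longrightarrow> qnum T a < qnum T b"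
proof -
  assume T: "T > 0" and "a < b"
  then obtain c where c: "b = Suc (c + a)"
    by (metis add.commute less_imp_Suc_add)
  have "qnum T b = qnum T a + T ^ a * qnum T (Suc c)"
    using qnum_add[of T "Suc c" a] c by simp
  moreover have "T ^ a * qnum T (Suc c) > 0"
    using T qnum_nonneg[of T c] by (intro mult_pos_pos) (auto simp: add_pos_nonneg)
  ultimately show ?thesis by simp
qed

lemma qnum_mono: "T > 0 \<Longrightarrow> a \<le> b \<Longrightarrow> qnum T a \<le> qnum T b"
  using qnum_strict_mono[of T a b] by (cases "a = b") auto

text \<open>Equal to \<open>qnum T (a + 1) - 2\<close>. Two pendent paths of length \<open>a\<close>
  at one vertex satisfy \<open>2 * qrat T a - 1 = qexc T a / qnum T (a + 1)\<close>; this is how the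
  quantity enters the potential.\<close>

definition qexc :: "real \<Rightarrow> nat \<Rightarrow> real" where
  "qexc T a = T * qnum T a - 1"

text \<open>\<open>qrat T m / t\<close> is the ratio of the first vertex of a pendent path of length \<open>m\<close> to its
  attachment vertex in a positive solution of \<open>A x = (t + 1 / t) x\<close>, where \<open>T = t\<^sup>2\<close>.\<close>

definition qrat :: "real \<Rightarrow> nat \<Rightarrow> real" where
  "qrat T m = 1 - 1 / qnum T (Suc m)"

lemma qexc_closed: "(T - 1) * qexc T a = T ^ (a + 1) - 2 * T + 1"
proof -
  have "(T - 1) * qexc T a = T * ((T - 1) * qnum T a) - (T - 1)"
    by (simp add: qexc_def algebra_simps)
  then show ?thesis unfolding qnum_closed by (simp add: algebra_simps)
qed

lemma qexc_add: "qexc T (a + m) = qexc T m + T ^ m * (qexc T a + 1)"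
  by (simp add: qexc_def qnum_add algebra_simps)

lemma qexc_ge: "T > 0 \<Longrightarrow> a \<ge> 1 \<Longrightarrow> qexc T a \<ge> T - 1"
  using qnum_mono[of T 1 a] by (simp add: qexc_def)

lemma qexc_pos: "T > 1 \<Longrightarrow> a \<ge> 1 \<Longrightarrow> qexc T a > 0"
  using qexc_ge[of T a] by simp

text \<open>The eigenvalue equation eliminates \<open>k\<close>: apart from a power of
  \<open>T\<close>, the excess of the remaining mass \<open>k - m\<close> is linear in
  \<open>qnum T (Suc m)\<close>, so a branch of size \<open>m\<close> and its complement become
  comparable.\<close>

lemma qexc_complement:
  assumes T: "T > 1" and eq: "T ^ (k + 1) * (2 - T) = 2 * T - 1" and m: "m \<le> k"
  shows "qexc T (k - m) = T ^ (k - m) * (2 - (2 - T) * qnum T (Suc m))"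
proof -
  have "(T - 1) * (T ^ (k - m) * (2 - (2 - T) * qnum T (Suc m)))
      = T ^ (k - m) * (2 * (T - 1) - (2 - T) * ((T - 1) * qnum T (Suc m)))"
    by (simp add: algebra_simps)
  also have "\<dots> = T ^ (k - m) * (T - (2 - T) * T ^ (Suc m))"
    unfolding qnum_closed by (simp add: algebra_simps)
  also have "\<dots> = T ^ (k - m + 1) - (2 - T) * (T ^ (k - m) * T ^ Suc m)"
    by (simp add: algebra_simps)
  also have "T ^ (k - m) * T ^ Suc m = T ^ (k + 1)"
    using m by (simp flip: power_add)
  also have "T ^ (k - m + 1) - (2 - T) * T ^ (k + 1) = (T - 1) * qexc T (k - m)"
    using eq unfolding qexc_closed by (simp add: algebra_simps)
  finally show ?thesis using T by simp
qed

text \<open>Increasing the size by \<open>m\<close> multiplies \<open>qexc\<close> by a factor that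
  is largest for initial size 1, where \<open>qexc T 1 = T - 1\<close>. This replaces the unknown
  mass accumulated so far by its worst case.\<close>

lemma qexc_ratio:
  assumes T: "T > 1" and a: "a \<ge> 1"
  shows "qexc T (a + m) * (T - 1) \<le> qexc T a * qexc T (m + 1)"
proof -
  have 1: "qexc T (m + 1) = qexc T m + T ^ m + T ^ m * (T - 1)"
    using qexc_add[of T 1 m] by (simp add: qexc_def algebra_simps)
  have "qexc T a * qexc T (m + 1) - qexc T (a + m) * (T - 1)
     = (qexc T m + T ^ m) * (qexc T a - (T - 1))"
    unfolding 1 qexc_add[of T a m] by (simp add: algebra_simps)
  moreover have "qexc T m + T ^ m \<ge> 0"
  proof -
    have "T * qnum T m \<ge> 0" "T ^ m \<ge> 1" using T qnum_nonneg[of T m] by auto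
    then show ?thesis by (simp add: qexc_def)
  qed
  moreover have "qexc T a - (T - 1) \<ge> 0"
    using qexc_ge[of T a] T a by simp
  ultimately show ?thesis by (smt (verit) mult_nonneg_nonneg)
qed

text \<open>Since \<open>\<alpha> + \<beta> + qrat T m = T - 1\<close> is fixed, \<open>\<alpha> * \<beta>\<close> is largest for \<open>\<alpha> = \<beta>\<close>; at that point
  the two sides would coincide for \<open>T = 2\<close>.\<close>

lemma branch_gain:
  assumes T: "1 < T" "T < 2" and m: "m \<ge> 1"
    and pos: "\<alpha> > 0" "\<beta> > 0" and sum: "\<alpha> + \<beta> + qrat T m = T - 1"
  shows "\<alpha> * \<beta> * (qexc T (m + 1))\<^sup>2 < (\<alpha> + qrat T m) * (\<beta> + qrat T m) * (T - 1)\<^sup>2"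
proof -
  define S where "S = qnum T (Suc m)"
  define D where "D = 1 - (2 - T) * S"
  define K where "K = (T * S - 1)\<^sup>2"
  have S1: "S > 1"
    using qnum_strict_mono[of T 0 m] T m by (simp add: S_def)
  have g: "qrat T m = (S - 1) / S" using S1 by (simp add: qrat_def diff_divide_distrib flip: S_def del: qnum.simps)
  have ab: "\<alpha> + \<beta> = D / S"
  proof -
    have "\<alpha> + \<beta> = T - 1 - (S - 1) / S" using sum g by simp
    also have "\<dots> = D / S" using S1 by (simp add: D_def field_simps)
    finally show ?thesis .
  qed
  have Dpos: "D > 0"
  proof -
    have "D / S > 0" using ab pos by simp
    then show ?thesis using S1 by (simp add: zero_less_divide_iff)
  qed
  \<comment> \<open>\<open>D\<close> is \<open>S * (\<alpha> + \<beta>)\<close>. The strictness of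
    the lemma originates here, from \<open>T < 2\<close> and \<open>S > 1\<close>.\<close>
  have DT: "D < T - 1"
  proof -
    have "(2 - T) * 1 < (2 - T) * S" using T S1 by (intro mult_strict_left_mono) auto
    then show ?thesis by (simp add: D_def)
  qed
  \<comment> \<open>Difference of squares with the factors \<open>2 * (S - 1)\<close> and
    \<open>2 * S * (T - 1)\<close>.\<close>
  have KD: "K - D\<^sup>2 = 4 * S * (S - 1) * (T - 1)"
    by (simp add: K_def D_def power2_eq_square algebra_simps)
  have "4 * (\<alpha> * \<beta>) \<le> (\<alpha> + \<beta>)\<^sup>2"
    using sum_squares_bound[of \<alpha> \<beta>] by (simp add: power2_eq_square algebra_simps)
  then have abD: "4 * S\<^sup>2 * (\<alpha> * \<beta>) \<le> D\<^sup>2"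
    unfolding ab using S1 by (simp add: power_divide field_simps)
  have TS: "T * S - 1 > T - 1" using T S1 by (simp add: mult_less_cancel_left2)
  have KT: "K - (T - 1)\<^sup>2 > 0"
    unfolding K_def using TS T by (simp add: power_strict_mono)
  have "4 * S\<^sup>2 * (\<alpha> * \<beta>) * (K - (T - 1)\<^sup>2) \<le> D\<^sup>2 * (K - (T - 1)\<^sup>2)"
    using abD KT by (intro mult_right_mono) auto
  also have "D\<^sup>2 * (K - (T - 1)\<^sup>2) < (T - 1)\<^sup>2 * (K - D\<^sup>2)"
  proof -
    have "D\<^sup>2 * K < (T - 1)\<^sup>2 * K"
      using DT Dpos KT by (intro mult_strict_right_mono power_strict_mono)
        (auto intro: less_le_trans[of 0 "K - (T-1)\<^sup>2" K])
    then show ?thesis by (simp add: algebra_simps)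
  qed
  also have "\<dots> = 4 * S\<^sup>2 * (qrat T m * (T - 1) ^ 3)"
    unfolding KD g using S1 by (simp add: field_simps power2_eq_square power3_eq_cube)
  finally have "\<alpha> * \<beta> * (K - (T - 1)\<^sup>2) < qrat T m * (T - 1) ^ 3"
    using S1 by (simp add: mult.assoc)
  moreover have "(\<alpha> + qrat T m) * (\<beta> + qrat T m) = \<alpha> * \<beta> + qrat T m * (T - 1)"
    unfolding sum[symmetric] by (simp add: algebra_simps)
  moreover have "K = (qexc T (m + 1))\<^sup>2"
    by (simp add: K_def S_def qexc_def)
  moreover have "(\<alpha> * \<beta> + qrat T m * (T - 1)) * (T - 1)\<^sup>2 = \<alpha> * \<beta> * (T - 1)\<^sup>2 + qrat T m * (T - 1) ^ 3"
    by (simp add: algebra_simps power2_eq_square power3_eq_cube)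
  ultimately show ?thesis by (simp add: right_diff_distrib)
qed

lemma qrat_mono: "T > 0 \<Longrightarrow> a \<le> b \<Longrightarrow> qrat T a \<le> qrat T b"
  using qnum_mono[of T "Suc a" "Suc b"] qnum_strict_mono[of T 0 "Suc a"]
  by (auto simp add: qrat_def intro!: divide_left_mono simp del: qnum.simps(2))

lemma qrat_ge: "T > 1 \<Longrightarrow> m \<ge> 1 \<Longrightarrow> qrat T m > 1 / 2"
proof -
  assume T: "T > 1" and "m \<ge> 1"
  then have "qrat T 1 \<le> qrat T m" by (intro qrat_mono) auto
  moreover have "qrat T 1 > 1 / 2" using T by (simp add: qrat_def field_simps)
  ultimately show ?thesis by simp
qed

definition mass_upto :: "(nat \<Rightarrow> nat) \<Rightarrow> nat \<Rightarrow> nat \<Rightarrow> nat" where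
  "mass_upto m u p = (\<Sum>q\<in>{u..p}. m q)"

text \<open>In the next lemmas \<open>a p\<close> is \<open>t\<close> times the ratio of the values at the path vertices \<open>p - 1\<close> and
  \<open>p\<close>, so that \<open>T / a (Suc p)\<close> is the same quantity read from right to left. The branch at \<open>p\<close>
  contributes \<open>qrat T (m p)\<close>, and \<open>u\<close> is the first vertex carrying a branch.\<close>

lemma left_ratio_gt_1:
  fixes a :: "nat \<Rightarrow> real"
  assumes T: "1 < T" and m: "1 \<le> m u" "m u \<le> u"
    and a: "\<And>p. u \<le> p \<Longrightarrow> p \<le> v \<Longrightarrow> a p > 0"
    and au: "a u \<ge> qrat T u"
    and super: "\<And>p. u \<le> p \<Longrightarrow> p < v \<Longrightarrow> a p + qrat T (m p) + T / a (Suc p) \<le> T + 1"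
    and p: "u \<le> p" "p < v"
  shows "a (Suc p) > 1"
  using p
proof (induction p rule: dec_induct)
  case base
  \<comment> \<open>Tail and branch at \<open>u\<close> together exceed 1; at later vertices the
    inductive bound on \<open>a\<close> alone does.\<close>
  have "qrat T u > 1 / 2" "qrat T (m u) > 1 / 2" using qrat_ge T m by auto
  then have "T / a (Suc u) < T" using super[of u] au base by auto
  then show ?case using a[of "Suc u"] base T by (simp add: field_simps)
next
  case (step p)
  have "qrat T (m (Suc p)) \<ge> 0" using qrat_mono[of T 0 "m (Suc p)"] T by (simp add: qrat_def)
  then have "T / a (Suc (Suc p)) < T" using super[of "Suc p"] step by auto
  then show ?case using a[of "Suc (Suc p)"] step T by (simp add: field_simps)
qed

text \<open>With \<open>Z = T * (Y - 1) / (T - Y)\<close>, a step along the path without a branch divides \<open>Z\<close> by \<open>T\<close>;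
  the claim is \<open>Z * T ^ p \<ge> T ^ (k + 1) * qexc T M / qexc T (k - M)\<close>, where \<open>M\<close> is the total size
  of the branches seen so far, with equality only for a single branch of length \<open>u\<close> at \<open>u\<close>.\<close>

lemma left_potential:
  fixes a :: "nat \<Rightarrow> real"
  assumes T: "1 < T" "T < 2" and eq: "T ^ (k + 1) * (2 - T) = 2 * T - 1"
    and m: "1 \<le> m u" "m u \<le> u"
    and a: "\<And>p. u \<le> p \<Longrightarrow> p \<le> v \<Longrightarrow> a p > 0"
    and au: "a u \<ge> qrat T u"
    and super: "\<And>p. u \<le> p \<Longrightarrow> p < v \<Longrightarrow> a p + qrat T (m p) + T / a (Suc p) \<le> T + 1"
    and right: "\<And>p. u \<le> p \<Longrightarrow> p < v \<Longrightarrow> a (Suc p) < T"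
    and mass: "\<And>p. u \<le> p \<Longrightarrow> p < v \<Longrightarrow> mass_upto m u p < k"
    and p: "u \<le> p" "p < v"
  defines "Y \<equiv> \<lambda>p. a p + qrat T (m p)"
  defines "lhs \<equiv> \<lambda>p. T ^ (k + 1) * qexc T (mass_upto m u p) * (T - Y p)"
  defines "rhs \<equiv> \<lambda>p. T ^ (p + 1) * qexc T (k - mass_upto m u p) * (Y p - 1)"
  shows "lhs p \<le> rhs p \<and> (\<not> (m u = u \<and> mass_upto m u p = u) \<longrightarrow> lhs p < rhs p)"
  using p
proof (induction p rule: dec_induct)
  case base
  let ?n = "m u"
  have mu: "mass_upto m u u = ?n" by (simp add: mass_upto_def)
  have nk: "?n < k" using mass[of u] base mu by simp
  define S where "S = qnum T (Suc ?n)"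
  have S1: "S > 1" using qnum_strict_mono[of T 0 ?n] T m by (simp add: S_def)
  have g: "qrat T ?n = 1 - 1 / S" by (simp add: qrat_def S_def)
  have c: "qexc T (k - ?n) = T ^ (k - ?n) * (2 - (2 - T) * S)"
    using qexc_complement[OF T(1) eq, of ?n] nk by (simp add: S_def)
  have qp: "qexc T (k - ?n) > 0" using qexc_pos[of T "k - ?n"] nk T by auto
  have e: "qexc T ?n = S - 2" by (simp add: qexc_def S_def)
  have ep: "qexc T ?n > 0" using qexc_pos[of T ?n] m T by auto
  \<comment> \<open>The equality case: a branch of length \<open>m u\<close> at the end of a tail of
    the same length. A longer tail only increases \<open>Y u\<close> and the power of
    \<open>T\<close> on the right.\<close>
  have key: "T ^ (k + 1) * qexc T ?n * (T - 2 * qrat T ?n)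
           = T ^ (?n + 1) * qexc T (k - ?n) * (2 * qrat T ?n - 1)"
  proof -
    have "T ^ (k + 1) = T ^ (?n + 1) * T ^ (k - ?n)" using nk by (simp flip: power_add)
    moreover have "T - 2 * qrat T ?n = (2 - (2 - T) * S) / S"
      unfolding g using S1 by (simp add: field_simps)
    moreover have "2 * qrat T ?n - 1 = (S - 2) / S"
      unfolding g using S1 by (simp add: field_simps)
    ultimately show ?thesis unfolding c e by (simp only: times_divide_eq_right times_divide_eq_left ac_simps)
  qed
  have Y: "Y u \<ge> 2 * qrat T ?n" using au qrat_mono[of T ?n u] m T by (simp add: Y_def)
  have Tk: "T ^ (k + 1) * qexc T ?n > 0" using T ep by simp
  have Tn: "T ^ (u + 1) \<ge> T ^ (?n + 1)" using T m by (intro power_increasing) auto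
  have half: "2 * qrat T ?n - 1 > 0" using qrat_ge[of T ?n] T m by simp
  have "lhs u \<le> T ^ (k + 1) * qexc T ?n * (T - 2 * qrat T ?n)"
    unfolding lhs_def mu using Tk Y by (intro mult_left_mono) auto
  also have "\<dots> = T ^ (?n + 1) * qexc T (k - ?n) * (2 * qrat T ?n - 1)" by (rule key)
  also have 1: "\<dots> \<le> T ^ (u + 1) * qexc T (k - ?n) * (2 * qrat T ?n - 1)"
    using Tn qp half by (intro mult_right_mono) auto
  also have 2: "\<dots> \<le> rhs u"
    unfolding rhs_def mu using Y qp T by (intro mult_left_mono) auto
  finally have le: "lhs u \<le> rhs u" .
  have "lhs u < rhs u" if "?n \<noteq> u"
  proof -
    have "T ^ (?n + 1) < T ^ (u + 1)" using T m that by (intro power_strict_increasing) auto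
    then have "T ^ (?n + 1) * qexc T (k - ?n) * (2 * qrat T ?n - 1)
        < T ^ (u + 1) * qexc T (k - ?n) * (2 * qrat T ?n - 1)"
      using qp half by (intro mult_strict_right_mono) auto
    moreover have "lhs u \<le> T ^ (k + 1) * qexc T ?n * (T - 2 * qrat T ?n)"
      unfolding lhs_def mu using Tk Y by (intro mult_left_mono) auto
    ultimately show ?thesis using key 2 by linarith
  qed
  then show ?case using le mu by auto
next
  case (step p)
  let ?M = "mass_upto m u p" and ?n = "m (Suc p)" and ?y = "a (Suc p)"
  have M': "mass_upto m u (Suc p) = ?M + ?n" using step by (simp add: mass_upto_def)
  have M1: "?M \<ge> 1"
  proof -
    have "m u \<le> ?M" unfolding mass_upto_def using step by (intro member_le_sum) auto
    then show ?thesis using m by simp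
  qed
  have Mk: "?M + ?n < k" using mass[of "Suc p"] step M' by simp
  \<comment> \<open>\<open>b\<close> is the ratio on the next edge read from right to left, at most
    \<open>T + 1 - Y p\<close> by \<open>super\<close>. Going over from \<open>b\<close> to
    \<open>T / b\<close> is what divides \<open>Z\<close> by \<open>T\<close>.\<close>
  define b where "b = T / ?y"
  have y: "1 < ?y" "?y < T"
    using left_ratio_gt_1[OF T(1) m a au super, of v p] right[of p] step by auto
  have b1: "b > 1" using y by (simp add: b_def)
  have by': "?y = T / b" using y T by (simp add: b_def)
  have bY: "b \<le> T + 1 - Y p" using super[of p] step by (simp add: b_def Y_def)
  have e1: "qexc T ?M > 0" using qexc_pos[of T ?M] M1 T by auto
  have e2: "qexc T (k - ?M) > 0" using qexc_pos[of T "k - ?M"] Mk T by auto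
  define C where "C = T ^ (k + 1) * qexc T ?M"
  define E where "E = T ^ (p + 1) * qexc T (k - ?M)"
  have C: "C > 0" using T e1 by (simp add: C_def)
  have E: "E > 0" using T e2 by (simp add: E_def)
  have Cb: "C * (b - 1) \<le> C * (T - Y p)" using C bY by (intro mult_left_mono) auto
  have Eb: "E * (Y p - 1) \<le> E * (T - b)" using E bY by (intro mult_left_mono) auto
  have IH: "lhs p = C * (T - Y p)" "rhs p = E * (Y p - 1)"
    by (simp_all add: lhs_def rhs_def C_def E_def)
  have IHs: "lhs p \<le> rhs p \<and> (\<not> (m u = u \<and> ?M = u) \<longrightarrow> lhs p < rhs p)"
    using step.IH step.prems by simp
  have tr: "C * (T - ?y) = (T / b) * (C * (b - 1))" "E * T * (?y - 1) = (T / b) * (E * (T - b))"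
    unfolding by' using b1 by (simp_all add: field_simps)
  have Tb: "T / b > 0" using T b1 by simp
  have free: "C * (T - ?y) \<le> E * T * (?y - 1)"
    unfolding tr using Tb Cb Eb IH IHs by (intro mult_left_mono) auto
  have free_strict: "C * (T - ?y) < E * T * (?y - 1)" if "\<not> (m u = u \<and> ?M = u)"
    unfolding tr using Tb Cb Eb IH IHs that by (intro mult_strict_left_mono) auto
  show ?case
  proof (cases "?n = 0")
    case True
    have "lhs (Suc p) = C * (T - ?y)"
      by (simp add: lhs_def M' True C_def Y_def qrat_def)
    moreover have "rhs (Suc p) = E * T * (?y - 1)"
      by (simp add: rhs_def M' True E_def Y_def qrat_def)
    ultimately show ?thesis using free free_strict True M' by auto
  next
    case False
    define \<alpha> where "\<alpha> = ?y - 1"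
    define \<beta> where "\<beta> = T - Y (Suc p)"
    let ?g = "qrat T ?n"
    have \<alpha>: "\<alpha> > 0" using y by (simp add: \<alpha>_def)
    have \<beta>: "\<beta> > 0"
    proof -
      have "T / a (Suc (Suc p)) > 1"
        using right[of "Suc p"] a[of "Suc (Suc p)"] step by auto
      then show ?thesis using super[of "Suc p"] step by (simp add: \<beta>_def Y_def)
    qed
    have g: "?g > 0" using qrat_ge[of T ?n] False T by simp
    have sum: "\<alpha> + \<beta> + ?g = T - 1" by (simp add: \<alpha>_def \<beta>_def Y_def)
    have gain: "\<alpha> * \<beta> * (qexc T (?n + 1))\<^sup>2 < (\<alpha> + ?g) * (\<beta> + ?g) * (T - 1)\<^sup>2"
      using branch_gain[OF T _ \<alpha> \<beta> sum] False by simp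
    define A B A' B' where "A = qexc T ?M" and "B = qexc T (k - ?M)"
      and "A' = qexc T (?M + ?n)" and "B' = qexc T (k - ?M - ?n)"
    have pos: "A > 0" "B > 0" "A' > 0" "B' > 0"
      using qexc_pos[of T ?M] qexc_pos[of T "k - ?M"] qexc_pos[of T "?M + ?n"]
        qexc_pos[of T "k - ?M - ?n"] M1 Mk T by (auto simp: A_def B_def A'_def B'_def)
    \<comment> \<open>The new branch raises \<open>qexc\<close> of the mass passed and lowers that
      of the mass remaining. Both factors are at most \<open>qexc T (?n + 1) / (T - 1)\<close>,
      which explains the squares in \<open>gain\<close>.\<close>
    have rA: "A' * (T - 1) \<le> A * qexc T (?n + 1)"
      unfolding A_def A'_def using qexc_ratio T M1 by simp
    have rB: "B * (T - 1) \<le> B' * qexc T (?n + 1)"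
    proof -
      have "k - ?M - ?n + ?n = k - ?M" using Mk by simp
      then show ?thesis unfolding B_def B'_def
        using qexc_ratio[OF T(1), of "k - ?M - ?n" ?n] Mk by simp
    qed
    have "A' * (T - 1) * (B * (T - 1)) \<le> (A * qexc T (?n + 1)) * (B' * qexc T (?n + 1))"
      using pos T by (intro mult_mono[OF rA rB] order_trans[OF _ rA]) auto
    then have "(\<alpha> * \<beta>) * (A' * B * (T - 1)\<^sup>2) \<le> (\<alpha> * \<beta>) * (A * B' * (qexc T (?n + 1))\<^sup>2)"
      using \<alpha> \<beta> by (intro mult_left_mono) (auto simp: power2_eq_square algebra_simps)
    also have "\<dots> = (A * B') * (\<alpha> * \<beta> * (qexc T (?n + 1))\<^sup>2)" by simp
    also have "\<dots> < (A * B') * ((\<alpha> + ?g) * (\<beta> + ?g) * (T - 1)\<^sup>2)"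
      using gain pos by (intro mult_strict_left_mono) auto
    finally have "(T - 1)\<^sup>2 * (\<alpha> * \<beta> * A' * B) < (T - 1)\<^sup>2 * ((\<alpha> + ?g) * (\<beta> + ?g) * A * B')"
      by (simp add: algebra_simps)
    then have ratio: "\<alpha> * \<beta> * A' * B < (\<alpha> + ?g) * (\<beta> + ?g) * A * B'"
      using T by simp
    define K where "K = T ^ (k + 1)"
    define L where "L = T ^ (p + 2)"
    have KL: "K > 0" "L > 0" using T by (simp_all add: K_def L_def)
    have fr: "K * A * (\<beta> + ?g) \<le> L * B * \<alpha>"
    proof -
      have "T - ?y = \<beta> + ?g" by (simp add: \<beta>_def Y_def)
      with free have "C * (\<beta> + ?g) \<le> E * T * \<alpha>" by (simp add: \<alpha>_def)
      then show ?thesis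
        by (simp add: C_def E_def A_def B_def K_def L_def mult_ac)
    qed
    have "(A * (\<beta> + ?g)) * (K * A' * \<beta>) = (A' * \<beta>) * (K * A * (\<beta> + ?g))" by simp
    also have "\<dots> \<le> (A' * \<beta>) * (L * B * \<alpha>)" using fr pos \<beta> by (intro mult_left_mono) auto
    also have "\<dots> = L * (\<alpha> * \<beta> * A' * B)" by simp
    also have "\<dots> < L * ((\<alpha> + ?g) * (\<beta> + ?g) * A * B')" using ratio KL by (intro mult_strict_left_mono) auto
    also have "\<dots> = (A * (\<beta> + ?g)) * (L * B' * (\<alpha> + ?g))" by simp
    finally have "K * A' * \<beta> < L * B' * (\<alpha> + ?g)" using pos \<beta> g by simp
    moreover have "lhs (Suc p) = K * A' * \<beta>"
      by (simp add: lhs_def M' K_def A'_def \<beta>_def)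
    moreover have "rhs (Suc p) = L * B' * (\<alpha> + ?g)"
      by (simp add: rhs_def M' L_def B'_def \<alpha>_def Y_def)
    ultimately show ?thesis by simp
  qed
qed

lemma mass_upto_mirror:
  assumes "u < v" "v \<le> n"
  shows "mass_upto (\<lambda>p. m (n - p)) (n - v) (n - Suc u) = (\<Sum>q\<in>{Suc u..v}. m q)"
  unfolding mass_upto_def
  by (rule sum.reindex_bij_witness[of _ "\<lambda>q. n - q" "\<lambda>q. n - q"]) (use assms in auto)

text \<open>The potential bounds from both ends are played against each other on the edge following \<open>u\<close>,
  where compatibility demands \<open>Z * Z' \<le> T ^ 3\<close>.\<close>

lemma two_branch_rigidity:
  fixes X :: "nat \<Rightarrow> real"
  assumes T: "1 < T" "T < 2" and eq: "T ^ (k + 1) * (2 - T) = 2 * T - 1" and t: "t > 0" "t * t = T"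
    and uv: "u < v" "v \<le> 2 * k"
    and m: "1 \<le> m u" "m u \<le> u" "1 \<le> m v" "m v \<le> 2 * k - v"
    and mass: "(\<Sum>p\<in>{u..v}. m p) = k"
    and X: "\<And>p. u \<le> p \<Longrightarrow> p \<le> v \<Longrightarrow> X p > 0"
    and left: "t * X (Suc u) + (qrat T u + qrat T (m u)) * X u \<le> (T + 1) * X u"
    and right: "t * X (v - 1) + (qrat T (2 * k - v) + qrat T (m v)) * X v \<le> (T + 1) * X v"
    and inner: "\<And>p. u < p \<Longrightarrow> p < v \<Longrightarrow>
      t * X (p - 1) + t * X (Suc p) + qrat T (m p) * X p \<le> (T + 1) * X p"
  shows "m u = u \<and> m v = 2 * k - v \<and> m u + m v = k"
proof -
  \<comment> \<open>No value of \<open>X\<close> left of \<open>u\<close> is given, so the ratio at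
    \<open>u\<close> is set to that of a pendent path of length \<open>u\<close>, the bound built
    into \<open>left\<close>; likewise for \<open>a'\<close> at the other end.\<close>
  define a where "a p = (if p = u then qrat T u else t * X (p - 1) / X p)" for p
  define a' where "a' p = (if p = 2 * k - v then qrat T p else t * X (2 * k - p + 1) / X (2 * k - p))" for p
  define m' where "m' p = m (2 * k - p)" for p
  let ?u' = "2 * k - v" and ?v' = "2 * k - u"
  have uv': "?u' < ?v'" using uv by auto
  have m': "1 \<le> m' ?u'" "m' ?u' \<le> ?u'" using m uv by (auto simp: m'_def)
  have qpos: "qrat T u > 0" "qrat T ?u' > 0"
    using qrat_ge[of T u] qrat_ge[of T ?u'] m T by auto
  have a: "a p > 0" if "u \<le> p" "p \<le> v" for p
    using that X[of p] X[of "p - 1"] t qpos by (auto simp: a_def)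
  have a': "a' p > 0" if "?u' \<le> p" "p \<le> ?v'" for p
    using that X[of "2 * k - p"] X[of "2 * k - p + 1"] t qpos uv by (auto simp: a'_def)
  have recip: "T / (t * y / z) = t * z / y" if "y > 0" "z > 0" for y z
    using that t by (simp add: field_simps flip: t(2))
  have super: "a p + qrat T (m p) + T / a (Suc p) \<le> T + 1" if p: "u \<le> p" "p < v" for p
  proof -
    have Xp: "X p > 0" "X (Suc p) > 0" using X p by auto
    have *: "T / a (Suc p) = t * X (Suc p) / X p"
      using p Xp recip by (simp add: a_def)
    have "(a p + qrat T (m p) + T / a (Suc p)) * X p \<le> (T + 1) * X p"
      unfolding * using p left inner[of p] Xp
      by (cases "p = u") (auto simp: a_def algebra_simps)
    then show ?thesis using Xp by simp
  qed
  have super': "a' p + qrat T (m' p) + T / a' (Suc p) \<le> T + 1" if p: "?u' \<le> p" "p < ?v'" for p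
  proof -
    let ?q = "2 * k - p"
    have q: "u < ?q" "?q \<le> v" and q1: "2 * k - Suc p = ?q - 1" "Suc (?q - 1) = ?q"
      using p uv by auto
    have Xp: "X ?q > 0" "X (?q - 1) > 0" using X q by auto
    have "a' (Suc p) = t * X ?q / X (?q - 1)"
      using p q1 by (auto simp add: a'_def simp del: One_nat_def)
    then have *: "T / a' (Suc p) = t * X (?q - 1) / X ?q"
      using recip Xp by simp
    have "(a' p + qrat T (m' p) + T / a' (Suc p)) * X ?q \<le> (T + 1) * X ?q"
    proof (cases "p = ?u'")
      case True
      then have "?q = v" using uv by auto
      then show ?thesis unfolding * using right Xp True
        by (auto simp: a'_def m'_def algebra_simps)
    next
      case False
      then have "?q < v" using p uv by auto
      then show ?thesis unfolding * using inner[of ?q] q Xp False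
        by (auto simp: a'_def m'_def algebra_simps)
    qed
    then show ?thesis using Xp by simp
  qed
  have gt: "a (Suc p) > 1" if "u \<le> p" "p < v" for p
    using left_ratio_gt_1[OF T(1) m(1,2) a _ super, of v p] that by (auto simp: a_def)
  have gt': "a' (Suc p) > 1" if "?u' \<le> p" "p < ?v'" for p
    using left_ratio_gt_1[OF T(1) m' a' _ super', of ?v' p] that by (auto simp: a'_def)
  have dual: "a (Suc p) * a' (2 * k - p) = T" if "u \<le> p" "p < v" for p
  proof -
    have "X p > 0" "X (Suc p) > 0" using X that by auto
    moreover have "2 * k - (2 * k - p) = p" using that uv by simp
    moreover have "2 * k - p \<noteq> ?u'" using that uv by auto
    ultimately show ?thesis using that t by (simp add: a_def a'_def)
  qed
  have lt: "a (Suc p) < T" if "u \<le> p" "p < v" for p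
  proof -
    have "a' (Suc (2 * k - p - 1)) > 1" using that uv by (intro gt') auto
    moreover have "Suc (2 * k - p - 1) = 2 * k - p" using that uv by auto
    ultimately show ?thesis using dual[OF that] gt[OF that]
      by (smt (verit) mult_less_cancel_left1)
  qed
  have lt': "a' (Suc p) < T" if "?u' \<le> p" "p < ?v'" for p
  proof -
    let ?q = "2 * k - p - 1"
    have q: "u \<le> ?q" "?q < v" "2 * k - ?q = Suc p" using that uv by auto
    show ?thesis using dual[OF q(1,2)] gt[OF q(1,2)] gt'[OF that] unfolding q(3)
      by (smt (verit) mult_less_cancel_right1)
  qed
  have mle: "m u + m v \<le> k"
  proof -
    have "(\<Sum>p\<in>{u, v}. m p) \<le> (\<Sum>p\<in>{u..v}. m p)" using uv by (intro sum_mono2) auto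
    then show ?thesis using uv mass by simp
  qed
  have mlt: "mass_upto m u p < k" if "u \<le> p" "p < v" for p
  proof -
    have "{u..v} = {u..p} \<union> {Suc p..v}" using that by auto
    then have "(\<Sum>p\<in>{u..v}. m p) = mass_upto m u p + (\<Sum>q\<in>{Suc p..v}. m q)"
      unfolding mass_upto_def by (simp add: sum.union_disjoint)
    moreover have "m v \<le> (\<Sum>q\<in>{Suc p..v}. m q)" using that by (intro member_le_sum) auto
    ultimately show ?thesis using mass m by simp
  qed
  have mlt': "mass_upto m' ?u' p < k" if "?u' \<le> p" "p < ?v'" for p
  proof -
    have "mass_upto m' ?u' p \<le> mass_upto m' ?u' (2 * k - Suc u)"
      unfolding mass_upto_def using that uv by (intro sum_mono2) auto
    also have "\<dots> = (\<Sum>q\<in>{Suc u..v}. m q)"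
      unfolding m'_def using uv by (intro mass_upto_mirror)
    also have "\<dots> < k" using mass m uv by (simp add: sum.atLeast_Suc_atMost)
    finally show ?thesis .
  qed
  let ?p' = "2 * k - Suc u"
  have p': "?u' \<le> ?p'" "?p' < ?v'" using uv by auto
  define Y where "Y = a u + qrat T (m u)"
  define Y' where "Y' = a' ?p' + qrat T (m' ?p')"
  define A where "A = qexc T (m u)"
  define B where "B = qexc T (k - m u)"
  have AB: "A > 0" "B > 0" using qexc_pos T m mle by (auto simp: A_def B_def)
  have M: "mass_upto m u u = m u" by (simp add: mass_upto_def)
  have M': "mass_upto m' ?u' ?p' = k - m u"
  proof -
    have "mass_upto m' ?u' ?p' = (\<Sum>q\<in>{Suc u..v}. m q)"
      unfolding m'_def using uv by (intro mass_upto_mirror)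
    then show ?thesis using mass uv by (simp add: sum.atLeast_Suc_atMost)
  qed
  have L: "T ^ (k + 1) * A * (T - Y) \<le> T ^ (u + 1) * B * (Y - 1) \<and>
      (m u \<noteq> u \<longrightarrow> T ^ (k + 1) * A * (T - Y) < T ^ (u + 1) * B * (Y - 1))"
    using left_potential[OF T eq m(1,2) a _ super lt mlt, of v u] uv
    unfolding M by (auto simp: a_def A_def B_def Y_def)
  have kk: "k - (k - m u) = m u" using mle by simp
  have R: "T ^ (k + 1) * B * (T - Y') \<le> T ^ (?p' + 1) * A * (Y' - 1) \<and>
      (\<not> (m' ?u' = ?u' \<and> k - m u = ?u') \<longrightarrow>
        T ^ (k + 1) * B * (T - Y') < T ^ (?p' + 1) * A * (Y' - 1))"
    using left_potential[OF T eq m' a' _ super' lt' mlt', of ?v' ?p'] p'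
    unfolding M' kk A_def B_def Y'_def by (simp add: a'_def)
  have pos: "T - Y > 0" "T - Y' > 0"
  proof -
    have "T / a (Suc u) > 1" using lt[of u] gt[of u] uv by auto
    then show "T - Y > 0" using super[of u] uv by (simp add: Y_def)
    have "T / a' (Suc ?p') > 1" using lt'[of ?p'] gt'[of ?p'] p' by auto
    then show "T - Y' > 0" using super'[of ?p'] p' by (simp add: Y'_def)
  qed
  \<comment> \<open>Read in the two directions, the ratios on this edge have product
    \<open>T\<close>, and \<open>super\<close> and \<open>super'\<close> bound them by
    \<open>1 + (T - Y')\<close> and \<open>1 + (T - Y)\<close>. Multiplying by \<open>T - 1\<close>
    and expanding turns this into \<open>Z * Z' \<le> T ^ 3\<close>.\<close>
  have match: "(Y - 1) * (Y' - 1) \<le> T * ((T - Y) * (T - Y'))"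
  proof -
    have d: "a (Suc u) * a' (Suc ?p') = T"
      using dual[of u] uv by (simp add: Suc_diff_Suc)
    have "T / a (Suc u) = a' (Suc ?p')" "T / a' (Suc ?p') = a (Suc u)"
      using d gt[of u] gt'[of ?p'] uv p' by (auto simp: field_simps)
    then have "a' (Suc ?p') \<le> 1 + (T - Y)" "a (Suc u) \<le> 1 + (T - Y')"
      using super[of u] super'[of ?p'] uv p' by (auto simp: Y_def Y'_def)
    then have "a (Suc u) * a' (Suc ?p') \<le> (1 + (T - Y')) * (1 + (T - Y))"
      using gt[of u] gt'[of ?p'] uv p' by (intro mult_mono) auto
    then have "0 \<le> (T - 1) * ((1 + (T - Y')) * (1 + (T - Y)) - T)"
      unfolding d using T by (intro mult_nonneg_nonneg) auto
    then show ?thesis by (simp add: algebra_simps)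
  qed
  \<comment> \<open>With \<open>A / B\<close> and \<open>B / A\<close> cancelling, the lower bounds
    for \<open>Z\<close> and \<open>Z'\<close> also multiply to \<open>T ^ 3\<close>. Hence neither
    can be strict, and only the equality case of \<open>left_potential\<close> remains on each
    side.\<close>
  have exps: "T ^ (k + 1) * T ^ (k + 1) = T * (T ^ (u + 1) * T ^ (?p' + 1))"
  proof -
    have "k + 1 + (k + 1) = 1 + (u + 1 + (?p' + 1))" using uv by simp
    then have "T ^ (k + 1 + (k + 1)) = T ^ (1 + (u + 1 + (?p' + 1)))" by (rule arg_cong)
    then show ?thesis by (simp only: power_add power_one_right mult.assoc)
  qed
  have neg: "\<not> (T ^ (k + 1) * A * (T - Y)) * (T ^ (k + 1) * B * (T - Y'))
       < (T ^ (u + 1) * B * (Y - 1)) * (T ^ (?p' + 1) * A * (Y' - 1))"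
  proof -
    define W where "W = A * B * (T ^ (u + 1) * T ^ (?p' + 1))"
    have "W > 0" using AB T by (simp add: W_def)
    then have "W * ((Y - 1) * (Y' - 1)) \<le> W * (T * ((T - Y) * (T - Y')))"
      using match by (intro mult_left_mono) auto
    also have "\<dots> = A * B * (T ^ (k + 1) * T ^ (k + 1)) * ((T - Y) * (T - Y'))"
      unfolding exps W_def by simp
    finally show ?thesis by (simp add: W_def ac_simps not_less)
  qed
  have Lp: "0 < T ^ (k + 1) * A * (T - Y)" using T AB pos by simp
  have Rp: "0 < T ^ (k + 1) * B * (T - Y')" using T AB pos by simp
  have "m u = u"
  proof (rule ccontr)
    assume "m u \<noteq> u"
    then show False using L R Lp Rp neg by (smt (verit) mult_strict_mono mult_less_le_imp_less)
  qed
  moreover have "m' ?u' = ?u' \<and> k - m u = ?u'"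
  proof (rule ccontr)
    assume "\<not> ?thesis"
    then show False using L R Lp Rp neg mult_le_less_imp_less by (smt (verit))
  qed
  ultimately show ?thesis using mle uv by (auto simp: m'_def)
qed

section \<open>Perron vectors\<close>

definition nbrs :: "(nat \<Rightarrow> nat \<Rightarrow> bool) \<Rightarrow> nat \<Rightarrow> nat set" where
  "nbrs E v = {w. E v w}"

lemma simple_graph_edgeD:
  assumes "simple_graph n E" "E u v"
  shows "u < n" "v < n" "u \<noteq> v" "E v u"
  using assms by (auto simp: simple_graph_def)

lemma nbrs_subset: "simple_graph n E \<Longrightarrow> nbrs E v \<subseteq> {..<n}"
  by (auto simp: nbrs_def simple_graph_def)

lemma finite_nbrs: "simple_graph n E \<Longrightarrow> finite (nbrs E v)"
  by (rule finite_subset[OF nbrs_subset finite_lessThan])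

lemma adj_matrix_row:
  assumes "simple_graph n E" "v < n" "y \<in> carrier_vec n"
  shows "vec_index (adj_matrix n E *\<^sub>v y) v = (\<Sum>w\<in>nbrs E v. vec_index y w)"
proof -
  have "vec_index (adj_matrix n E *\<^sub>v y) v = (\<Sum>w\<in>{0..<n}. (if E v w then 1 else 0) * vec_index y w)"
    using assms by (auto simp: adj_matrix_def scalar_prod_def intro!: sum.cong)
  also have "\<dots> = (\<Sum>w\<in>{0..<n} \<inter> {w. E v w}. vec_index y w)"
    by (simp add: sum.inter_restrict if_distrib[of "\<lambda>x. x * _"] cong: if_cong)
  also have "{0..<n} \<inter> {w. E v w} = nbrs E v"
    using nbrs_subset[OF assms(1), of v] by (auto simp: nbrs_def)
  finally show ?thesis .
qed

lemma eigenvalue_adj_iff: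
  assumes G: "simple_graph n E"
  shows "eigenvalue (adj_matrix n E) r \<longleftrightarrow>
    (\<exists>y. (\<exists>v<n. y v \<noteq> 0) \<and> (\<forall>v<n. (\<Sum>w\<in>nbrs E v. y w) = r * y v))"
proof
  assume "eigenvalue (adj_matrix n E) r"
  then obtain z where z: "z \<in> carrier_vec n" "z \<noteq> 0\<^sub>v n" "adj_matrix n E *\<^sub>v z = r \<cdot>\<^sub>v z"
    by (auto simp: eigenvalue_def eigenvector_def adj_matrix_def)
  have "\<exists>v<n. vec_index z v \<noteq> 0"
    using z(1,2) by (metis carrier_vecD eq_vecI index_zero_vec)
  moreover have "(\<Sum>w\<in>nbrs E v. vec_index z w) = r * vec_index z v" if "v < n" for v
    using adj_matrix_row[OF G that z(1)] z that by simp
  ultimately show "\<exists>y. (\<exists>v<n. y v \<noteq> 0) \<and> (\<forall>v<n. (\<Sum>w\<in>nbrs E v. y w) = r * y v)" by blast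
next
  assume "\<exists>y. (\<exists>v<n. y v \<noteq> 0) \<and> (\<forall>v<n. (\<Sum>w\<in>nbrs E v. y w) = r * y v)"
  then obtain y where y: "\<exists>v<n. y v \<noteq> 0" "\<And>v. v < n \<Longrightarrow> (\<Sum>w\<in>nbrs E v. y w) = r * y v" by blast
  define z where "z = vec n y"
  have zc: "z \<in> carrier_vec n" by (simp add: z_def)
  have zi: "vec_index z v = y v" if "v < n" for v using that by (simp add: z_def)
  have "adj_matrix n E *\<^sub>v z = r \<cdot>\<^sub>v z"
  proof (rule eq_vecI)
    fix v assume "v < dim_vec (r \<cdot>\<^sub>v z)"
    then have v: "v < n" by (simp add: z_def)
    have "(\<Sum>w\<in>nbrs E v. vec_index z w) = (\<Sum>w\<in>nbrs E v. y w)"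
      using nbrs_subset[OF G, of v] zi by (intro sum.cong) auto
    then show "vec_index (adj_matrix n E *\<^sub>v z) v = vec_index (r \<cdot>\<^sub>v z) v"
      using adj_matrix_row[OF G v zc] y(2)[OF v] v zi zc by simp
  qed (simp add: z_def adj_matrix_def)
  moreover have "z \<noteq> 0\<^sub>v n" using y(1) zi by (metis index_zero_vec(1))
  ultimately show "eigenvalue (adj_matrix n E) r"
    using zc by (auto simp: eigenvalue_def eigenvector_def adj_matrix_def)
qed

text \<open>Another eigenvector \<open>y\<close> is dominated in absolute value by
  \<open>M * x\<close> for a least \<open>M\<close>. At a vertex where equality holds, the triangle
  inequality bounds its eigenvalue by \<open>r\<close>.\<close>

lemma spectral_radius_eqI:
  fixes x :: "nat \<Rightarrow> real"
  assumes G: "simple_graph n E" and n: "n > 0"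
    and pos: "\<And>v. v < n \<Longrightarrow> x v > 0"
    and eig: "\<And>v. v < n \<Longrightarrow> (\<Sum>w\<in>nbrs E v. x w) = r * x v"
  shows "spectral_radius_graph n E = r"
  unfolding spectral_radius_graph_def
proof (rule Max_eqI)
  have "adj_matrix n E \<in> carrier_mat n n" by (simp add: adj_matrix_def)
  then have "{r. eigenvalue (adj_matrix n E) r} \<subseteq> {r. poly (char_poly (adj_matrix n E)) r = 0}"
    using eigenvalue_root_char_poly by blast
  moreover have "char_poly (adj_matrix n E) \<noteq> 0"
    using degree_monic_char_poly[of "adj_matrix n E" n] by (auto simp: adj_matrix_def)
  ultimately show "finite {r. eigenvalue (adj_matrix n E) r}"
    by (metis (no_types) finite_subset poly_roots_finite)
  show "r \<in> {r. eigenvalue (adj_matrix n E) r}"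
    unfolding mem_Collect_eq eigenvalue_adj_iff[OF G]
    using pos[OF n] eig n by (intro exI[of _ x] conjI exI[of _ 0]) auto
next
  fix s assume "s \<in> {r. eigenvalue (adj_matrix n E) r}"
  then obtain y where y: "\<exists>v<n. y v \<noteq> 0" "\<And>v. v < n \<Longrightarrow> (\<Sum>w\<in>nbrs E v. y w) = s * y v"
    using eigenvalue_adj_iff[OF G] by auto
  define M where "M = Max ((\<lambda>v. \<bar>y v\<bar> / x v) ` {..<n})"
  have fin: "finite ((\<lambda>v. \<bar>y v\<bar> / x v) ` {..<n})" "(\<lambda>v. \<bar>y v\<bar> / x v) ` {..<n} \<noteq> {}"
    using n by auto
  have le: "\<bar>y v\<bar> \<le> M * x v" if "v < n" for v
  proof -
    have "\<bar>y v\<bar> / x v \<le> M" unfolding M_def using fin that by (intro Max_ge) auto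
    then show ?thesis using pos[OF that] by (simp add: field_simps)
  qed
  obtain u where u: "u < n" "M = \<bar>y u\<bar> / x u"
    using Max_in[OF fin] by (auto simp: M_def)
  obtain v0 where v0: "v0 < n" "y v0 \<noteq> 0" using y(1) by blast
  have "M > 0"
  proof -
    have "0 < M * x v0" using le[OF v0(1)] v0(2) by linarith
    then show ?thesis using pos[OF v0(1)] by (simp add: zero_less_mult_iff)
  qed
  have "\<bar>s\<bar> * \<bar>y u\<bar> = \<bar>\<Sum>w\<in>nbrs E u. y w\<bar>" using y(2)[OF u(1)] by (simp add: abs_mult)
  also have "\<dots> \<le> (\<Sum>w\<in>nbrs E u. \<bar>y w\<bar>)" by (rule sum_abs)
  also have "\<dots> \<le> (\<Sum>w\<in>nbrs E u. M * x w)"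
    using le nbrs_subset[OF G, of u] by (intro sum_mono) auto
  also have "\<dots> = M * (r * x u)" using eig[OF u(1)] by (simp flip: sum_distrib_left)
  also have "\<dots> = r * \<bar>y u\<bar>" using u pos[OF u(1)] by simp
  finally have "\<bar>s\<bar> * \<bar>y u\<bar> \<le> r * \<bar>y u\<bar>" .
  moreover have "\<bar>y u\<bar> > 0" using \<open>M > 0\<close> u pos[OF u(1)] by (simp add: zero_less_divide_iff)
  ultimately show "s \<le> r" by simp
qed

text \<open>The first-order condition at a maximum without derivatives: for small \<open>e\<close>
  of the sign of \<open>a\<close> the linear term wins.\<close>

lemma quadratic_perturbation_zero:
  fixes a b :: real
  assumes "\<And>e. 2 * e * a + e\<^sup>2 * b \<le> 0"
  shows "a = 0"
proof (rule ccontr)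
  assume a: "a \<noteq> 0"
  define e where "e = a / (1 + \<bar>b\<bar>)"
  have p: "1 + \<bar>b\<bar> > 0" by simp
  have ae: "a = e * (1 + \<bar>b\<bar>)" using p by (simp add: e_def)
  have e0: "e\<^sup>2 > 0" using a ae by auto
  have "2 * e * a + e\<^sup>2 * b = e\<^sup>2 * (2 + 2 * \<bar>b\<bar> + b)"
    by (subst ae) (simp add: power2_eq_square algebra_simps)
  moreover have "e\<^sup>2 * (2 + 2 * \<bar>b\<bar> + b) > 0" using e0 by (intro mult_pos_pos) auto
  ultimately show False using assms[of e] by simp
qed

text \<open>Maximises the Rayleigh quotient over nonnegative vectors. Taking absolute values shows
  that signed vectors do no better, so the maximiser is stationary in every coordinate direction and
  hence an eigenvector. A zero entry would spread along walks to every vertex.\<close>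

lemma perron_vector_exists:
  assumes G: "simple_graph n E" and C: "connected_graph n E" and n: "n > 0"
  shows "\<exists>x. (\<forall>v<n. x v > 0) \<and> (\<forall>v<n. (\<Sum>w\<in>nbrs E v. x w) = spectral_radius_graph n E * x v)"
proof -
  define R where "R x = (\<Sum>v<n. x v * (\<Sum>w\<in>nbrs E v. x w))" for x :: "nat \<Rightarrow> real"
  define N where "N x = (\<Sum>v<n. (x v)\<^sup>2)" for x :: "nat \<Rightarrow> real"
  \<comment> \<open>The cube has one factor for every natural number, so that its compactness is
    that of a product; \<open>R\<close> and \<open>N\<close> read only the coordinates below
    \<open>n\<close>.\<close>
  define B where "B = (\<Pi>\<^sub>E v\<in>(UNIV::nat set). {0..1::real})"
  define K where "K = B \<inter> {x :: nat \<Rightarrow> real. N x = 1}"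
  have cN: "continuous_on UNIV N" unfolding N_def
    by (intro continuous_intros continuous_on_product_coordinates)
  have cR: "continuous_on UNIV R" unfolding R_def
    by (intro continuous_intros continuous_on_product_coordinates)
  have "compactin (product_topology (\<lambda>i. euclidean) UNIV) B"
    unfolding B_def by (subst compactin_PiE) auto
  then have "compact B" by (simp add: euclidean_product_topology)
  moreover have "closed {x :: nat \<Rightarrow> real. N x = 1}"
    by (intro closed_Collect_eq cN continuous_on_const)
  ultimately have "compact K" unfolding K_def by (rule compact_Int_closed)
  moreover have "K \<noteq> {}"
  proof -
    have "(\<lambda>v. if v = 0 then 1 else 0) \<in> K"
      using n by (auto simp: K_def B_def N_def if_distrib[of "\<lambda>x. x ^ 2"] cong: if_cong)
    then show ?thesis by blast
  qed
  ultimately obtain x where x: "x \<in> K" and xmax: "\<And>y. y \<in> K \<Longrightarrow> R y \<le> R x"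
    using continuous_attains_sup[of K R] continuous_on_subset[OF cR] by blast
  have x0: "x v \<ge> 0" for v using x by (auto simp: K_def B_def PiE_def Pi_def)
  have Nx: "N x = 1" using x by (simp add: K_def)
  define r where "r = R x"
  have Rle: "R y \<le> r * N y" for y
  proof (cases "N y = 0")
    case True
    then have "y v = 0" if "v < n" for v
      using that by (auto simp: N_def sum_nonneg_eq_0_iff)
    then have "R y = 0" by (simp add: R_def)
    then show ?thesis using True by simp
  next
    case False
    then have Npos: "N y > 0" using sum_nonneg[of "{..<n}" "\<lambda>v. (y v)\<^sup>2"] by (simp add: N_def less_le)
    define c where "c = sqrt (N y)"
    have c: "c > 0" "c\<^sup>2 = N y" using Npos by (auto simp: c_def)
    define z where "z v = (if v < n then \<bar>y v\<bar> / c else 0)" for v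
    have "N z = N y / c\<^sup>2"
      by (simp add: N_def z_def power_divide sum_divide_distrib)
    then have Nz: "N z = 1" using c Npos by simp
    have "z v \<le> 1" for v
    proof (cases "v < n")
      case True
      then have "(z v)\<^sup>2 \<le> N z" unfolding N_def by (intro member_le_sum) auto
      then show ?thesis unfolding Nz by (simp add: abs_square_le_1)
    qed (simp add: z_def)
    then have "z \<in> K" using Nz c by (auto simp: K_def B_def z_def)
    then have "R z \<le> r" unfolding r_def by (rule xmax)
    moreover have "R y \<le> c\<^sup>2 * R z"
    proof -
      have "c\<^sup>2 * R z = (\<Sum>v<n. c\<^sup>2 * (z v * (\<Sum>w\<in>nbrs E v. z w)))"
        unfolding R_def by (rule sum_distrib_left)
      also have "\<dots> = (\<Sum>v<n. \<bar>y v\<bar> * (\<Sum>w\<in>nbrs E v. \<bar>y w\<bar>))"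
      proof (rule sum.cong[OF refl])
        fix v assume v: "v \<in> {..<n}"
        have "(\<Sum>w\<in>nbrs E v. c * z w) = (\<Sum>w\<in>nbrs E v. \<bar>y w\<bar>)"
          using nbrs_subset[OF G, of v] c by (intro sum.cong) (auto simp: z_def)
        then have "c * (\<Sum>w\<in>nbrs E v. z w) = (\<Sum>w\<in>nbrs E v. \<bar>y w\<bar>)"
          by (simp add: sum_distrib_left)
        moreover have "c * z v = \<bar>y v\<bar>" using v c by (simp add: z_def)
        ultimately have "\<bar>y v\<bar> * (\<Sum>w\<in>nbrs E v. \<bar>y w\<bar>) = (c * z v) * (c * (\<Sum>w\<in>nbrs E v. z w))"
          by simp
        then show "c\<^sup>2 * (z v * (\<Sum>w\<in>nbrs E v. z w)) = \<bar>y v\<bar> * (\<Sum>w\<in>nbrs E v. \<bar>y w\<bar>)"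
          by (simp add: power2_eq_square)
      qed
      finally have "c\<^sup>2 * R z = (\<Sum>v<n. \<bar>y v\<bar> * (\<Sum>w\<in>nbrs E v. \<bar>y w\<bar>))" .
      moreover have "R y \<le> (\<Sum>v<n. \<bar>y v\<bar> * (\<Sum>w\<in>nbrs E v. \<bar>y w\<bar>))"
        unfolding R_def
      proof (rule sum_mono)
        fix v
        have "y v * (\<Sum>w\<in>nbrs E v. y w) \<le> \<bar>y v\<bar> * \<bar>\<Sum>w\<in>nbrs E v. y w\<bar>"
          unfolding abs_mult[symmetric] by (rule abs_ge_self)
        also have "\<dots> \<le> \<bar>y v\<bar> * (\<Sum>w\<in>nbrs E v. \<bar>y w\<bar>)"
          by (intro mult_left_mono sum_abs) auto
        finally show "y v * (\<Sum>w\<in>nbrs E v. y w) \<le> \<bar>y v\<bar> * (\<Sum>w\<in>nbrs E v. \<bar>y w\<bar>)" .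
      qed
      ultimately show ?thesis by simp
    qed
    moreover have "c\<^sup>2 * R z \<le> c\<^sup>2 * r" using \<open>R z \<le> r\<close> by (intro mult_left_mono) auto
    ultimately show ?thesis using c(2) by (simp add: mult.commute)
  qed
  have eig: "(\<Sum>w\<in>nbrs E u. x w) = r * x u" if u: "u < n" for u
  proof -
    let ?s = "\<Sum>w\<in>nbrs E u. x w"
    have "2 * e * (?s - r * x u) + e\<^sup>2 * (- r) \<le> 0" for e
    proof -
      define y where "y v = x v + e * (if v = u then 1 else 0)" for v
      have "N y = (\<Sum>v<n. (x v)\<^sup>2 + (if v = u then 2 * e * x u + e\<^sup>2 else 0))"
        unfolding N_def y_def by (intro sum.cong) (auto simp: power2_eq_square algebra_simps)
      also have "\<dots> = N x + (2 * e * x u + e\<^sup>2)"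
        using u by (simp add: N_def sum.distrib)
      finally have Ny: "N y = 1 + 2 * e * x u + e\<^sup>2" using Nx by simp
      have s: "(\<Sum>w\<in>nbrs E v. y w) = (\<Sum>w\<in>nbrs E v. x w) + e * (if E v u then 1 else 0)" for v
      proof -
        have "(\<Sum>w\<in>nbrs E v. (if w = u then 1 else 0 :: real)) = (if E v u then 1 else 0)"
          using finite_nbrs[OF G, of v] by (simp add: sum.delta' nbrs_def)
        then show ?thesis by (simp add: y_def sum.distrib flip: sum_distrib_left)
      qed
      have symsum: "(\<Sum>v<n. x v * (if E v u then 1 else 0)) = ?s"
      proof -
        have "nbrs E u = {..<n} \<inter> {v. E v u}"
          using nbrs_subset[OF G, of u] simple_graph_edgeD[OF G] by (auto simp: nbrs_def)
        then show ?thesis by (simp add: sum.inter_restrict if_distrib cong: if_cong)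
      qed
      have "R y = (\<Sum>v<n. x v * (\<Sum>w\<in>nbrs E v. x w) + e * (x v * (if E v u then 1 else 0))
          + (if v = u then e * ?s else 0))"
        unfolding R_def s using simple_graph_edgeD(3)[OF G]
        by (intro sum.cong) (auto simp: y_def algebra_simps)
      also have "\<dots> = R x + e * ?s + e * ?s"
        using u symsum by (simp add: R_def sum.distrib flip: sum_distrib_left)
      finally have "R y = r + 2 * e * ?s" by (simp add: r_def)
      then show ?thesis using Rle[of y] Ny by (simp add: algebra_simps)
    qed
    then have "?s - r * x u = 0" by (rule quadratic_perturbation_zero)
    then show ?thesis by simp
  qed
  have spread: "walk E k u v \<Longrightarrow> u < n \<Longrightarrow> x u = 0 \<Longrightarrow> x v = 0" for k u v
  proof (induction rule: walk.induct)
    case (walkS u w k v)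
    have "(\<Sum>w\<in>nbrs E u. x w) = 0" using eig[of u] walkS by simp
    then have "x w = 0"
      using x0 finite_nbrs[OF G] walkS by (subst (asm) sum_nonneg_eq_0_iff) (auto simp: nbrs_def)
    then show ?case using walkS simple_graph_edgeD[OF G] by auto
  qed
  have pos: "x v > 0" if v: "v < n" for v
  proof (rule ccontr)
    assume "\<not> x v > 0"
    then have "x v = 0" using x0[of v] by simp
    then have "x w = 0" if "w < n" for w
      using C spread v that by (metis connected_graph_def)
    then show False using Nx by (simp add: N_def)
  qed
  have "spectral_radius_graph n E = r"
    using spectral_radius_eqI[OF G n pos eig] by simp
  then show ?thesis using pos eig by blast
qed

text \<open>Pair the inequality for \<open>x\<close> on \<open>G\<close> with the equation for
  \<open>y\<close> on \<open>H\<close>. By symmetry the edges of \<open>H\<close> cancel, and the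
  remaining edges of \<open>G\<close> contribute products \<open>y v * x w\<close> that are positive
  but have sum at most 0.\<close>

lemma spanning_subgraph_eqI:
  fixes x y :: "nat \<Rightarrow> real"
  assumes G: "simple_graph n G" and H: "simple_graph n H" and n: "n > 0"
    and sub: "\<And>u v. H u v \<Longrightarrow> G u v"
    and x: "\<And>v. v < n \<Longrightarrow> x v > 0" "\<And>v. v < n \<Longrightarrow> (\<Sum>w\<in>nbrs G v. x w) \<le> r * x v"
    and y: "\<And>v. v < n \<Longrightarrow> y v > 0" "\<And>v. v < n \<Longrightarrow> (\<Sum>w\<in>nbrs H v. y w) = r * y v"
  shows "G = H"
proof -
  have double: "(\<Sum>v<n. f v * (\<Sum>w\<in>nbrs F v. g w)) = (\<Sum>v<n. \<Sum>w<n. if F v w then f v * g w else 0)"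
    if "simple_graph n F" for F and f g :: "nat \<Rightarrow> real"
  proof (rule sum.cong[OF refl])
    fix v
    have "nbrs F v = {..<n} \<inter> {w. F v w}" using nbrs_subset[OF that, of v] by (auto simp: nbrs_def)
    then show "f v * (\<Sum>w\<in>nbrs F v. g w) = (\<Sum>w<n. if F v w then f v * g w else 0)"
      by (simp add: sum.inter_restrict sum_distrib_left if_distrib cong: if_cong)
  qed
  define D where "D v w = (if G v w then y v * x w else 0) - (if H v w then y v * x w else 0)" for v w
  have D0: "D v w \<ge> 0" if "v < n" "w < n" for v w
    using sub x(1) y(1) that by (auto simp: D_def less_imp_le)
  have "(\<Sum>v<n. \<Sum>w<n. D v w) = (\<Sum>v<n. y v * (\<Sum>w\<in>nbrs G v. x w)) - (\<Sum>v<n. y v * (\<Sum>w\<in>nbrs H v. x w))"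
    unfolding D_def by (simp add: sum_subtractf double[OF G] double[OF H])
  also have "(\<Sum>v<n. y v * (\<Sum>w\<in>nbrs H v. x w)) = (\<Sum>v<n. x v * (\<Sum>w\<in>nbrs H v. y w))"
    unfolding double[OF H] using simple_graph_edgeD(4)[OF H]
    by (subst sum.swap) (intro sum.cong, auto)
  also have "\<dots> = (\<Sum>v<n. y v * (r * x v))" using y(2) by (intro sum.cong) auto
  also have "(\<Sum>v<n. y v * (\<Sum>w\<in>nbrs G v. x w)) \<le> (\<Sum>v<n. y v * (r * x v))"
    using x(2) y(1) by (intro sum_mono mult_left_mono) (auto simp: less_imp_le)
  finally have le: "(\<Sum>v<n. \<Sum>w<n. D v w) \<le> 0" by simp
  have "D v w = 0" if "v < n" "w < n" for v w
  proof -
    have "D v w \<le> (\<Sum>w<n. D v w)" using D0 that by (intro member_le_sum) auto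
    also have "\<dots> \<le> (\<Sum>v<n. \<Sum>w<n. D v w)"
      using D0 that by (intro member_le_sum[of v _ "\<lambda>v. \<Sum>w<n. D v w"] sum_nonneg) auto
    finally show ?thesis using le D0[OF that] by simp
  qed
  then have "H v w" if "G v w" for v w
    using that simple_graph_edgeD(1,2)[OF G that] x(1)[of w] y(1)[of v]
    by (force simp: D_def split: if_splits)
  then show ?thesis using sub by blast
qed

section \<open>Graphs of small spectral radius\<close>

lemma walk_append: "walk E a u v \<Longrightarrow> walk E b v w \<Longrightarrow> walk E (a + b) u w"
  by (induction rule: walk.induct) (auto intro: walk.intros)

lemma walk_rev: "walk E a u v \<Longrightarrow> (\<And>u v. E u v \<Longrightarrow> E v u) \<Longrightarrow> walk E a v u"
proof (induction rule: walk.induct)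
  case (walkS u w k v)
  have "walk E 1 w u" using walkS(1,4) by (auto intro: walk.intros)
  then show ?case using walk_append[OF walkS(3)] walkS(4) by fastforce
qed (rule walk.intros)

lemma walk_path: "walk E a u v \<Longrightarrow> \<exists>P. P 0 = u \<and> P a = v \<and> (\<forall>i<a. E (P i) (P (Suc i)))"
proof (induction rule: walk.induct)
  case (walkS u w k v)
  then obtain P where P: "P 0 = w" "P k = v" "\<forall>i<k. E (P i) (P (Suc i))" by blast
  have "\<forall>i<Suc k. E (case_nat u P i) (case_nat u P (Suc i))"
    using P walkS(1) by (auto simp: less_Suc_eq_0_disj)
  then show ?case using P by (intro exI[of _ "case_nat u P"]) auto
qed auto

lemma path_walk: "(\<And>i. a \<le> i \<Longrightarrow> i < b \<Longrightarrow> E (P i) (P (Suc i))) \<Longrightarrow> a \<le> b \<Longrightarrow> walk E (b - a) (P a) (P b)"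
proof (induction "b - a" arbitrary: a)
  case (Suc l)
  then have "walk E (b - Suc a) (P (Suc a)) (P b)" by auto
  moreover have "b - a = Suc (b - Suc a)" "E (P a) (P (Suc a))" using Suc by auto
  ultimately show ?case by (metis walkS)
qed (auto intro: walk.intros)

locale conn_graph =
  fixes n :: nat and E :: "nat \<Rightarrow> nat \<Rightarrow> bool"
  assumes simple: "simple_graph n E" and conn: "connected_graph n E"
begin

abbreviation d where "d \<equiv> graph_dist E"

lemmas edgeD = simple_graph_edgeD[OF simple]

lemma dist_walk: "u < n \<Longrightarrow> v < n \<Longrightarrow> walk E (d u v) u v"
  unfolding graph_dist_def by (rule LeastI_ex) (use conn in \<open>auto simp: connected_graph_def\<close>)

lemma dist_le: "walk E l u v \<Longrightarrow> d u v \<le> l"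
  unfolding graph_dist_def by (rule Least_le)

lemma dist_sym: "u < n \<Longrightarrow> v < n \<Longrightarrow> d u v = d v u"
  by (metis dist_walk dist_le walk_rev edgeD(4) le_antisym)

lemma dist_triangle: "u < n \<Longrightarrow> v < n \<Longrightarrow> w < n \<Longrightarrow> d u w \<le> d u v + d v w"
  by (meson dist_walk dist_le walk_append)

lemma dist_self [simp]: "d u u = 0"
  using dist_le[OF walk.walk0, of u] by simp

definition geodesic :: "(nat \<Rightarrow> nat) \<Rightarrow> nat \<Rightarrow> bool" where
  "geodesic P L \<longleftrightarrow> (\<forall>a\<le>L. P a < n) \<and> (\<forall>a<L. E (P a) (P (Suc a))) \<and>
     (\<forall>a b. a \<le> b \<and> b \<le> L \<longrightarrow> d (P a) (P b) = b - a)"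

text \<open>A shortcut between two points of the path would shorten the whole path below the
  distance of its ends.\<close>

lemma geodesicI:
  assumes P: "\<And>a. a \<le> L \<Longrightarrow> P a < n" "\<And>a. a < L \<Longrightarrow> E (P a) (P (Suc a))" "d (P 0) (P L) = L"
  shows "geodesic P L"
proof -
  have "d (P a) (P b) = b - a" if ab: "a \<le> b" "b \<le> L" for a b
  proof -
    have w: "d (P i) (P j) \<le> j - i" if "i \<le> j" "j \<le> L" for i j
      using path_walk[of i j E P] P that by (intro dist_le) auto
    have "L \<le> d (P 0) (P b) + d (P b) (P L)" using P dist_triangle[of "P 0" "P b" "P L"] ab by auto
    also have "d (P 0) (P b) \<le> d (P 0) (P a) + d (P a) (P b)"
      using P ab by (intro dist_triangle) auto
    finally show ?thesis using w[of 0 a] w[of a b] w[of b L] ab by simp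
  qed
  then show ?thesis using P by (auto simp: geodesic_def)
qed

lemma geodesic_exists:
  assumes "u < n" "v < n"
  obtains P where "P 0 = u" "P (d u v) = v" "geodesic P (d u v)"
proof -
  obtain P where P: "P 0 = u" "P (d u v) = v" "\<forall>i<d u v. E (P i) (P (Suc i))"
    using walk_path[OF dist_walk[OF assms]] by blast
  have "P a < n" if "a \<le> d u v" for a
    using P(3) that edgeD(1)[of "P a" "P (Suc a)"] P(2) assms by (cases "a = d u v") auto
  then show ?thesis using P that geodesicI[of "d u v" P] by auto
qed

lemma geodesicD:
  assumes "geodesic P L"
  shows "a \<le> L \<Longrightarrow> P a < n" "a < L \<Longrightarrow> E (P a) (P (Suc a))" "a \<le> b \<Longrightarrow> b \<le> L \<Longrightarrow> d (P a) (P b) = b - a"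
  using assms by (auto simp: geodesic_def)

lemma geodesic_inj: "geodesic P L \<Longrightarrow> a \<le> L \<Longrightarrow> b \<le> L \<Longrightarrow> P a = P b \<Longrightarrow> a = b"
  by (metis dist_self geodesicD(3) diff_is_0_eq le_antisym linear)

lemma geodesic_ne: "geodesic P L \<Longrightarrow> a \<le> L \<Longrightarrow> b \<le> L \<Longrightarrow> a \<noteq> b \<Longrightarrow> P a \<noteq> P b"
  using geodesic_inj by blast

lemma geodesic_pred: "geodesic P L \<Longrightarrow> 0 < a \<Longrightarrow> a \<le> L \<Longrightarrow> E (P a) (P (a - 1))"
  using geodesicD(2)[of P L "a - 1"] edgeD(4) by simp

lemma geodesic_rev: "geodesic P L \<Longrightarrow> geodesic (\<lambda>a. P (L - a)) L"
proof (rule geodesicI)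
  assume P: "geodesic P L"
  show "P (L - a) < n" for a using geodesicD(1)[OF P] by simp
  show "E (P (L - a)) (P (L - Suc a))" if "a < L" for a
    using geodesic_pred[OF P, of "L - a"] that by simp
  show "d (P (L - 0)) (P (L - L)) = L"
    using geodesicD(1,3)[OF P] dist_sym[of "P 0" "P L"] by simp
qed

end

section \<open>Lower bounds for the ratios of neighbouring values\<close>

text \<open>The inequality is unrolled from the far end \<open>z m\<close> towards the root
  \<open>z 0\<close>, each vertex using the bound for the part beyond it. The start value
  \<open>r 0\<close> is the load at the far end: 0 for a leaf, \<open>2 / lam\<close> for a
  fork.\<close>

lemma ratio_chain:
  fixes r :: "nat \<Rightarrow> real" and z :: "nat \<Rightarrow> real"
  assumes r: "\<And>i. i < m \<Longrightarrow> lam - r i > 0 \<and> r (Suc i) = 1 / (lam - r i)"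
    and last: "z (m - 1) + r 0 * z m \<le> lam * z m"
    and inner: "\<And>a. 1 \<le> a \<Longrightarrow> a < m \<Longrightarrow> z (a - 1) + z (Suc a) \<le> lam * z a"
    and m: "m \<ge> 1"
  shows "z 1 \<ge> r m * z 0"
proof -
  have "z (m - j) \<ge> r (Suc j) * z (m - Suc j)" if "j < m" for j
    using that
  proof (induction j)
    case 0
    have "z (m - 1) \<le> (lam - r 0) * z m" using last by (simp add: algebra_simps)
    then show ?case using r[of 0] 0 by (simp add: field_simps)
  next
    case (Suc j)
    then have IH: "r (Suc j) * z (m - Suc j) \<le> z (m - j)" by simp
    have "z (m - Suc j - 1) + z (Suc (m - Suc j)) \<le> lam * z (m - Suc j)"
      using Suc.prems by (intro inner) auto
    moreover have "Suc (m - Suc j) = m - j" using Suc.prems by simp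
    ultimately have "z (m - Suc (Suc j)) \<le> (lam - r (Suc j)) * z (m - Suc j)"
      using IH by (simp add: algebra_simps)
    then show ?case using r[of "Suc j"] Suc.prems by (simp add: field_simps)
  qed
  from this[of "m - 1"] show ?thesis using m by simp
qed

text \<open>\<open>g m\<close> is the least possible ratio at the root of a pendent path of length \<open>m\<close>, and \<open>f e\<close> that of a
  path of length \<open>e\<close> ending in a fork. The values for \<open>k = 1\<close>, \<open>k = 2\<close> and \<open>k \<ge> 3\<close> need different
  parametrisations because \<open>lam\<close> is below, equal to and above 2.\<close>

locale extremal_values =
  fixes k :: nat and lam :: real and g f :: "nat \<Rightarrow> real"
  assumes k1: "k \<ge> 1" and lam_pos: "lam > 0"
    and g0: "g 0 = 0" and gS: "m < 2 * k \<Longrightarrow> lam - g m > 0 \<and> g (Suc m) = 1 / (lam - g m)"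
    and g_mono: "a \<le> b \<Longrightarrow> b \<le> 2 * k \<Longrightarrow> g a \<le> g b"
    and f0: "f 0 = 2 / lam" and fS: "Suc m < k \<Longrightarrow> lam - f m > 0 \<and> f (Suc m) = 1 / (lam - f m)"
    and fork: "p \<le> 2 * k \<Longrightarrow> (e < p \<and> e < 2 * k - p) \<or> (e \<le> p \<and> p < k \<and> k \<le> 2 * p) \<Longrightarrow>
       lam < g p + g (2 * k - p) + f e"
    and rigid: "\<And>(X :: nat \<Rightarrow> real) m u v.
       u < v \<Longrightarrow> v \<le> 2 * k \<Longrightarrow> 1 \<le> m u \<Longrightarrow> m u \<le> u \<Longrightarrow> 1 \<le> m v \<Longrightarrow> m v \<le> 2 * k - v \<Longrightarrow>
       (\<Sum>p\<in>{u..v}. m p) = k \<Longrightarrow>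
       (\<And>p. u \<le> p \<Longrightarrow> p \<le> v \<Longrightarrow> X p > 0) \<Longrightarrow>
       X (Suc u) + (g u + g (m u)) * X u \<le> lam * X u \<Longrightarrow>
       X (v - 1) + (g (2 * k - v) + g (m v)) * X v \<le> lam * X v \<Longrightarrow>
       (\<And>p. u < p \<Longrightarrow> p < v \<Longrightarrow> X (p - 1) + X (Suc p) + g (m p) * X p \<le> lam * X p) \<Longrightarrow>
       m u = u \<and> m v = 2 * k - v \<and> m u + m v = k"
    and small: "k = 1 \<Longrightarrow> lam * lam < 4"

text \<open>\<open>x_super\<close> is an inequality so that graphs with spectral radius below
  \<open>lam\<close> are covered as well. The geodesic \<open>P\<close> is a parameter because the
  arguments are also applied to its reversal.\<close>

locale extremal_graph = extremal_values + conn_graph +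
  fixes x :: "nat \<Rightarrow> real" and P :: "nat \<Rightarrow> nat"
  assumes n: "n = 3 * k + 1"
    and diam: "u < n \<Longrightarrow> v < n \<Longrightarrow> graph_dist E u v \<le> 2 * k"
    and x_pos: "v < n \<Longrightarrow> x v > 0"
    and x_super: "v < n \<Longrightarrow> (\<Sum>w\<in>nbrs E v. x w) \<le> lam * x v"
    and P: "geodesic P (2 * k)"
begin

lemmas Pn = geodesicD(1)[OF P] and Pe = geodesicD(2)[OF P] and Pd = geodesicD(3)[OF P]
  and Pinj = geodesic_inj[OF P] and Pne = geodesic_ne[OF P] and Pp = geodesic_pred[OF P]

lemma nbr_sum_le:
  assumes "v < n" "\<And>w. w \<in> F \<Longrightarrow> E v w"
  shows "(\<Sum>w\<in>F. x w) \<le> lam * x v"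
proof -
  have "(\<Sum>w\<in>F. x w) \<le> (\<Sum>w\<in>nbrs E v. x w)"
    using assms edgeD(2) x_pos finite_nbrs[OF simple]
    by (intro sum_mono2) (auto simp: nbrs_def less_imp_le)
  then show ?thesis using x_super[OF assms(1)] by simp
qed

lemma nbr_le1: "E v a \<Longrightarrow> x a \<le> lam * x v"
  using nbr_sum_le[of v "{a}"] edgeD by auto

lemma nbr_le2: "E v a \<Longrightarrow> E v b \<Longrightarrow> a \<noteq> b \<Longrightarrow> x a + x b \<le> lam * x v"
  using nbr_sum_le[of v "{a, b}"] edgeD by auto

lemma nbr_le3: "E v a \<Longrightarrow> E v b \<Longrightarrow> E v c \<Longrightarrow> distinct [a, b, c] \<Longrightarrow> x a + x b + x c \<le> lam * x v"
  using nbr_sum_le[of v "{a, b, c}"] edgeD by (auto simp: add.assoc)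

definition U where "U = {v. v < n} - P ` {..2 * k}"

lemma U_D: "v \<in> U \<Longrightarrow> v < n" "v \<in> U \<Longrightarrow> p \<le> 2 * k \<Longrightarrow> P p \<noteq> v"
  by (auto simp: U_def)

lemma U_I: "v < n \<Longrightarrow> v \<notin> P ` {..2 * k} \<Longrightarrow> v \<in> U"
  by (auto simp: U_def)

lemma finite_U: "finite U" by (simp add: U_def)

lemma card_U: "card U = k"
proof -
  have "inj_on P {..2 * k}" using Pinj by (auto intro: inj_onI)
  then have "card (P ` {..2 * k}) = 2 * k + 1" by (simp add: card_image)
  moreover have "P ` {..2 * k} \<subseteq> {v. v < n}" using Pn by auto
  ultimately show ?thesis unfolding U_def using n by (subst card_Diff_subset) auto
qed

lemma path_ratio:
  assumes m: "1 \<le> m" "m \<le> 2 * k" and e: "\<And>a. a < m \<Longrightarrow> E (y a) (y (Suc a))"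
    and ne: "\<And>a. 1 \<le> a \<Longrightarrow> a < m \<Longrightarrow> y (a - 1) \<noteq> y (Suc a)"
  shows "x (y 1) \<ge> g m * x (y 0)"
proof (rule ratio_chain[where z = "\<lambda>a. x (y a)" and r = g])
  show "i < m \<Longrightarrow> lam - g i > 0 \<and> g (Suc i) = 1 / (lam - g i)" for i
    using gS m by auto
  have "E (y m) (y (m - 1))" using e[of "m - 1"] m edgeD(4) by simp
  then show "x (y (m - 1)) + g 0 * x (y m) \<le> lam * x (y m)" using nbr_le1 g0 by simp
  show "x (y (a - 1)) + x (y (Suc a)) \<le> lam * x (y a)" if "1 \<le> a" "a < m" for a
    using that e[of "a - 1"] e[of a] edgeD(4) ne by (intro nbr_le2) auto
qed (use m in auto)

text \<open>The two further neighbours of \<open>y m\<close> each have at least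
  \<open>1 / lam\<close> of its value, together the start value \<open>f 0\<close>. They may be any
  distinct neighbours, so the fork may also sit on a cycle.\<close>

lemma fork_ratio:
  assumes m: "1 \<le> m" "m < k" and e: "\<And>a. a < m \<Longrightarrow> E (y a) (y (Suc a))"
    and ne: "\<And>a. 1 \<le> a \<Longrightarrow> a < m \<Longrightarrow> y (a - 1) \<noteq> y (Suc a)"
    and w: "E (y m) w" "E (y m) w'" "distinct [y (m - 1), w, w']"
  shows "x (y 1) \<ge> f m * x (y 0)"
proof (rule ratio_chain[where z = "\<lambda>a. x (y a)" and r = f])
  show "i < m \<Longrightarrow> lam - f i > 0 \<and> f (Suc i) = 1 / (lam - f i)" for i
    using fS m by auto
  have "E (y m) (y (m - 1))" using e[of "m - 1"] m edgeD(4) by simp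
  then have "x (y (m - 1)) + x w + x w' \<le> lam * x (y m)" using w by (intro nbr_le3)
  moreover have "x (y m) \<le> lam * x w" "x (y m) \<le> lam * x w'"
    using w edgeD(4) nbr_le1 by auto
  then have "x (y m) / lam \<le> x w" "x (y m) / lam \<le> x w'"
    using lam_pos by (auto simp: field_simps)
  moreover have "f 0 * x (y m) = x (y m) / lam + x (y m) / lam" by (simp add: f0)
  ultimately show "x (y (m - 1)) + f 0 * x (y m) \<le> lam * x (y m)" by linarith
  show "x (y (a - 1)) + x (y (Suc a)) \<le> lam * x (y a)" if "1 \<le> a" "a < m" for a
    using that e[of "a - 1"] e[of a] edgeD(4) ne by (intro nbr_le2) auto
qed (use m in auto)

lemma left_ratio:
  assumes "1 \<le> p" "p \<le> 2 * k"
  shows "x (P (p - 1)) \<ge> g p * x (P p)"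
proof -
  have "x (P (p - 1)) \<ge> g p * x (P (p - 0))"
  proof (rule path_ratio[of p "\<lambda>a. P (p - a)"])
    show "E (P (p - a)) (P (p - Suc a))" if "a < p" for a
      using Pp[of "p - a"] that assms by simp
    show "P (p - (a - 1)) \<noteq> P (p - Suc a)" if "1 \<le> a" "a < p" for a
      using that assms by (intro Pne) auto
  qed (use assms in auto)
  then show ?thesis by simp
qed

lemma right_ratio:
  assumes "p < 2 * k"
  shows "x (P (Suc p)) \<ge> g (2 * k - p) * x (P p)"
proof -
  have "x (P (p + 1)) \<ge> g (2 * k - p) * x (P (p + 0))"
  proof (rule path_ratio[of "2 * k - p" "\<lambda>a. P (p + a)"])
    show "E (P (p + a)) (P (p + Suc a))" if "a < 2 * k - p" for a
      using Pe[of "p + a"] that by simp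
    show "P (p + (a - 1)) \<noteq> P (p + Suc a)" if "1 \<le> a" "a < 2 * k - p" for a
      using that by (intro Pne) auto
  qed (use assms in auto)
  then show ?thesis by simp
qed

text \<open>The local estimate behind the exclusion of forks: the two directions of \<open>P\<close>
  already contribute \<open>g p + g (2 * k - p)\<close> times the value at \<open>P p\<close>, and
  another \<open>f e\<close> exceeds \<open>lam\<close>.\<close>

lemma no_heavy_branch:
  assumes p: "1 \<le> p" "p < 2 * k" and F: "F \<subseteq> U" "\<And>w. w \<in> F \<Longrightarrow> E (P p) w"
    and heavy: "f e * x (P p) \<le> (\<Sum>w\<in>F. x w)" and lam: "lam < g p + g (2 * k - p) + f e"
  shows False
proof -
  have fin: "finite F" using F(1) finite_U by (rule finite_subset)
  have "P (p - 1) \<notin> U" "P (Suc p) \<notin> U" using p by (auto simp: U_def)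
  then have notin: "P (p - 1) \<notin> F" "P (Suc p) \<notin> F" using F(1) by auto
  have ne: "P (p - 1) \<noteq> P (Suc p)" using p by (intro Pne) auto
  have "(\<Sum>w\<in>insert (P (p - 1)) (insert (P (Suc p)) F). x w) \<le> lam * x (P p)"
    using p F Pe[of p] Pp[of p] Pn[of p] by (intro nbr_sum_le) auto
  then have "x (P (p - 1)) + x (P (Suc p)) + (\<Sum>w\<in>F. x w) \<le> lam * x (P p)"
    using fin notin ne by simp
  then have "(g p + g (2 * k - p) + f e) * x (P p) \<le> lam * x (P p)"
    using left_ratio[of p] right_ratio[of p] heavy p by (simp add: algebra_simps)
  then show False using lam x_pos[OF Pn[of p]] p by simp
qed

section \<open>The breadth-first tree from the centre of the geodesic\<close>

abbreviation D where "D v \<equiv> d v (P k)"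

lemma D_P: "p \<le> 2 * k \<Longrightarrow> D (P p) = (if p \<le> k then k - p else p - k)"
  using Pd[of p k] Pd[of k p] dist_sym[of "P k" "P p"] Pn by auto

lemma exists_parent: "v < n \<Longrightarrow> D v > 0 \<Longrightarrow> \<exists>w. E v w \<and> Suc (D w) = D v"
proof -
  assume v: "v < n" "D v > 0"
  obtain Q where Q: "Q 0 = v" "Q (D v) = P k" "geodesic Q (D v)"
    using geodesic_exists[OF v(1) Pn[of k]] by auto
  have "D (Q 1) = D v - 1" using geodesicD(3)[OF Q(3), of 1 "D v"] v Q by simp
  moreover have "E v (Q 1)" using geodesicD(2)[OF Q(3), of 0] v Q by simp
  ultimately show ?thesis using v by force
qed

definition par where "par v = (SOME w. E v w \<and> Suc (D w) = D v)"

lemma par: "v \<in> U \<Longrightarrow> E v (par v)" "v \<in> U \<Longrightarrow> Suc (D (par v)) = D v"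
proof -
  assume v: "v \<in> U"
  have "D v > 0"
  proof (rule ccontr)
    assume "\<not> D v > 0"
    then have "walk E 0 v (P k)" using dist_walk[of v "P k"] U_D(1)[OF v] Pn[of k] by simp
    then have "v = P k" by (cases rule: walk.cases) auto
    then show False using U_D(2)[OF v, of k] by simp
  qed
  then have "E v (par v) \<and> Suc (D (par v)) = D v"
    unfolding par_def by (rule someI_ex[OF exists_parent[OF U_D(1)[OF v]]])
  then show "E v (par v)" "Suc (D (par v)) = D v" by auto
qed

text \<open>\<open>branch p h v\<close>: in the breadth-first tree rooted at the centre \<open>P k\<close> the vertex \<open>v\<close> hangs at height
  \<open>h\<close> above the path vertex \<open>P p\<close>.\<close>

inductive branch :: "nat \<Rightarrow> nat \<Rightarrow> nat \<Rightarrow> bool" where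
  root: "p \<le> 2 * k \<Longrightarrow> branch p 0 (P p)"
| step: "branch p h (par v) \<Longrightarrow> v \<in> U \<Longrightarrow> branch p (Suc h) v"

lemma branch_p: "branch p h v \<Longrightarrow> p \<le> 2 * k"
  by (induction rule: branch.induct) auto

lemma branch_n: "branch p h v \<Longrightarrow> v < n"
  by (cases rule: branch.cases) (auto simp: Pn U_D)

lemma branch_U: "branch p h v \<Longrightarrow> h > 0 \<longleftrightarrow> v \<in> U"
  by (cases rule: branch.cases) (auto simp: U_def)

lemma branch_SucD: "branch p (Suc h) v \<Longrightarrow> v \<in> U \<and> branch p h (par v)"
  by (cases rule: branch.cases) auto

lemma branch_0: "branch p 0 v \<Longrightarrow> v = P p"
  by (cases rule: branch.cases) auto

lemma branch_D: "branch p h v \<Longrightarrow> D v = D (P p) + h"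
  by (induction rule: branch.induct) (auto simp flip: par(2))

lemma branch_exists: "v < n \<Longrightarrow> \<exists>p h. branch p h v"
proof (induction "D v" arbitrary: v rule: less_induct)
  case less
  show ?case
  proof (cases "v \<in> U")
    case True
    then have "D (par v) < D v" "par v < n" using par[OF True] edgeD by auto
    then show ?thesis using less True branch.step by blast
  next
    case False
    then show ?thesis using less(2) branch.root by (auto simp: U_def)
  qed
qed

lemma branch_unique: "branch p h v \<Longrightarrow> branch p' h' v \<Longrightarrow> p = p' \<and> h = h'"
proof (induction arbitrary: p' h' rule: branch.induct)
  case (root p)
  from root(2) show ?case
    by (cases rule: branch.cases) (use root Pinj in \<open>auto simp: U_def\<close>)
next
  case (step p h v)
  obtain h'' where h'': "h' = Suc h''"
    using branch_U[OF step(4)] step(2) by (cases h') auto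
  then show ?case using branch_SucD[of p' h'' v] step(3)[of p' h''] step(4) by simp
qed

lemma branch_height:
  assumes near: "\<And>v. v < n \<Longrightarrow> D v \<le> k" and b: "branch p h v"
  shows "h \<le> p" "h \<le> 2 * k - p"
  using branch_D[OF b] near[OF branch_n[OF b]] D_P[OF branch_p[OF b]] branch_p[OF b]
  by (auto split: if_splits)

text \<open>The tree path from \<open>P p\<close> to the common parent ends in a fork, which lifts
  the contribution of this branch to \<open>f h\<close> and contradicts the local estimate. At
  height 0 the fork is formed by the two children at \<open>P p\<close> itself.\<close>

lemma no_fork:
  assumes near: "\<And>v. v < n \<Longrightarrow> D v \<le> k"
    and w: "w \<in> U" "w' \<in> U" "w \<noteq> w'" "par w = par w'"
  shows False
proof -
  define v where "v = par w"
  obtain p h where b: "branch p h v"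
    using branch_exists edgeD(2)[OF par(1)[OF w(1)]] unfolding v_def by blast
  then have bw: "branch p (Suc h) w" using w by (auto intro: branch.step simp: v_def)
  have h: "Suc h \<le> p" "Suc h \<le> 2 * k - p" using branch_height[OF near bw] by auto
  have lam: "lam < g p + g (2 * k - p) + f h" using h by (intro fork) auto
  have Ew: "E v w" "E v w'" using par(1)[OF w(1)] par(1)[OF w(2)] w(4) edgeD(4) by (auto simp: v_def)
  show False
  proof (cases "h = 0")
    case True
    then have v: "v = P p" using b branch_0 by simp
    have "x v \<le> lam * x w" "x v \<le> lam * x w'" using Ew edgeD(4) nbr_le1 by auto
    then have "x v / lam \<le> x w" "x v / lam \<le> x w'" using lam_pos by (auto simp: field_simps)
    then have "f h * x (P p) \<le> (\<Sum>w\<in>{w, w'}. x w)"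
      using True f0 w(3) by (simp add: v)
    moreover have "1 \<le> p" "p < 2 * k" using h by auto
    ultimately show False
      using no_heavy_branch[of p "{w, w'}" h] w Ew lam unfolding v by blast
  next
    case False
    \<comment> \<open>\<open>y\<close> runs upwards from \<open>P p\<close> to \<open>v\<close>,
      hence the iteration count \<open>h - a\<close>.\<close>
    define y where "y a = (par ^^ (h - a)) v" for a
    have yb: "branch p (h - a) ((par ^^ a) v)" if "a \<le> h" for a
      using that
    proof (induction a)
      case (Suc a)
      then have "branch p (Suc (h - Suc a)) ((par ^^ a) v)"
        by (simp add: Suc_diff_Suc)
      then show ?case using branch_SucD by auto
    qed (use b in auto)
    have ybr: "branch p a (y a)" if "a \<le> h" for a
      using yb[of "h - a"] that by (simp add: y_def)
    have ypar: "y a = par (y (Suc a))" if "a < h" for a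
    proof -
      have "h - a = Suc (h - Suc a)" using that by simp
      then show ?thesis by (simp add: y_def)
    qed
    have yU: "y a \<in> U" if "1 \<le> a" "a \<le> h" for a using branch_U[OF ybr] that by auto
    have yD: "D (y a) = D (P p) + a" if "a \<le> h" for a using branch_D[OF ybr] that by auto
    have ye: "E (y a) (y (Suc a))" if "a < h" for a
      using par(1)[OF yU[of "Suc a"]] ypar[OF that] that edgeD(4) by auto
    have y0: "y 0 = P p" using ybr[of 0] branch_0 by simp
    have yh: "y h = v" by (simp add: y_def)
    have Dw: "D w = D (P p) + Suc h" "D w' = D (P p) + Suc h"
      using par(2)[OF w(1)] par(2)[OF w(2)] w(4) branch_D[OF b] by (auto simp: v_def)
    have "x (y 1) \<ge> f h * x (y 0)"
    proof (rule fork_ratio[of h y w w'])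
      show "y (a - 1) \<noteq> y (Suc a)" if "1 \<le> a" "a < h" for a
      proof -
        have "D (y (a - 1)) < D (y (Suc a))" using yD[of "a - 1"] yD[of "Suc a"] that by simp
        then show ?thesis by auto
      qed
      have "D (y (h - 1)) < D w" using yD[of "h - 1"] Dw False by simp
      then show "distinct [y (h - 1), w, w']" using Dw w(3) by auto
    qed (use False h ye Ew yh in auto)
    moreover have "1 \<le> p" "p < 2 * k" using h by auto
    moreover have "{y 1} \<subseteq> U" "E (P p) (y 1)" using yU[of 1] ye[of 0] False y0 by auto
    ultimately show False
      using no_heavy_branch[of p "{y 1}" h] lam y0 by auto
  qed
qed

section \<open>Branches as paths, and the embedded quipu\<close>

definition blen :: "nat \<Rightarrow> nat" where "blen p = Max {h. \<exists>v. branch p h v}"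
definition W :: "nat \<Rightarrow> nat \<Rightarrow> nat" where "W p h = (THE v. branch p h v)"

context
  assumes near: "\<And>v. v < n \<Longrightarrow> D v \<le> k"
begin

lemma branch_inj: "branch p h v \<Longrightarrow> branch p h v' \<Longrightarrow> v = v'"
proof (induction arbitrary: v' rule: branch.induct)
  case (root p)
  then show ?case using branch_0 by simp
next
  case (step p h v)
  then have "v' \<in> U" "par v = par v'" using branch_SucD by blast+
  then show ?case using no_fork[OF near step(2)] by blast
qed

lemma branch_W: "branch p h v \<Longrightarrow> W p h = v"
  unfolding W_def using branch_inj by blast

lemma branch_down: "branch p h v \<Longrightarrow> h' \<le> h \<Longrightarrow> \<exists>v'. branch p h' v'"
proof (induction h arbitrary: v)
  case (Suc h)
  then show ?case using branch_SucD by (metis le_Suc_eq)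
qed auto

lemma blen_finite: "finite {h. \<exists>v. branch p h v}"
  by (rule finite_subset[of _ "{..p}"]) (use branch_height[OF near] in auto)

lemma branch_blen: "p \<le> 2 * k \<Longrightarrow> h \<le> blen p \<Longrightarrow> branch p h (W p h)"
proof -
  assume p: "p \<le> 2 * k" and h: "h \<le> blen p"
  have "{h. \<exists>v. branch p h v} \<noteq> {}" using branch.root[OF p] by blast
  then have "blen p \<in> {h. \<exists>v. branch p h v}"
    unfolding blen_def using blen_finite by (intro Max_in)
  then obtain v where "branch p h v" using branch_down h by blast
  then show ?thesis using branch_W by simp
qed

lemma blen_ge: "branch p h v \<Longrightarrow> h \<le> blen p"
  unfolding blen_def using blen_finite by (intro Max_ge) auto

lemma blen_le: "p \<le> 2 * k \<Longrightarrow> blen p \<le> p" "p \<le> 2 * k \<Longrightarrow> blen p \<le> 2 * k - p"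
  using branch_blen[of p "blen p"] branch_height[OF near] by auto

lemma W_0: "p \<le> 2 * k \<Longrightarrow> W p 0 = P p"
  using branch_W[OF branch.root] .

lemma W_U: "p \<le> 2 * k \<Longrightarrow> 1 \<le> h \<Longrightarrow> h \<le> blen p \<Longrightarrow> W p h \<in> U"
  using branch_U[OF branch_blen] by auto

lemma W_edge: "p \<le> 2 * k \<Longrightarrow> h < blen p \<Longrightarrow> E (W p h) (W p (Suc h))"
proof -
  assume p: "p \<le> 2 * k" "h < blen p"
  then have "branch p (Suc h) (W p (Suc h))" by (intro branch_blen) auto
  then have "W p (Suc h) \<in> U" "branch p h (par (W p (Suc h)))" using branch_SucD by blast+
  then show ?thesis using branch_W par(1) edgeD(4) by metis
qed

lemma W_bij: "bij_betw (\<lambda>(p, h). W p h) (SIGMA p:{..2 * k}. {1..blen p}) U"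
proof (rule bij_betwI')
  fix a b assume "a \<in> (SIGMA p:{..2 * k}. {1..blen p})" "b \<in> (SIGMA p:{..2 * k}. {1..blen p})"
  then obtain p h q l where ab: "a = (p, h)" "b = (q, l)" and
    "p \<le> 2 * k" "h \<le> blen p" "q \<le> 2 * k" "l \<le> blen q" by auto
  then have "branch p h (W p h)" "branch q l (W q l)" by (auto intro: branch_blen)
  then show "((case a of (p, h) \<Rightarrow> W p h) = (case b of (p, h) \<Rightarrow> W p h)) = (a = b)"
    unfolding ab using branch_unique by auto
next
  fix a assume "a \<in> (SIGMA p:{..2 * k}. {1..blen p})"
  then show "(case a of (p, h) \<Rightarrow> W p h) \<in> U" using W_U by auto
next
  fix v assume v: "v \<in> U"
  then obtain p h where b: "branch p h v" using branch_exists U_D(1) by blast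
  then show "\<exists>a\<in>SIGMA p:{..2 * k}. {1..blen p}. v = (case a of (p, h) \<Rightarrow> W p h)"
    using v branch_U[OF b] branch_p[OF b] blen_ge[OF b] branch_W[OF b]
    by (intro bexI[of _ "(p, h)"]) auto
qed

lemma blen_sum: "(\<Sum>p\<le>2 * k. blen p) = k"
proof -
  have "card (SIGMA p:{..2 * k}. {1..blen p}) = k"
    using bij_betw_same_card[OF W_bij] card_U by simp
  then show ?thesis by (simp add: card_SigmaI)
qed

lemma main_super:
  assumes p: "0 < p" "p < 2 * k"
  shows "x (P (p - 1)) + x (P (Suc p)) + g (blen p) * x (P p) \<le> lam * x (P p)"
proof (cases "blen p = 0")
  case True
  have "P (p - 1) \<noteq> P (Suc p)" using p by (intro Pne) auto
  then have "x (P (p - 1)) + x (P (Suc p)) \<le> lam * x (P p)"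
    using p Pe[of p] Pp[of p] by (intro nbr_le2) auto
  then show ?thesis using True g0 by simp
next
  case False
  have "x (W p 1) \<ge> g (blen p) * x (W p 0)"
  proof (rule path_ratio)
    show "1 \<le> blen p" "blen p \<le> 2 * k" using False blen_le[of p] p by auto
    show "E (W p a) (W p (Suc a))" if "a < blen p" for a using W_edge[of p a] that p by auto
    show "W p (a - 1) \<noteq> W p (Suc a)" if "1 \<le> a" "a < blen p" for a
    proof
      assume eq: "W p (a - 1) = W p (Suc a)"
      have "branch p (a - 1) (W p (a - 1))" "branch p (Suc a) (W p (Suc a))"
        using that p by (auto intro: branch_blen)
      then have "a - 1 = Suc a" unfolding eq using branch_unique by blast
      then show False by simp
    qed
  qed
  moreover have "x (P (p - 1)) + x (P (Suc p)) + x (W p 1) \<le> lam * x (P p)"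
  proof (rule nbr_le3)
    show "E (P p) (W p 1)" using W_edge[of p 0] False p by (simp add: W_0)
    have "W p 1 \<in> U" using W_U[of p 1] False p by auto
    then show "distinct [P (p - 1), P (Suc p), W p 1]"
      using U_D(2)[of "W p 1"] p Pne[of "p - 1" "Suc p"] by auto
  qed (use p Pe Pp in auto)
  ultimately show ?thesis using p by (simp add: W_0)
qed

text \<open>\<open>u\<close> and \<open>v\<close> are the first and last positions with a branch. If
  they coincide, a branch of length \<open>k\<close> fits only at the centre, which is
  \<open>i = 0\<close>. Otherwise \<open>rigid\<close> applies to the values along \<open>P\<close>;
  its two branches use up the total \<open>k\<close>, so there is none in between.\<close>

lemma two_blens:
  "\<exists>i j. i + j = k \<and> (1 \<le> i \<longrightarrow> blen i = i) \<and> (1 \<le> j \<longrightarrow> blen (2 * i + j) = j) \<and>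
     (\<forall>p\<le>2 * k. 1 \<le> blen p \<longrightarrow> p = i \<or> p = 2 * i + j)"
proof -
  define S where "S = {p. p \<le> 2 * k \<and> 1 \<le> blen p}"
  have fin: "finite S" by (simp add: S_def)
  have ne: "S \<noteq> {}"
  proof
    assume "S = {}"
    then have "blen p = 0" if "p \<le> 2 * k" for p using that by (auto simp: S_def)
    then show False using blen_sum k1 by simp
  qed
  define u where "u = Min S"
  define v where "v = Max S"
  have u: "u \<le> 2 * k" "1 \<le> blen u" using Min_in[OF fin ne] by (auto simp: u_def S_def)
  have v: "v \<le> 2 * k" "1 \<le> blen v" using Max_in[OF fin ne] by (auto simp: v_def S_def)
  have out: "u \<le> p \<and> p \<le> v" if "p \<le> 2 * k" "1 \<le> blen p" for p
    using fin that by (auto simp: u_def v_def S_def)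
  have uv: "u \<le> v" using out u by blast
  have "(\<Sum>p\<in>{u..v}. blen p) = (\<Sum>p\<le>2 * k. blen p)"
  proof (rule sum.mono_neutral_left)
    show "\<forall>p\<in>{..2 * k} - {u..v}. blen p = 0"
      using out by (metis DiffE atLeastAtMost_iff atMost_iff le_add1 plus_1_eq_Suc not0_implies_Suc)
  qed (use v in auto)
  then have sum: "(\<Sum>p\<in>{u..v}. blen p) = k" using blen_sum by simp
  show ?thesis
  proof (cases "u = v")
    case True
    then have "blen u = k" using sum by simp
    then have "u = k" using blen_le[OF u(1)] u(1) by simp
    then show ?thesis using True \<open>blen u = k\<close> out by (intro exI[of _ 0] exI[of _ k]) force
  next
    case False
    have tu: "blen u \<le> u" "blen v \<le> 2 * k - v" using blen_le u v by auto
    have *: "blen u = u \<and> blen v = 2 * k - v \<and> blen u + blen v = k"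
    proof (rule rigid[of u v blen "\<lambda>p. x (P p)"])
      show "x (P p) > 0" if "u \<le> p" "p \<le> v" for p using x_pos Pn that v by auto
      show "x (P (Suc u)) + (g u + g (blen u)) * x (P u) \<le> lam * x (P u)"
        using main_super[of u] left_ratio[of u] False uv v u tu by (simp add: algebra_simps)
      show "x (P (v - 1)) + (g (2 * k - v) + g (blen v)) * x (P v) \<le> lam * x (P v)"
      proof -
        have "0 < v" "v < 2 * k" using tu v False uv by linarith+
        then show ?thesis using main_super[of v] right_ratio[of v] by (simp add: algebra_simps)
      qed
      show "x (P (p - 1)) + x (P (Suc p)) + g (blen p) * x (P p) \<le> lam * x (P p)"
        if "u < p" "p < v" for p using main_super[of p] that v by auto
    qed (use False uv u v tu sum in auto)
    then have v': "v = 2 * blen u + blen v" using v by auto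
    have "blen p = 0" if "u < p" "p < v" for p
    proof -
      have "(\<Sum>p\<in>{u, p, v}. blen p) \<le> (\<Sum>p\<in>{u..v}. blen p)" using that by (intro sum_mono2) auto
      then show ?thesis using that sum * by simp
    qed
    then have "\<forall>p\<le>2 * k. 1 \<le> blen p \<longrightarrow> p = u \<or> p = v"
      using out by (metis le_neq_implies_less not_one_le_zero)
    then show ?thesis using * v' by (intro exI[of _ "blen u"] exI[of _ "blen v"]) auto
  qed
qed

text \<open>\<open>\<phi>\<close> follows the numbering of \<open>quipu\<close>: main path, leg at
  \<open>i\<close>, leg at \<open>2 * i + j\<close>. It is onto because every vertex outside
  \<open>P\<close> lies on a branch with one of these two feet, and then injective by
  counting.\<close>

lemma quipu_embeds:
  "\<exists>i j \<phi>. i + j = k \<and> bij_betw \<phi> {..<n} {..<n} \<and> (\<forall>a b. quipu i j a b \<longrightarrow> E (\<phi> a) (\<phi> b))"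
proof -
  obtain i j where ij: "i + j = k" and ti: "1 \<le> i \<longrightarrow> blen i = i"
    and tj: "1 \<le> j \<longrightarrow> blen (2 * i + j) = j"
    and only: "\<And>p. p \<le> 2 * k \<Longrightarrow> 1 \<le> blen p \<Longrightarrow> p = i \<or> p = 2 * i + j"
    using two_blens by blast
  define \<phi> where "\<phi> a = (if a \<le> 2 * k then P a else if a \<le> 2 * k + i then W i (a - 2 * k)
     else W (2 * i + j) (a - 2 * k - i))" for a
  have bound: "i \<le> 2 * k" "2 * i + j \<le> 2 * k" using ij by auto
  have into: "\<phi> a < n" if "a < n" for a
  proof -
    consider "a \<le> 2 * k" | "2 * k < a" "a \<le> 2 * k + i" | "2 * k + i < a" by linarith
    then show ?thesis
    proof cases
      case 1 then show ?thesis using Pn by (simp add: \<phi>_def)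
    next
      case 2
      then have "1 \<le> a - 2 * k" "a - 2 * k \<le> blen i" using ti by auto
      then show ?thesis using 2 W_U[OF bound(1)] U_D(1) by (auto simp: \<phi>_def)
    next
      case 3
      then have "1 \<le> a - 2 * k - i" "a - 2 * k - i \<le> blen (2 * i + j)" using tj that n ij by auto
      then show ?thesis using 3 W_U[OF bound(2)] U_D(1) by (auto simp: \<phi>_def)
    qed
  qed
  have onto: "v \<in> \<phi> ` {..<n}" if v: "v < n" for v
  proof (cases "v \<in> U")
    case False
    then obtain p where "p \<le> 2 * k" "v = P p" using v by (auto simp: U_def)
    then have "v = \<phi> p" "p < n" using n by (auto simp: \<phi>_def)
    then show ?thesis by auto
  next
    case True
    then obtain p h where ph: "p \<le> 2 * k" "1 \<le> h" "h \<le> blen p" "v = W p h"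
      using bij_betw_imp_surj_on[OF W_bij] by force
    then have "p = i \<or> p = 2 * i + j" using only by simp
    then show ?thesis
    proof
      assume pi: "p = i"
      show ?thesis
      proof (cases "i = 0")
        case True
        then show ?thesis using ph pi blen_le[of 0] by simp
      next
        case False
        then have "h \<le> i" using ph pi ti by simp
        then have "v = \<phi> (2 * k + h)" "2 * k + h < n" using ph pi n ij by (auto simp: \<phi>_def)
        then show ?thesis by auto
      qed
    next
      assume pj: "p = 2 * i + j"
      have "1 \<le> j"
      proof (rule ccontr)
        assume "\<not> 1 \<le> j"
        then have "p = 2 * k" using pj ij by simp
        then show False using blen_le(2)[of "2 * k"] ph by simp
      qed
      then have "h \<le> j" using tj ph pj by simp
      then have "v = \<phi> (2 * k + i + h)" "2 * k + i + h < n" using ph pj n ij by (auto simp: \<phi>_def)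
      then show ?thesis by auto
    qed
  qed
  have img: "\<phi> ` {..<n} = {..<n}" using into onto by auto
  then have "bij_betw \<phi> {..<n} {..<n}"
    unfolding bij_betw_def by (simp add: eq_card_imp_inj_on)
  moreover have base: "E (\<phi> a) (\<phi> b)" if "quipu_base i j a b" for a b
  proof -
    from that consider "b = a + 1" "b \<le> 2 * k" | "1 \<le> i" "a = i" "b = 2 * k + 1"
      | "b = a + 1" "2 * k + 1 \<le> a" "b \<le> 2 * k + i" | "1 \<le> j" "a = 2 * i + j" "b = 2 * k + i + 1"
      | "b = a + 1" "2 * k + i + 1 \<le> a" "b \<le> 2 * k + i + j"
      unfolding quipu_base_def Let_def ij by blast
    then show ?thesis
    proof cases
      case 1 then show ?thesis using Pe[of a] by (simp add: \<phi>_def)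
    next
      case 2 then show ?thesis using W_edge[of i 0] ti bound by (simp add: \<phi>_def W_0)
    next
      case 3
      then have "b - 2 * k = Suc (a - 2 * k)" by simp
      then show ?thesis using 3 W_edge[of i "a - 2 * k"] ti bound by (simp add: \<phi>_def)
    next
      case 4 then show ?thesis using W_edge[of "2 * i + j" 0] tj bound by (simp add: \<phi>_def W_0)
    next
      case 5
      then have "b - 2 * k - i = Suc (a - 2 * k - i)" by simp
      then show ?thesis using 5 W_edge[of "2 * i + j" "a - 2 * k - i"] tj bound by (simp add: \<phi>_def)
    qed
  qed
  have "\<forall>a b. quipu i j a b \<longrightarrow> E (\<phi> a) (\<phi> b)"
    unfolding quipu_def using base edgeD(4) by blast
  ultimately show ?thesis using ij by blast
qed

end

text \<open>A cycle of length \<open>2 * k + 2\<close> with tails at antipodal points. Adding the values on the two halves folds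
  it onto a path that carries branches of total size \<open>k + 1\<close>, one more than rigidity allows.\<close>

lemma fold_contradiction:
  assumes i: "i < k" and c0: "c 0 = P i" and ck: "c (Suc k) = P (Suc (k + i))"
    and cU: "\<And>a. 1 \<le> a \<Longrightarrow> a \<le> k \<Longrightarrow> c a \<in> U"
    and ce: "\<And>a. a \<le> k \<Longrightarrow> E (c a) (c (Suc a))"
    and cne: "\<And>a. 1 \<le> a \<Longrightarrow> a \<le> k \<Longrightarrow> c (a - 1) \<noteq> c (Suc a)"
  shows False
proof -
  \<comment> \<open>The halves meet at both ends, so \<open>X 0\<close> and \<open>X (Suc k)\<close>
    are twice the values there. This is the source of the factor 2 in \<open>ends\<close>: on the
    folded path each tail acts both as a tail and as a branch.\<close>
  define X where "X a = x (P (i + a)) + x (c a)" for a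
  have Xpos: "X a > 0" if "1 \<le> a" "a \<le> k" for a
    using x_pos[OF Pn[of "i + a"]] x_pos[OF U_D(1)[OF cU[OF that]]] that i by (simp add: X_def)
  have inner: "X (a - 1) + X (Suc a) \<le> lam * X a" if a: "1 \<le> a" "a \<le> k" for a
  proof -
    have "x (P (i + (a - 1))) + x (P (i + Suc a)) \<le> lam * x (P (i + a))"
    proof (rule nbr_le2)
      show "E (P (i + a)) (P (i + (a - 1)))" using Pp[of "i + a"] a i by simp
      show "E (P (i + a)) (P (i + Suc a))" using Pe[of "i + a"] a i by simp
      show "P (i + (a - 1)) \<noteq> P (i + Suc a)" using a i by (intro Pne) auto
    qed
    moreover have "x (c (a - 1)) + x (c (Suc a)) \<le> lam * x (c a)"
      using ce[of "a - 1"] ce[of a] cne[of a] edgeD(4) a by (intro nbr_le2) auto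
    ultimately show ?thesis by (simp add: X_def algebra_simps)
  qed
  have ends: "2 * g (Suc q) * (x y + x z) \<le> 2 * x w"
    if q: "q < 2 * k" and w: "w < n" and s: "g q * x w + x y + x z \<le> lam * x w" for q w y z
  proof -
    have "x y + x z \<le> (lam - g q) * x w" using s by (simp add: algebra_simps)
    then have "g (Suc q) * (x y + x z) \<le> x w" using gS[OF q] by (simp add: field_simps)
    then show ?thesis by simp
  qed
  have c1: "c 1 \<in> U" "c k \<in> U" using cU k1 by auto
  have left: "2 * g (Suc i) * X 1 \<le> X 0"
  proof -
    have "g i * x (P i) + x (P (Suc i)) + x (c 1) \<le> lam * x (P i)"
    proof (cases "i = 0")
      case True
      then show ?thesis using nbr_le2[of "P 0" "P 1" "c 1"] Pe[of 0] ce[of 0] c0 k1 g0 U_D(2)[OF c1(1)] by auto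
    next
      case False
      have "x (P (i - 1)) + x (P (Suc i)) + x (c 1) \<le> lam * x (P i)"
      proof (rule nbr_le3)
        show "E (P i) (c 1)" using ce[of 0] c0 by simp
        show "distinct [P (i - 1), P (Suc i), c 1]"
          using U_D(2)[OF c1(1), of "i - 1"] U_D(2)[OF c1(1), of "Suc i"] Pne[of "i - 1" "Suc i"] i False by auto
      qed (use i False Pe Pp in auto)
      then show ?thesis using left_ratio[of i] i False by simp
    qed
    then show ?thesis using ends[of i "P i" "P (Suc i)" "c 1"] i Pn[of i] by (simp add: X_def c0)
  qed
  have right: "2 * g (k - i) * X k \<le> X (Suc k)"
  proof -
    let ?j = "Suc (k + i)"
    have jj: "2 * k - ?j = k - 1 - i" "Suc (k - 1 - i) = k - i" using i by auto
    have Ec: "E (P ?j) (c k)" using ce[of k] ck edgeD(4) by simp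
    have "g (k - 1 - i) * x (P ?j) + x (P (k + i)) + x (c k) \<le> lam * x (P ?j)"
    proof (cases "?j = 2 * k")
      case True
      then show ?thesis using nbr_le2[of "P ?j" "P (k + i)" "c k"] Pp[of ?j] Ec g0 U_D(2)[OF c1(2), of "k + i"] jj by auto
    next
      case False
      have "x (P (k + i)) + x (P (Suc ?j)) + x (c k) \<le> lam * x (P ?j)"
      proof (rule nbr_le3)
        show "E (P ?j) (P (k + i))" using Pp[of ?j] i by simp
        show "distinct [P (k + i), P (Suc ?j), c k]"
          using U_D(2)[OF c1(2), of "k + i"] U_D(2)[OF c1(2), of "Suc ?j"] Pne[of "k + i" "Suc ?j"] i False by auto
      qed (use i False Pe Ec in auto)
      then show ?thesis using right_ratio[of ?j] i False jj by simp
    qed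
    then show ?thesis using ends[of "k - 1 - i" "P ?j" "P (k + i)" "c k"] i Pn[of ?j] jj
      by (simp add: X_def ck add.commute)
  qed
  show False
  \<comment> \<open>For \<open>k = 1\<close> the folded path has a single inner vertex and no room
    for \<open>u < v\<close>; here a 4-cycle forces \<open>lam * lam \<ge> 4\<close>.\<close>
  proof (cases "k = 1")
    case True
    have g1: "g 1 = 1 / lam" using gS[of 0] g0 True by simp
    have "2 * g 1 * X 1 + 2 * g 1 * X 1 \<le> lam * X 1"
    proof -
      have "i = 0" using True i by simp
      then have "2 * g 1 * X 1 \<le> X 0" "2 * g 1 * X 1 \<le> X 2" "X 0 + X 2 \<le> lam * X 1"
        using left right inner[of 1] True by (simp_all add: numeral_2_eq_2)
      then show ?thesis by linarith
    qed
    then have "4 / lam * X 1 \<le> lam * X 1" unfolding g1 by simp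
    then have "4 / lam \<le> lam" by (rule mult_right_le_imp_le) (use Xpos[of 1] True in simp)
    then have "4 \<le> lam * lam" using lam_pos by (simp add: field_simps)
    then show False using small True by simp
  next
    case False
    define u where "u = Suc i"
    define v where "v = k + i"
    have uv: "u < v" "v \<le> 2 * k" using False i by (auto simp: u_def v_def)
    \<comment> \<open>The folded path carries branches of lengths \<open>i + 1\<close> and
      \<open>k - i\<close>. One is shortened by 1 to reach the total \<open>k\<close> that
      \<open>rigid\<close> requires, the right one if \<open>i = 0\<close>, because
      \<open>m u\<close> must stay positive. The shortened branch then violates the conclusion of
      \<open>rigid\<close>.\<close>
    define m where "m p = (if p = u then (if i = 0 then 1 else i)
        else if p = v then (if i = 0 then k - 1 else k - i) else 0)" for p
    have gle: "g (m u) \<le> g (Suc i)" "g (m v) \<le> g (k - i)"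
      using uv i by (auto simp: m_def intro!: g_mono)
    have "m u = u \<and> m v = 2 * k - v \<and> m u + m v = k"
    proof (rule rigid[of u v m "\<lambda>p. X (p - i)"])
      have "(\<Sum>p\<in>{u..v}. m p) = (\<Sum>p\<in>{u, v}. m p)"
        using uv by (intro sum.mono_neutral_right) (auto simp: m_def)
      then show "(\<Sum>p\<in>{u..v}. m p) = k" using uv i k1 by (auto simp: m_def)
      show "X (p - i) > 0" if "u \<le> p" "p \<le> v" for p
        using that by (intro Xpos) (auto simp: u_def v_def)
      have "(g u + g (m u)) * X 1 \<le> 2 * g (Suc i) * X 1"
        using gle Xpos[of 1] k1 by (intro mult_right_mono) (auto simp: u_def)
      moreover have "Suc u - i = Suc 1" "u - i = 1" by (auto simp: u_def)
      ultimately show "X (Suc u - i) + (g u + g (m u)) * X (u - i) \<le> lam * X (u - i)"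
        using left inner[of 1] k1 by simp
      have "(g (2 * k - v) + g (m v)) * X k \<le> 2 * g (k - i) * X k"
        using gle Xpos[of k] k1 by (intro mult_right_mono) (auto simp: v_def)
      moreover have "v - 1 - i = k - 1" "v - i = k" by (auto simp: v_def)
      ultimately show "X (v - 1 - i) + (g (2 * k - v) + g (m v)) * X (v - i) \<le> lam * X (v - i)"
        using right inner[of k] k1 by simp
      show "X (p - 1 - i) + X (Suc p - i) + g (m p) * X (p - i) \<le> lam * X (p - i)"
        if "u < p" "p < v" for p
      proof -
        have "X (p - i - 1) + X (Suc (p - i)) \<le> lam * X (p - i)"
          using that by (intro inner) (auto simp: u_def v_def)
        moreover have "p - 1 - i = p - i - 1" "Suc p - i = Suc (p - i)" "m p = 0"
          using that by (auto simp: u_def m_def)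
        ultimately show ?thesis using g0 by simp
      qed
    qed (use uv i k1 False in \<open>auto simp: m_def u_def v_def\<close>)
    then show False using uv i by (auto simp: m_def u_def v_def split: if_splits)
  qed
qed

text \<open>Counting the vertices outside \<open>P\<close> on geodesics from \<open>v\<close> to \<open>P k\<close> and to \<open>P (2 * k)\<close> forces all
  triangle inequalities to be equalities: they meet \<open>P\<close> at antipodal points \<open>P i\<close>, \<open>P j\<close> of a cycle, and
  \<open>v\<close> is the end of a pendent path of length \<open>s\<close> at that cycle.\<close>

lemma far_vertex_contradiction:
  assumes v: "v < n" "D v = Suc k"
    and Q: "Q 0 = v" "Q (Suc k) = P k" "geodesic Q (Suc k)"
    and i: "i < k" and Qi: "Q (Suc i) = P i" and QU: "\<And>a. a \<le> i \<Longrightarrow> Q a \<in> U"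
  shows False
proof -
  define L where "L = d v (P (2 * k))"
  obtain R where R: "R 0 = v" "R L = P (2 * k)" "geodesic R L"
    using geodesic_exists[OF v(1) Pn[of "2 * k"]] unfolding L_def by auto
  \<comment> \<open>The first index at which \<open>R\<close> meets \<open>P\<close>. The bound
    \<open>L \<le> 2 * k\<close> from the diameter will place this meeting point beyond the
    centre.\<close>
  define \<sigma> where "\<sigma> = (LEAST a. R a \<in> P ` {..2 * k})"
  have ex: "R L \<in> P ` {..2 * k}" using R by auto
  then have \<sigma>P: "R \<sigma> \<in> P ` {..2 * k}" unfolding \<sigma>_def by (rule LeastI)
  have \<sigma>L: "\<sigma> \<le> L" unfolding \<sigma>_def using ex by (rule Least_le)
  have RU: "R a \<in> U" if "a < \<sigma>" for a
    using not_less_Least[of a "\<lambda>a. R a \<in> P ` {..2 * k}"] that geodesicD(1)[OF R(3), of a] \<sigma>L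
    by (auto simp: \<sigma>_def intro: U_I)
  obtain j where j: "j \<le> 2 * k" "R \<sigma> = P j" using \<sigma>P by auto
  have dvj: "d v (P j) = \<sigma>" using geodesicD(3)[OF R(3), of 0 \<sigma>] \<sigma>L R j by simp
  have L2: "L \<le> 2 * k" unfolding L_def using diam v Pn by simp
  have "L - \<sigma> = 2 * k - j"
    using geodesicD(3)[OF R(3), of \<sigma> L] \<sigma>L R j Pd[of j "2 * k"] by simp
  then have \<sigma>j: "\<sigma> \<le> j" using L2 \<sigma>L j by simp
  have tri: "Suc k \<le> \<sigma> + D (P j)"
    using dist_triangle[of v "P j" "P k"] v Pn j dvj by simp
  have jk: "k < j"
  proof (rule ccontr)
    assume "\<not> k < j"
    then show False using tri D_P[of j] \<sigma>j j by simp
  qed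
  have sj: "2 * k + 1 \<le> \<sigma> + j" using tri D_P[of j] jk j by simp
  \<comment> \<open>Its maximum \<open>s\<close> is the last common vertex of the two geodesics
    before they reach \<open>P\<close>. Both start at \<open>v\<close>, so the index of a common
    vertex is the same on each.\<close>
  define A where "A = {a. a < \<sigma> \<and> R a \<in> Q ` {..i}}"
  have "0 < \<sigma>"
  proof (rule ccontr)
    assume "\<not> 0 < \<sigma>"
    then have "v = P j" using R j by simp
    then show False using QU[of 0] Q U_D(2)[of v j] j by simp
  qed
  then have A0: "0 \<in> A" using R Q by (auto simp: A_def intro: image_eqI[of _ _ 0])
  have finA: "finite A" by (simp add: A_def)
  define s where "s = Max A"
  have sA: "s \<in> A" unfolding s_def using finA A0 by (intro Max_in) auto
  have smax: "a \<le> s" if "a \<in> A" for a unfolding s_def using finA that by simp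
  obtain s' where s': "s' \<le> i" "R s = Q s'" using sA by (auto simp: A_def)
  have s\<sigma>: "s < \<sigma>" using sA by (simp add: A_def)
  have "s = s'"
    using geodesicD(3)[OF R(3), of 0 s] geodesicD(3)[OF Q(3), of 0 s'] s' s\<sigma> \<sigma>L i R Q by simp
  then have RQ: "R s = Q s" and si: "s \<le> i" using s' by auto
  have Rnot: "R a \<notin> Q ` {..i}" if "s < a" "a < \<sigma>" for a
    using smax[of a] that by (auto simp: A_def)
  \<comment> \<open>\<open>Q\<close> has \<open>i + 1\<close> vertices outside \<open>P\<close>
    before it reaches \<open>P i\<close>, and \<open>R\<close> adds \<open>\<sigma> - s - 1\<close>
    new ones; there are only \<open>k\<close>.\<close>
  have count: "i + \<sigma> \<le> k + s"
  proof -
    have 1: "card (Q ` {..i}) = Suc i"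
      using geodesic_inj[OF Q(3)] i by (subst card_image) (auto intro!: inj_onI)
    have 2: "card (R ` {s<..<\<sigma>}) = \<sigma> - Suc s"
      using geodesic_inj[OF R(3)] \<sigma>L by (subst card_image) (auto intro!: inj_onI)
    have "Q ` {..i} \<inter> R ` {s<..<\<sigma>} = {}"
    proof (rule equals0I)
      fix y assume y: "y \<in> Q ` {..i} \<inter> R ` {s<..<\<sigma>}"
      from y have yQ: "y \<in> Q ` {..i}" by (rule IntD1)
      from y have "y \<in> R ` {s<..<\<sigma>}" by (rule IntD2)
      then obtain b where b: "s < b" "b < \<sigma>" "y = R b" by auto
      show False using Rnot[OF b(1,2)] yQ b(3) by simp
    qed
    then have "card (Q ` {..i} \<union> R ` {s<..<\<sigma>}) = Suc i + (\<sigma> - Suc s)"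
      using 1 2 by (subst card_Un_disjoint) auto
    moreover have "Q ` {..i} \<union> R ` {s<..<\<sigma>} \<subseteq> U" using QU RU by auto
    ultimately have "Suc i + (\<sigma> - Suc s) \<le> k" using card_mono[OF finite_U] card_U by metis
    then show ?thesis using s\<sigma> by simp
  qed
  have "d (P i) (P j) \<le> d (P i) (Q s) + d (R s) (P j)"
    using dist_triangle[of "P i" "Q s" "P j"] RQ Pn geodesicD(1)[OF Q(3)] si i j by simp
  moreover have "d (P i) (Q s) = Suc i - s"
    using geodesicD(3)[OF Q(3), of s "Suc i"] dist_sym[of "P i" "Q s"] Qi si i Pn geodesicD(1)[OF Q(3)] by simp
  moreover have "d (R s) (P j) = \<sigma> - s" using geodesicD(3)[OF R(3), of s \<sigma>] s\<sigma> \<sigma>L j by simp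
  moreover have "d (P i) (P j) = j - i" using Pd[of i j] i j jk by simp
  ultimately have tri2: "j - i \<le> (Suc i - s) + (\<sigma> - s)" by simp
  \<comment> \<open>All slack is used up: the two sides of the cycle between \<open>P i\<close> and
    \<open>P j\<close> both have length \<open>k + 1 - s\<close>.\<close>
  have \<sigma>eq: "\<sigma> = k - i + s" and jeq: "j = k + 1 + i - s"
    using count tri2 sj s\<sigma> si i jk by linarith+
  have Qe: "E (Q a) (Q (Suc a))" "E (Q (Suc a)) (Q a)" if "a \<le> i" for a
    using geodesicD(2)[OF Q(3), of a] edgeD(4) that i by auto
  have Re: "E (R a) (R (Suc a))" "E (R (Suc a)) (R a)" if "a < \<sigma>" for a
    using geodesicD(2)[OF R(3), of a] edgeD(4) that \<sigma>L by auto
  have Qne: "Q a \<noteq> Q b" if "a \<le> Suc i" "b \<le> Suc i" "a \<noteq> b" for a b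
    using geodesic_ne[OF Q(3)] that i by auto
  have Rne: "R a \<noteq> R b" if "a \<le> \<sigma>" "b \<le> \<sigma>" "a \<noteq> b" for a b
    using geodesic_ne[OF R(3)] that \<sigma>L by auto
  have QR: "Q a \<noteq> R b" if "a \<le> Suc i" "s < b" "b \<le> \<sigma>" for a b
  proof (cases "b = \<sigma>")
    case True
    show ?thesis
    proof (cases "a = Suc i")
      case True
      then show ?thesis using Qi j \<open>b = \<sigma>\<close> Pne[of i j] jk i by simp
    next
      case False
      then show ?thesis using QU[of a] U_D(2)[of "Q a" j] j \<open>b = \<sigma>\<close> that by auto
    qed
  next
    case False
    show ?thesis
    proof (cases "a = Suc i")
      case True
      then show ?thesis using Qi RU[of b] U_D(2)[of "R b" i] False that i by auto
    next
      case False
      then have "Q a \<in> Q ` {..i}" using that by simp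
      moreover have "R b \<notin> Q ` {..i}" using Rnot[of b] \<open>b \<noteq> \<sigma>\<close> that by simp
      ultimately show ?thesis by metis
    qed
  qed
  show False
  proof (cases "s = 0")
    case True
    have \<sigma>0: "\<sigma> = k - i" using \<sigma>eq True by simp
    define c where "c a = (if a \<le> Suc i then Q (Suc i - a) else R (a - Suc i))" for a
    show False
    proof (rule fold_contradiction[OF i, of c])
      show "c 0 = P i" by (simp add: c_def Qi)
      show "c (Suc k) = P (Suc (k + i))" using i j \<sigma>0 jeq True by (simp add: c_def)
      show "c a \<in> U" if "1 \<le> a" "a \<le> k" for a
        using that QU[of "Suc i - a"] RU[of "a - Suc i"] \<sigma>0 by (auto simp: c_def)
      show "E (c a) (c (Suc a))" if "a \<le> k" for a
      proof -
        consider "a < Suc i" | "a = Suc i" | "Suc i < a" by linarith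
        then show ?thesis
        proof cases
          case 1
          then show ?thesis using Qe(2)[of "i - a"] by (simp add: c_def Suc_diff_le)
        next
          case 2
          then show ?thesis using Re(1)[of 0] \<open>0 < \<sigma>\<close> R Q by (simp add: c_def)
        next
          case 3
          then show ?thesis using Re(1)[of "a - Suc i"] \<sigma>0 that by (simp add: c_def Suc_diff_Suc)
        qed
      qed
      show "c (a - 1) \<noteq> c (Suc a)" if "1 \<le> a" "a \<le> k" for a
      proof -
        consider "a \<le> i" | "a = Suc i" | "Suc i < a" by linarith
        then show ?thesis
        proof cases
          case 1
          then have "Q (Suc i - (a - 1)) \<noteq> Q (Suc i - Suc a)" using that by (intro Qne) auto
          moreover have "a - 1 \<le> Suc i" "Suc a \<le> Suc i" using 1 by auto
          ultimately show ?thesis unfolding c_def by presburger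
        next
          case 2
          then show ?thesis using QR[of 1 1] True \<open>0 < \<sigma>\<close> by (simp add: c_def)
        next
          case 3
          have "R (a - 1 - Suc i) \<noteq> R (Suc a - Suc i)" using 3 that \<sigma>0 by (intro Rne) auto
          moreover have "c (a - 1) = R (a - 1 - Suc i)"
            using 3 R Q by (auto simp: c_def)
          ultimately show ?thesis using 3 by (simp add: c_def)
        qed
      qed
    qed
  next
    case False
    show False
    \<comment> \<open>The tail makes \<open>Q s\<close> a fork, at distance \<open>i + 1 - s\<close>
      from \<open>P i\<close> and \<open>k - i\<close> from \<open>P j\<close> along the cycle. The
      case distinction decides from which of them \<open>fork\<close> applies; for
      \<open>P j\<close> the position is measured from the right end of \<open>P\<close>.\<close>
    proof (cases "k \<le> 2 * i")
      case True
      let ?t = "Suc i - s"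
      have "x (Q (Suc i - 1)) \<ge> f ?t * x (Q (Suc i - 0))"
      proof (rule fork_ratio[of ?t "\<lambda>a. Q (Suc i - a)" "Q (s - 1)" "R (Suc s)"])
        show "E (Q (Suc i - a)) (Q (Suc i - Suc a))" if "a < ?t" for a
          using Qe(2)[of "i - a"] that by (simp add: Suc_diff_le)
        show "Q (Suc i - (a - 1)) \<noteq> Q (Suc i - Suc a)" if "1 \<le> a" "a < ?t" for a
          using that by (intro Qne) auto
        have eq: "Suc i - ?t = s" "Suc i - (?t - 1) = Suc s" using si False by auto
        show "E (Q (Suc i - ?t)) (Q (s - 1))" unfolding eq using Qe(2)[of "s - 1"] False si by simp
        show "E (Q (Suc i - ?t)) (R (Suc s))" unfolding eq using Re(1)[of s] RQ s\<sigma> by simp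
        show "distinct [Q (Suc i - (?t - 1)), Q (s - 1), R (Suc s)]"
          unfolding eq using Qne[of "Suc s" "s - 1"] QR[of "Suc s" "Suc s"] QR[of "s - 1" "Suc s"] si s\<sigma> by auto
      qed (use si i False in auto)
      then have "f ?t * x (P i) \<le> (\<Sum>w\<in>{Q i}. x w)" by (simp add: Qi)
      moreover have "lam < g i + g (2 * k - i) + f ?t" using i True si False by (intro fork) auto
      ultimately show False
        using no_heavy_branch[of i "{Q i}" ?t] QU[of i] Qe(2)[of i] Qi si i False by auto
    next
      case small_i: False
      let ?t = "\<sigma> - s" and ?c = "2 * k - j"
      have t: "?t = k - i" "?c = k - 1 - i + s" using \<sigma>eq jeq si i by auto
      have "x (R (\<sigma> - 1)) \<ge> f ?t * x (R (\<sigma> - 0))"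
      proof (rule fork_ratio[of ?t "\<lambda>a. R (\<sigma> - a)" "Q (s - 1)" "Q (Suc s)"])
        show "E (R (\<sigma> - a)) (R (\<sigma> - Suc a))" if "a < ?t" for a
          using Re(2)[of "\<sigma> - Suc a"] that by (simp add: Suc_diff_Suc)
        show "R (\<sigma> - (a - 1)) \<noteq> R (\<sigma> - Suc a)" if "1 \<le> a" "a < ?t" for a
          using that by (intro Rne) auto
        have eq: "\<sigma> - ?t = s" "\<sigma> - (?t - 1) = Suc s" using s\<sigma> by auto
        show "E (R (\<sigma> - ?t)) (Q (s - 1))" unfolding eq RQ using Qe(2)[of "s - 1"] False si by simp
        show "E (R (\<sigma> - ?t)) (Q (Suc s))" unfolding eq RQ using Qe(1)[of s] si by simp
        show "distinct [R (\<sigma> - (?t - 1)), Q (s - 1), Q (Suc s)]"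
        proof -
          have "Q (Suc s) \<noteq> R (Suc s)" by (intro QR) (use si s\<sigma> in auto)
          moreover have "Q (s - 1) \<noteq> R (Suc s)" by (intro QR) (use si s\<sigma> in auto)
          moreover have "Q (s - 1) \<noteq> Q (Suc s)" by (intro Qne) (use si s\<sigma> in auto)
          ultimately show ?thesis unfolding eq by auto
        qed
      qed (use si i False s\<sigma> t in auto)
      then have "f ?t * x (P j) \<le> (\<Sum>w\<in>{R (\<sigma> - 1)}. x w)" by (simp add: j)
      moreover have "lam < g ?c + g (2 * k - ?c) + f ?t"
        using i small_i si False t by (intro fork) auto
      moreover have "2 * k - ?c = j" using j by simp
      ultimately have lam: "f ?t * x (P j) \<le> (\<Sum>w\<in>{R (\<sigma> - 1)}. x w)"
          "lam < g j + g (2 * k - j) + f ?t" by (simp_all add: add.commute)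
      have "1 \<le> j" "j < 2 * k" using jk jeq i False si by linarith+
      moreover have "{R (\<sigma> - 1)} \<subseteq> U" using RU[of "\<sigma> - 1"] \<open>0 < \<sigma>\<close> by simp
      moreover have "E (P j) (R (\<sigma> - 1))" using Re(2)[of "\<sigma> - 1"] \<open>0 < \<sigma>\<close> j by simp
      ultimately show False using no_heavy_branch[OF _ _ _ _ lam] by blast
    qed
  qed
qed

end

section \<open>All vertices lie within distance \<open>k\<close> of the centre\<close>

context extremal_graph
begin

lemma extremal_graph_mirror: "extremal_graph k lam g f n E x (\<lambda>a. P (2 * k - a))"
proof unfold_locales
  show "geodesic (\<lambda>a. P (2 * k - a)) (2 * k)" by (rule geodesic_rev[OF P])
qed (use n diam x_pos x_super in auto)

text \<open>It suffices to refute distance exactly \<open>k + 1\<close>, since a geodesic from a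
  farther vertex to the centre passes through such a point. With only \<open>k\<close> vertices
  outside \<open>P\<close>, its geodesic must meet \<open>P\<close> before the centre; if that
  happens on the right half, \<open>P\<close> is reversed.\<close>

lemma near_center:
  assumes "w < n"
  shows "D w \<le> k"
proof (rule ccontr)
  assume far: "\<not> D w \<le> k"
  have wk: "w < n" "P k < n" using assms Pn[of k] by auto
  obtain S where S: "S 0 = w" "S (D w) = P k" "geodesic S (D w)"
    using geodesic_exists[OF wk] by auto
  define v where "v = S (D w - Suc k)"
  have v: "v < n" "D v = Suc k"
    using geodesicD(1)[OF S(3), of "D w - Suc k"] geodesicD(3)[OF S(3), of "D w - Suc k" "D w"] S far
    by (auto simp: v_def)
  obtain Q where Q: "Q 0 = v" "Q (Suc k) = P k" "geodesic Q (Suc k)"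
    using geodesic_exists[OF v(1) wk(2)] v(2) by auto
  define \<tau> where "\<tau> = (LEAST a. Q a \<in> P ` {..2 * k})"
  have ex: "Q (Suc k) \<in> P ` {..2 * k}" using Q by auto
  then have "Q \<tau> \<in> P ` {..2 * k}" unfolding \<tau>_def by (rule LeastI)
  then obtain i where i: "i \<le> 2 * k" "Q \<tau> = P i" by auto
  have \<tau>k: "\<tau> \<le> Suc k" unfolding \<tau>_def using ex by (rule Least_le)
  have QU: "Q a \<in> U" if "a < \<tau>" for a
    using not_less_Least[of a "\<lambda>a. Q a \<in> P ` {..2 * k}"] that geodesicD(1)[OF Q(3), of a] \<tau>k
    by (auto simp: \<tau>_def intro: U_I)
  have "card (Q ` {..<\<tau>}) = \<tau>"
    using geodesic_inj[OF Q(3)] \<tau>k by (subst card_image) (auto intro!: inj_onI)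
  moreover have "card (Q ` {..<\<tau>}) \<le> card U" using QU by (intro card_mono finite_U) auto
  ultimately have \<tau>: "\<tau> \<le> k" using card_U by simp
  have Di: "D (P i) = Suc k - \<tau>" using geodesicD(3)[OF Q(3), of \<tau> "Suc k"] \<tau>k Q i by simp
  show False
  proof (cases "i < k")
    case True
    then have "\<tau> = Suc i" using Di D_P[OF i(1)] \<tau> by simp
    then show False using far_vertex_contradiction[OF v Q True] i QU by auto
  next
    case False
    then have "i - k = Suc k - \<tau>" using Di D_P[OF i(1)] by (cases "i = k") auto
    then have "\<tau> = Suc (2 * k - i)" "2 * k - i < k" using \<tau> i(1) False by linarith+
    moreover interpret M: extremal_graph k lam g f n E x "\<lambda>a. P (2 * k - a)"
      by (rule extremal_graph_mirror)
    have "(\<lambda>a. P (2 * k - a)) ` {..2 * k} = P ` {..2 * k}"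
      by (auto simp: image_iff) (metis diff_diff_cancel diff_le_self atMost_iff)
    then have "M.U = U" by (simp add: M.U_def U_def)
    moreover have "2 * k - k = k" by simp
    ultimately show False
      using M.far_vertex_contradiction[of v Q "2 * k - i"] v Q i QU by auto
  qed
qed

theorem quipu_embedding:
  "\<exists>i j \<phi>. i + j = k \<and> bij_betw \<phi> {..<n} {..<n} \<and> (\<forall>a b. quipu i j a b \<longrightarrow> E (\<phi> a) (\<phi> b))"
  by (rule quipu_embeds[OF near_center])

end

section \<open>The extremal eigenvalue\<close>

text \<open>\<open>sqrt 3\<close> belongs to the star with three leaves. Two nonempty branches of
  total size 1 do not exist, so \<open>rigid\<close> is vacuous.\<close>

lemma extremal_values_1:
  "extremal_values 1 (sqrt 3) (\<lambda>m. if m = 0 then 0 else if m = 1 then 1 / sqrt 3 else sqrt 3 / 2) (\<lambda>_. 2 / sqrt 3)"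
  (is "extremal_values 1 _ ?g _")
proof
  have s: "sqrt 3 * sqrt 3 = (3::real)" "sqrt 3 > (0::real)" by auto
  have s2: "sqrt 3 / 2 * sqrt 3 = 3 / (2::real)" using s by simp
  show "sqrt 3 - ?g m > 0 \<and> ?g (Suc m) = 1 / (sqrt 3 - ?g m)" if "m < 2 * 1" for m
  proof -
    have "sqrt 3 - 1 / sqrt 3 = 2 / (sqrt 3 :: real)" using s by (simp add: field_simps)
    then show ?thesis using that by (cases m) auto
  qed
  show "?g a \<le> ?g b" if "a \<le> b" "b \<le> 2 * 1" for a b
  proof -
    have "1 / sqrt 3 \<le> (sqrt 3 / 2 :: real)" using s by (simp add: field_simps)
    then show ?thesis using that by auto
  qed
  show "sqrt 3 < ?g p + ?g (2 * 1 - p) + 2 / sqrt 3"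
    if "p \<le> 2 * 1" "(e < p \<and> e < 2 * 1 - p) \<or> (e \<le> p \<and> p < 1 \<and> 1 \<le> 2 * p)" for p e :: nat
  proof -
    have "p = 1" using that by auto
    then show ?thesis using s by (simp add: field_simps)
  qed
  show "sqrt 3 * sqrt 3 < (4::real)" using s by simp
qed auto

text \<open>At \<open>lam = 2\<close> the solutions along a path are linear, which gives
  \<open>m / (m + 1)\<close>. A path ending in a fork has a constant solution with half the value on
  the two leaves, which gives 1.\<close>

lemma extremal_values_2:
  "extremal_values 2 2 (\<lambda>m. real m / (real m + 1)) (\<lambda>_. 1)" (is "extremal_values 2 2 ?g ?f")
proof
  show "2 - ?g m > 0 \<and> ?g (Suc m) = 1 / (2 - ?g m)" for m
  proof -
    have "2 - ?g m = (real m + 2) / (real m + 1)" by (simp add: field_simps)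
    then show ?thesis by (simp add: field_simps)
  qed
  show "?g a \<le> ?g b" if "a \<le> b" for a b using that by (simp add: field_simps)
  show "2 < ?g p + ?g (2 * 2 - p) + 1"
    if "p \<le> 2 * 2" "(e < p \<and> e < 2 * 2 - p) \<or> (e \<le> p \<and> p < 2 \<and> 2 \<le> 2 * p)" for p e :: nat
  proof -
    have "p = 1 \<or> p = 2 \<or> p = 3" using that by auto
    then show ?thesis by auto
  qed
  fix X :: "nat \<Rightarrow> real" and m :: "nat \<Rightarrow> nat" and u v :: nat
  assume uv: "u < v" "v \<le> 2 * 2" and m: "1 \<le> m u" "m u \<le> u" "1 \<le> m v" "m v \<le> 2 * 2 - v"
    and sum: "(\<Sum>p\<in>{u..v}. m p) = 2"
    and pos: "\<And>p. u \<le> p \<Longrightarrow> p \<le> v \<Longrightarrow> X p > 0"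
    and L: "X (Suc u) + (?g u + ?g (m u)) * X u \<le> 2 * X u"
    and R: "X (v - 1) + (?g (2 * 2 - v) + ?g (m v)) * X v \<le> 2 * X v"
  have "(\<Sum>p\<in>{u, v}. m p) \<le> (\<Sum>p\<in>{u..v}. m p)" using uv by (intro sum_mono2) auto
  then have m1: "m u = 1" "m v = 1" using sum uv m by auto
  consider "u = 1" "v = 3" | "u = 1" "v = 2" | "u = 2" "v = 3" using uv m by force
  then show "m u = u \<and> m v = 2 * 2 - v \<and> m u + m v = 2"
  proof cases
    case 1 then show ?thesis using m1 by simp
  next
    case 2
    then have "X 2 \<le> X 1" "X 1 \<le> 5 / 6 * X 2" using L R m1 by (simp_all add: numeral_2_eq_2)
    then show ?thesis using pos[of 2] 2 by simp
  next
    case 3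
    then have "X 3 \<le> 5 / 6 * X 2" "X 2 \<le> X 3" using L R m1 by (simp_all add: numeral_2_eq_2 numeral_3_eq_3)
    then show ?thesis using pos[of 2] 3 by simp
  qed
qed auto

text \<open>The interval has to avoid the trivial root 1. The bound \<open>17 / 10\<close> lies just
  below the root for \<open>k = 3\<close> and is just large enough for
  \<open>T * T * (T - 1) \<ge> 2\<close>, on which the fork estimate rests.\<close>

lemma extremal_base_exists:
  assumes k: "k \<ge> 3"
  shows "\<exists>T::real. 17 / 10 < T \<and> T < 2 \<and> T ^ (k + 1) * (2 - T) = 2 * T - 1"
proof -
  define h :: "real \<Rightarrow> real" where "h T = T ^ (k + 1) * (2 - T) - (2 * T - 1)" for T
  have "(17 / 10 :: real) ^ 4 \<le> (17 / 10) ^ (k + 1)" using k by (intro power_increasing) auto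
  then have a: "h (17 / 10) > 0" by (simp add: h_def power4_eq_xxxx del: power_Suc)
  have b: "h 2 < 0" by (simp add: h_def)
  have "\<forall>T. 17 / 10 \<le> T \<and> T \<le> 2 \<longrightarrow> isCont h T" unfolding h_def by (auto intro!: continuous_intros)
  then obtain T where T: "17 / 10 \<le> T" "T \<le> 2" "h T = 0"
    using IVT2[of h 2 0 "17 / 10"] a b by auto
  have "T \<noteq> 17 / 10" using T(3) a by (metis less_irrefl)
  moreover have "T \<noteq> 2" using T(3) b by (metis less_irrefl)
  ultimately show ?thesis using T by (intro exI[of _ T]) (auto simp: h_def)
qed

locale extremal_base =
  fixes k :: nat and T t :: real
  assumes k3: "k \<ge> 3" and T17: "17 / 10 < T" and T2: "T < 2"
    and Teq: "T ^ (k + 1) * (2 - T) = 2 * T - 1" and t: "t > 0" "t * t = T"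
begin

definition lam where "lam = (T + 1) / t"
definition g where "g m = qrat T m / t" for m
text \<open>The ratio of consecutive terms of \<open>t ^ d + 1 / t ^ d\<close>. The two leaves of
  the fork together play the role of the term 2 at \<open>d = 0\<close>.\<close>

definition f where "f e = t * (1 + T ^ e) / (1 + T ^ (e + 1))" for e

lemma T1: "T > 1" using T17 by simp

lemma qn_pos: "qnum T (Suc m) > 0"
  using qnum_strict_mono[of T 0 "Suc m"] T1 by simp

lemma lam_g: "lam - g m = qnum T (Suc (Suc m)) / (t * qnum T (Suc m))"
proof -
  have "lam - g m = (T + 1 - qrat T m) / t" by (simp add: lam_def g_def diff_divide_distrib)
  also have "T + 1 - qrat T m = qnum T (Suc (Suc m)) / qnum T (Suc m)"
    using qn_pos[of m] unfolding qrat_def qnum.simps(2)[of T "Suc m"] by (simp add: field_simps del: qnum.simps)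
  finally show ?thesis by simp
qed

lemma g_eq: "g m = t * qnum T m / qnum T (Suc m)"
proof -
  have "qrat T m = t * (t * qnum T m / qnum T (Suc m))"
    using qn_pos[of m] t by (simp add: qrat_def field_simps flip: mult.assoc)
  then show ?thesis using t by (simp add: g_def)
qed

lemma lam_f: "lam - f e = (1 + T ^ (e + 2)) / (t * (1 + T ^ (e + 1)))"
proof -
  have p: "1 + T ^ (e + 1) > 0" using T1 by (simp add: add_pos_pos)
  have "f e = (t * t) * (1 + T ^ e) / (t * (1 + T ^ (e + 1)))"
    using t(1) by (simp add: f_def)
  then have "f e = T * (1 + T ^ e) / (t * (1 + T ^ (e + 1)))" by (simp only: t(2))
  moreover have "lam = (T + 1) * (1 + T ^ (e + 1)) / (t * (1 + T ^ (e + 1)))"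
    using p t by (simp add: lam_def)
  ultimately have "lam - f e = ((T + 1) * (1 + T ^ (e + 1)) - T * (1 + T ^ e)) / (t * (1 + T ^ (e + 1)))"
    by (simp add: diff_divide_distrib)
  also have "(T + 1) * (1 + T ^ (e + 1)) - T * (1 + T ^ e) = 1 + T ^ (e + 2)"
    by (simp add: algebra_simps)
  finally show ?thesis .
qed

lemma qrat_alt: "qrat T m = 1 - (T - 1) / (T ^ (m + 1) - 1)"
proof -
  have "qnum T (Suc m) = (T ^ (m + 1) - 1) / (T - 1)"
    using qnum_closed[of T "Suc m"] T1 by (simp add: field_simps)
  then show ?thesis by (simp add: qrat_def del: qnum.simps)
qed

lemma tf_alt: "t * f e = 1 + (T - 1) / (1 + T ^ (e + 1))"
proof -
  have p: "1 + T ^ (e + 1) > 0" using T1 by (simp add: add_pos_pos)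
  have "t * f e = (t * t) * (1 + T ^ e) / (1 + T ^ (e + 1))" by (simp add: f_def)
  then have "t * f e = T * (1 + T ^ e) / (1 + T ^ (e + 1))" by (simp only: t(2))
  also have "\<dots> = 1 + (T - 1) / (1 + T ^ (e + 1))" using p by (simp add: field_simps)
  finally show ?thesis .
qed

text \<open>Times \<open>t\<close>, each ratio is 1 plus or minus \<open>T - 1\<close> over a power
  of \<open>T\<close> shifted by 1. The slack \<open>2 - T\<close> that remains is rewritten by
  \<open>Teq\<close>, which brings in \<open>k\<close> and makes all terms comparable.\<close>

lemma fork_iff:
  "lam < g p + g q + f e \<longleftrightarrow>
   1 / (T ^ (p + 1) - 1) + 1 / (T ^ (q + 1) - 1) < (2 * T - 1) / ((T - 1) * T ^ (k + 1)) + 1 / (1 + T ^ (e + 1))"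
  (is "_ \<longleftrightarrow> ?A < ?B + ?C")
proof -
  have "lam < g p + g q + f e \<longleftrightarrow> t * lam < t * (g p + g q + f e)" using t by simp
  also have "t * lam = T + 1" using t by (simp add: lam_def)
  also have "t * (g p + g q + f e) = 3 - (T - 1) * ?A + (T - 1) * ?C"
    using t tf_alt[of e] qrat_alt[of p] qrat_alt[of q] by (simp add: g_def distrib_left)
  also have "T + 1 < 3 - (T - 1) * ?A + (T - 1) * ?C \<longleftrightarrow> (T - 1) * ?A < (2 - T) + (T - 1) * ?C" by linarith
  also have "2 - T = (T - 1) * ?B"
  proof -
    have "T ^ (k + 1) > 0" using T1 by simp
    then have "2 - T = (2 * T - 1) / T ^ (k + 1)" unfolding Teq[symmetric] using T1 by simp
    then show ?thesis using T1 by simp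
  qed
  also have "(T - 1) * ?A < (T - 1) * ?B + (T - 1) * ?C \<longleftrightarrow> (T - 1) * ?A < (T - 1) * (?B + ?C)"
    by (simp only: distrib_left)
  also have "\<dots> \<longleftrightarrow> ?A < ?B + ?C" using T1 by simp
  finally show ?thesis .
qed

lemma T_pow_gt: "a \<ge> 1 \<Longrightarrow> T ^ a > 1" using T1 by (simp add: one_less_power)

lemma T_pow_ge2: "a \<ge> 2 \<Longrightarrow> T ^ a \<ge> T * T"
  using power_increasing[of 2 a T] T1 by (simp add: power2_eq_square)

text \<open>\<open>f\<close> decreases, so \<open>e = p - 1\<close> is the worst case. For
  \<open>p \<ge> 2\<close> the fork outweighs the deficit of the shorter direction, and the slack
  from \<open>Teq\<close> covers the longer one. For \<open>p = 1\<close> the fork falls short by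
  \<open>(2 - T) / (T * T - 1)\<close>, which the slack can still absorb.\<close>

lemma fork_low:
  assumes p: "1 \<le> p" "p \<le> k" and e: "e < p"
  shows "lam < g p + g (2 * k - p) + f e"
proof -
  let ?V = "T ^ (k + 1)" and ?B = "(2 * T - 1) / ((T - 1) * T ^ (k + 1))"
  have V: "?V > 1" "?V \<ge> T * T" by (rule T_pow_gt, simp, rule T_pow_ge2, use k3 in simp)
  have mono: "T ^ (e + 1) \<le> T ^ p" using e T1 by (intro power_increasing) auto
  have "0 < 1 + T ^ (e + 1)" using T1 by (simp add: add_pos_pos)
  then have C: "1 / (1 + T ^ p) \<le> 1 / (1 + T ^ (e + 1))"
    using mono by (intro divide_left_mono) auto
  have "1 / (T ^ (p + 1) - 1) + 1 / (T ^ (2 * k - p + 1) - 1) < ?B + 1 / (1 + T ^ p)"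
  proof (cases "p = 1")
    case True
    have eq1: "1 / (T ^ (p + 1) - 1) - 1 / (1 + T ^ p) = (2 - T) / (T * T - 1)"
    proof -
      have "T * T - 1 = (T - 1) * (T + 1)" by (simp add: algebra_simps)
      moreover have "T - 1 > 0" "T + 1 > 0" using T1 by auto
      moreover have "1 / (a * b) - 1 / b = (1 - a) / (a * b)" if "a > 0" "b > 0" for a b :: real
        using that by (simp add: field_simps)
      ultimately have "1 / (T * T - 1) - 1 / (T + 1) = (2 - T) / (T * T - 1)" by simp
      then show ?thesis using True by (simp add: add.commute)
    qed
    have B2: "?B = (2 - T) / (T - 1)"
      unfolding Teq[symmetric] using V T1 by simp
    have eq2: "?B - (2 - T) / (T * T - 1) = (2 - T) * T / (T * T - 1)"
    proof -
      have "T * T - 1 = (T - 1) * (T + 1)" by (simp add: algebra_simps)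
      moreover have "T - 1 > 0" "T + 1 > 0" using T1 by auto
      moreover have "c / a - c / (a * b) = c * (b - 1) / (a * b)" if "a > 0" "b > 0" for a b c :: real
        using that by (simp add: field_simps)
      ultimately show ?thesis unfolding B2 by simp
    qed
    have eq3: "2 - T = (2 * T - 1) / ?V" unfolding Teq[symmetric] using T1 by simp
    have TT: "T * T - 1 > 0" using T_pow_gt[of 2] by (simp add: power2_eq_square)
    have TT2: "T * T > 2"
    proof -
      have "(17 / 10) * (17 / 10) < T * T" using T17 by (intro mult_strict_mono) auto
      then show ?thesis by simp
    qed
    have "?V + 1 < T ^ (2 * k - p + 1)"
    proof -
      have "2 * k - p + 1 = (k + 1) + (k - 1)" using k3 True by simp
      then have "T ^ (2 * k - p + 1) = ?V * T ^ (k - 1)" by (simp only: power_add)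
      moreover have "2 \<le> k - 1" using k3 by simp
      then have "T ^ (k - 1) > 2" using T_pow_ge2[of "k - 1"] TT2 by linarith
      then have "?V * T ^ (k - 1) > ?V * 2" using V by (intro mult_strict_left_mono) auto
      ultimately show ?thesis using V(1) by linarith
    qed
    then have "1 / (T ^ (2 * k - p + 1) - 1) < 1 / ?V" using V by (intro divide_strict_left_mono) auto
    also have "\<dots> \<le> (2 - T) * T / (T * T - 1)"
    proof -
      have "(T * T - 1) * 1 \<le> (2 * T - 1) * T"
        using T1 by (simp add: algebra_simps) (smt (verit) TT2 mult_less_cancel_left2)
      then have "1 \<le> (2 * T - 1) * T / (T * T - 1)" using TT by (simp add: field_simps)
      then have "1 / ?V \<le> (2 * T - 1) * T / (T * T - 1) / ?V" using V by (intro divide_right_mono) auto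
      moreover have "(2 - T) * T / (T * T - 1) = (2 * T - 1) * T / (T * T - 1) / ?V"
        unfolding eq3 by (simp only: times_divide_eq_left times_divide_eq_right divide_divide_eq_left mult_ac)
      ultimately show ?thesis by simp
    qed
    finally show ?thesis using eq1 eq2 by linarith
  next
    case False
    then have p2: "p \<ge> 2" using p by simp
    have Tp: "T ^ p * (T - 1) \<ge> 2"
    proof -
      have "(17 / 10 * (17 / 10)) * (7 / 10) \<le> (T * T) * (T - 1)" using T17 by (intro mult_mono) auto
      also have "\<dots> \<le> T ^ p * (T - 1)" using T_pow_ge2[OF p2] T1 by (intro mult_right_mono) auto
      finally show ?thesis by simp
    qed
    have "1 + T ^ p \<le> T ^ (p + 1) - 1" using Tp by (simp add: algebra_simps)
    moreover have "0 < 1 + T ^ p" using T_pow_gt[of p] p by simp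
    ultimately have "1 / (T ^ (p + 1) - 1) \<le> 1 / (1 + T ^ p)" by (intro frac_le) auto
    moreover have "1 / (T ^ (2 * k - p + 1) - 1) \<le> 1 / (?V - 1)"
    proof -
      have "?V \<le> T ^ (2 * k - p + 1)" using p T1 by (intro power_increasing) auto
      then show ?thesis using V by (intro divide_left_mono) auto
    qed
    moreover have "1 / (?V - 1) < ?B"
    proof -
      have "T * 1 < T * T" using T1 by (intro mult_strict_left_mono) auto
      then have "T < ?V" using V by linarith
      then have "T * T < T * ?V" using T1 by (intro mult_strict_left_mono) auto
      moreover have "T * T \<ge> 2 * T - 1" using zero_le_power2[of "T - 1"] by (simp add: power2_eq_square algebra_simps)
      ultimately have "(T - 1) * ?V < (2 * T - 1) * (?V - 1)" by (simp add: algebra_simps)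
      then show ?thesis using V T1 by (simp add: divide_simps)
    qed
    ultimately show ?thesis by linarith
  qed
  then show ?thesis unfolding fork_iff using C by linarith
qed

text \<open>For a branch along a cycle, which may be as long as \<open>p\<close> itself. Then fork
  and shorter direction leave \<open>2 / (s * s - 1)\<close> with \<open>s = T ^ (p + 1)\<close>;
  \<open>k \<le> 2 * p\<close> and \<open>p < k\<close> reduce everything to the single power
  \<open>T ^ (k + 2)\<close>.\<close>

lemma fork_mid:
  assumes p: "e \<le> p" "p < k" "k \<le> 2 * p"
  shows "lam < g p + g (2 * k - p) + f e"
proof -
  let ?V = "T ^ (k + 1)" and ?B = "(2 * T - 1) / ((T - 1) * T ^ (k + 1))"
  let ?s = "T ^ (p + 1)" and ?W = "T ^ (k + 2)"
  have V: "?V > 1" "?V \<ge> T * T" by (rule T_pow_gt, simp, rule T_pow_ge2, use k3 in simp)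
  have W: "?W > 1" by (rule T_pow_gt) simp
  have s: "?s > 1" by (rule T_pow_gt) simp
  have mono: "T ^ (e + 1) \<le> ?s" using p T1 by (intro power_increasing) auto
  have "0 < 1 + T ^ (e + 1)" using T1 by (simp add: add_pos_pos)
  then have C: "1 / (1 + ?s) \<le> 1 / (1 + T ^ (e + 1))"
    using mono by (intro divide_left_mono) auto
  have ss: "?s * ?s \<ge> ?W"
  proof -
    have "T ^ (k + 2) \<le> T ^ ((p + 1) + (p + 1))" using p T1 by (intro power_increasing) auto
    then show ?thesis by (simp only: power_add)
  qed
  have "1 / (?s - 1) - 1 / (1 + ?s) = 2 / (?s * ?s - 1)"
  proof -
    have "?s * ?s - 1 = (?s - 1) * (1 + ?s)" by (simp add: algebra_simps)
    then show ?thesis using s by (simp add: diff_frac_eq)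
  qed
  moreover have "2 / (?s * ?s - 1) \<le> 2 / (?W - 1)"
    using ss W by (intro divide_left_mono) auto
  moreover have "1 / (T ^ (2 * k - p + 1) - 1) \<le> 1 / (?W - 1)"
  proof -
    have "?W \<le> T ^ (2 * k - p + 1)" using p T1 by (intro power_increasing) auto
    then show ?thesis using W by (intro divide_left_mono) auto
  qed
  moreover have "2 / (?W - 1) + 1 / (?W - 1) < ?B"
  proof -
    have "?V * (2 * ((T - 1) * (T - 1)) + 1) > ?V * 1" using V T1 by (intro mult_strict_left_mono) auto
    moreover have "T * T \<ge> 2 * T - 1" using zero_le_power2[of "T - 1"] by (simp add: power2_eq_square algebra_simps)
    ultimately have "?V * (2 * ((T - 1) * (T - 1)) + 1) > 2 * T - 1" using V by linarith
    then have "3 * ((T - 1) * ?V) < (2 * T - 1) * (T * ?V - 1)" by (simp add: algebra_simps)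
    then have "3 / (T * ?V - 1) < ?B" using V T1 W by (simp add: divide_simps)
    moreover have "?W = T * ?V" by simp
    moreover have "2 / (?W - 1) + 1 / (?W - 1) = 3 / (?W - 1)" by (simp flip: add_divide_distrib)
    ultimately show ?thesis by simp
  qed
  ultimately have "1 / (?s - 1) + 1 / (T ^ (2 * k - p + 1) - 1) < ?B + 1 / (1 + ?s)" by linarith
  then show ?thesis unfolding fork_iff using C by linarith
qed

sublocale extremal_values k lam g f
proof
  show "k \<ge> 1" using k3 by simp
  show "lam > 0" using T1 t by (simp add: lam_def)
  show "g 0 = 0" by (simp add: g_def qrat_def)
  show "lam - g m > 0 \<and> g (Suc m) = 1 / (lam - g m)" for m
    unfolding lam_g using qn_pos[of m] qn_pos[of "Suc m"] t by (auto simp: g_eq simp del: qnum.simps)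
  show "g a \<le> g b" if "a \<le> b" for a b
    using qrat_mono[of T a b] that T1 t by (simp add: g_def divide_right_mono)
  have "1 + T > 0" using T1 by simp
  then show "f 0 = 2 / lam" using t by (simp add: f_def lam_def add.commute)
  show "lam - f m > 0 \<and> f (Suc m) = 1 / (lam - f m)" for m
  proof -
    have "1 + T ^ (m + 1) > 0" "1 + T ^ (m + 2) > 0" using T1 by (auto simp: add_pos_pos)
    then show ?thesis unfolding lam_f using t by (simp add: f_def)
  qed
  show "lam < g p + g (2 * k - p) + f e"
    if "p \<le> 2 * k" "(e < p \<and> e < 2 * k - p) \<or> (e \<le> p \<and> p < k \<and> k \<le> 2 * p)" for p e
    using that(2)
  proof
    assume e: "e < p \<and> e < 2 * k - p"
    show ?thesis
    proof (cases "p \<le> k")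
      case True
      then show ?thesis using fork_low[of p e] e by simp
    next
      case False
      then have "2 * k - (2 * k - p) = p" using that(1) by simp
      then show ?thesis using fork_low[of "2 * k - p" e] e False by (simp add: add.commute)
    qed
  next
    assume "e \<le> p \<and> p < k \<and> k \<le> 2 * p"
    then show ?thesis by (intro fork_mid) auto
  qed
  show "k = 1 \<Longrightarrow> lam * lam < 4" using k3 by simp
  fix X :: "nat \<Rightarrow> real" and m :: "nat \<Rightarrow> nat" and u v :: nat
  assume *: "u < v" "v \<le> 2 * k" "1 \<le> m u" "m u \<le> u" "1 \<le> m v" "m v \<le> 2 * k - v"
    "(\<Sum>p\<in>{u..v}. m p) = k" "\<And>p. u \<le> p \<Longrightarrow> p \<le> v \<Longrightarrow> X p > 0"
    and L: "X (Suc u) + (g u + g (m u)) * X u \<le> lam * X u"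
    and R: "X (v - 1) + (g (2 * k - v) + g (m v)) * X v \<le> lam * X v"
    and I: "\<And>p. u < p \<Longrightarrow> p < v \<Longrightarrow> X (p - 1) + X (Suc p) + g (m p) * X p \<le> lam * X p"
  have tg: "t * g a = qrat T a" "t * lam = T + 1" for a using t by (simp_all add: g_def lam_def)
  have scale: "t * A + t * B * C \<le> t * lam * C" if "A + B * C \<le> lam * C" for A B C
    using mult_left_mono[OF that, of t] t by (simp add: algebra_simps)
  show "m u = u \<and> m v = 2 * k - v \<and> m u + m v = k"
    using two_branch_rigidity[OF T1 T2 Teq t *] scale[OF L] scale[OF R] scale[OF I]
    by (simp add: tg distrib_left)
qed

end

section \<open>Quipus\<close>

lemma quipu_base_iff:
  "quipu_base i j u v \<longleftrightarrow>
     (v = u + 1 \<and> v \<le> 2 * (i + j)) \<or>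
     (1 \<le> i \<and> u = i \<and> v = 2 * (i + j) + 1) \<or>
     (v = u + 1 \<and> 2 * (i + j) + 1 \<le> u \<and> v \<le> 2 * (i + j) + i) \<or>
     (1 \<le> j \<and> u = 2 * i + j \<and> v = 2 * (i + j) + i + 1) \<or>
     (v = u + 1 \<and> 2 * (i + j) + i + 1 \<le> u \<and> v \<le> 2 * (i + j) + i + j)"
  by (simp add: quipu_base_def Let_def)

lemma quipu_sym: "quipu i j u v \<Longrightarrow> quipu i j v u"
  by (auto simp: quipu_def)

lemma quipu_simple: "simple_graph (3 * (i + j) + 1) (quipu i j)"
  unfolding simple_graph_def quipu_def quipu_base_iff by auto

text \<open>The branching vertex with legs of length \<open>i\<close> is \<open>j\<close> away from
  the middle of the main path, and conversely. This yields both connectedness and the upper bound on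
  the diameter.\<close>

lemma quipu_to_center:
  assumes v: "v < 3 * (i + j) + 1"
  shows "\<exists>l\<le>i + j. walk (quipu i j) l v (i + j)"
proof -
  let ?Q = "quipu i j" and ?k = "i + j"
  have main: "walk ?Q (b - a) a b" if "a \<le> b" "b \<le> 2 * ?k" for a b
    using path_walk[of a b ?Q "\<lambda>a. a"] that by (simp add: quipu_def quipu_base_iff)
  have main': "walk ?Q (b - a) b a" if "a \<le> b" "b \<le> 2 * ?k" for a b
    using walk_rev[OF main[OF that]] quipu_sym by blast
  consider "v \<le> ?k" | "?k < v" "v \<le> 2 * ?k" | "2 * ?k < v" "v \<le> 2 * ?k + i" | "2 * ?k + i < v"
    by linarith
  then show ?thesis
  proof cases
    case 1 then show ?thesis using main[of v ?k] by (intro exI[of _ "?k - v"]) auto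
  next
    case 2 then show ?thesis using main'[of ?k v] by (intro exI[of _ "v - ?k"]) auto
  next
    case 3
    have "walk ?Q (v - 2 * ?k) v i"
    proof -
      have "walk ?Q (v - (2 * ?k + 1)) (2 * ?k + 1) v"
        using path_walk[of "2 * ?k + 1" v ?Q "\<lambda>a. a"] 3 by (simp add: quipu_def quipu_base_iff)
      moreover have "?Q i (2 * ?k + 1)" using 3 by (auto simp: quipu_def quipu_base_iff)
      ultimately have "walk ?Q (Suc (v - (2 * ?k + 1))) i v" by (rule walkS[rotated])
      moreover have "Suc (v - (2 * ?k + 1)) = v - 2 * ?k" using 3 by simp
      ultimately show ?thesis using walk_rev quipu_sym by metis
    qed
    moreover have "walk ?Q j i ?k" using main[of i ?k] by simp
    ultimately have "walk ?Q (v - 2 * ?k + j) v ?k" by (rule walk_append)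
    then show ?thesis using 3 by (intro exI[of _ "v - 2 * ?k + j"]) auto
  next
    case 4
    have "walk ?Q (v - 2 * ?k - i) v (2 * i + j)"
    proof -
      have "walk ?Q (v - (2 * ?k + i + 1)) (2 * ?k + i + 1) v"
        using path_walk[of "2 * ?k + i + 1" v ?Q "\<lambda>a. a"] 4 v by (simp add: quipu_def quipu_base_iff)
      moreover have "?Q (2 * i + j) (2 * ?k + i + 1)" using 4 v by (auto simp: quipu_def quipu_base_iff)
      ultimately have "walk ?Q (Suc (v - (2 * ?k + i + 1))) (2 * i + j) v" by (rule walkS[rotated])
      moreover have "Suc (v - (2 * ?k + i + 1)) = v - 2 * ?k - i" using 4 by simp
      ultimately show ?thesis using walk_rev quipu_sym by metis
    qed
    moreover have "walk ?Q i (2 * i + j) ?k" using main'[of ?k "2 * i + j"] by simp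
    ultimately have "walk ?Q (v - 2 * ?k - i + i) v ?k" by (rule walk_append)
    then show ?thesis using 4 v by (intro exI[of _ "v - 2 * ?k - i + i"]) auto
  qed
qed

lemma quipu_walk:
  assumes "u < 3 * (i + j) + 1" "v < 3 * (i + j) + 1"
  shows "\<exists>l\<le>2 * (i + j). walk (quipu i j) l u v"
proof -
  obtain a b where a: "a \<le> i + j" "walk (quipu i j) a u (i + j)"
    and b: "b \<le> i + j" "walk (quipu i j) b v (i + j)"
    using quipu_to_center assms by metis
  have "walk (quipu i j) (a + b) u v"
    using walk_append[OF a(2) walk_rev[OF b(2)]] quipu_sym by blast
  then show ?thesis using a b by (intro exI[of _ "a + b"]) auto
qed

lemma quipu_connected: "connected_graph (3 * (i + j) + 1) (quipu i j)"
  unfolding connected_graph_def using quipu_walk by blast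

text \<open>The retraction onto the main path that collapses each extra leg to its foot. It advances
  by at most 1 per edge, which bounds the distance between the ends of the main path from
  below.\<close>

definition quipu_pos :: "nat \<Rightarrow> nat \<Rightarrow> nat \<Rightarrow> nat" where
  "quipu_pos i j v = (if v \<le> 2 * (i + j) then v else if v \<le> 2 * (i + j) + i then i else 2 * i + j)"

lemma quipu_pos_edge: "quipu i j u v \<Longrightarrow> quipu_pos i j v \<le> Suc (quipu_pos i j u)"
  unfolding quipu_def quipu_base_iff quipu_pos_def by auto

lemma quipu_pos_walk: "walk (quipu i j) l u v \<Longrightarrow> quipu_pos i j v \<le> quipu_pos i j u + l"
  by (induction rule: walk.induct) (auto dest!: quipu_pos_edge)

lemma quipu_diameter: "diameter (3 * (i + j) + 1) (quipu i j) = 2 * (i + j)"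
proof -
  let ?n = "3 * (i + j) + 1" and ?Q = "quipu i j"
  interpret conn_graph ?n ?Q
    by unfold_locales (rule quipu_simple, rule quipu_connected)
  have le: "d u v \<le> 2 * (i + j)" if "u < ?n" "v < ?n" for u v
    using quipu_walk[OF that] dist_le by (meson order_trans)
  have "quipu_pos i j (2 * (i + j)) \<le> quipu_pos i j 0 + d 0 (2 * (i + j))"
    by (rule quipu_pos_walk[OF dist_walk]) auto
  then have far: "d 0 (2 * (i + j)) = 2 * (i + j)"
    using le[of 0 "2 * (i + j)"] by (simp add: quipu_pos_def)
  show ?thesis unfolding diameter_def
  proof (rule Max_eqI)
    have "{d u v |u v. u < ?n \<and> v < ?n} \<subseteq> {..2 * (i + j)}" using le by auto
    then show "finite {d u v |u v. u < ?n \<and> v < ?n}" by (rule finite_subset) simp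
    have "0 < ?n" "2 * (i + j) < ?n" by auto
    then show "2 * (i + j) \<in> {d u v |u v. u < ?n \<and> v < ?n}" using far by (metis (mono_tags, lifting) mem_Collect_eq)
  qed (use le in auto)
qed

text \<open>Reverses the main path and exchanges the label blocks of the extra legs; as the blocks
  have sizes \<open>i\<close> and \<open>j\<close>, they shift by \<open>j\<close> and
  \<open>i\<close>.\<close>

definition quipu_flip :: "nat \<Rightarrow> nat \<Rightarrow> nat \<Rightarrow> nat" where
  "quipu_flip i j u = (if u \<le> 2 * (i + j) then 2 * (i + j) - u
     else if u \<le> 2 * (i + j) + i then u + j else u - i)"

lemma quipu_flip_flip: "u < 3 * (i + j) + 1 \<Longrightarrow> quipu_flip j i (quipu_flip i j u) = u"
  by (auto simp: quipu_flip_def)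

lemma quipu_flip_lt: "u < 3 * (i + j) + 1 \<Longrightarrow> quipu_flip i j u < 3 * (i + j) + 1"
  by (auto simp: quipu_flip_def)

lemma quipu_flip_base:
  assumes "quipu_base i j u v"
  shows "quipu j i (quipu_flip i j u) (quipu_flip i j v)"
proof -
  let ?k = "i + j"
  from assms consider "v = u + 1" "v \<le> 2 * ?k" | "1 \<le> i" "u = i" "v = 2 * ?k + 1"
    | "v = u + 1" "2 * ?k + 1 \<le> u" "v \<le> 2 * ?k + i" | "1 \<le> j" "u = 2 * i + j" "v = 2 * ?k + i + 1"
    | "v = u + 1" "2 * ?k + i + 1 \<le> u" "v \<le> 2 * ?k + i + j"
    unfolding quipu_base_iff by blast
  then show ?thesis
  proof cases
    case 1
    then have "quipu_flip i j u = quipu_flip i j v + 1" "quipu_flip i j u \<le> 2 * (j + i)"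
      by (auto simp: quipu_flip_def)
    then show ?thesis by (simp add: quipu_def quipu_base_iff)
  next
    case 2
    then have "quipu_flip i j u = 2 * j + i" "quipu_flip i j v = 2 * (j + i) + j + 1"
      by (auto simp: quipu_flip_def)
    then show ?thesis using 2 by (simp add: quipu_def quipu_base_iff)
  next
    case 3
    then have "quipu_flip i j u = u + j" "quipu_flip i j v = u + j + 1"
      by (auto simp: quipu_flip_def)
    then show ?thesis using 3 by (simp add: quipu_def quipu_base_iff)
  next
    case 4
    then have "quipu_flip i j u = j" "quipu_flip i j v = 2 * (j + i) + 1"
      by (auto simp: quipu_flip_def)
    then show ?thesis using 4 by (simp add: quipu_def quipu_base_iff)
  next
    case 5
    then have "quipu_flip i j u = u - i" "quipu_flip i j v = (u - i) + 1"
      by (auto simp: quipu_flip_def)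
    moreover have "2 * (j + i) + 1 \<le> u - i" "u - i + 1 \<le> 2 * (j + i) + j" using 5 by auto
    ultimately show ?thesis by (simp add: quipu_def quipu_base_iff)
  qed
qed

lemma quipu_flip_edge: "quipu i j u v \<Longrightarrow> quipu j i (quipu_flip i j u) (quipu_flip i j v)"
  using quipu_flip_base quipu_sym unfolding quipu_def[of i j] by blast

lemma quipu_swap: "graph_iso (3 * (i + j) + 1) (quipu i j) (quipu j i)"
proof -
  let ?n = "3 * (i + j) + 1"
  have flip': "quipu_flip i j (quipu_flip j i u) = u" "quipu_flip j i u < ?n" if "u < ?n" for u
    using quipu_flip_flip[of u j i] quipu_flip_lt[of u j i] that by (simp_all add: add.commute)
  have "bij_betw (quipu_flip i j) {0..<?n} {0..<?n}"
    by (rule bij_betw_byWitness[where f' = "quipu_flip j i"])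
      (use flip' quipu_flip_flip quipu_flip_lt in auto)
  moreover have "quipu i j u v" if "u < ?n" "v < ?n" "quipu j i (quipu_flip i j u) (quipu_flip i j v)" for u v
    using quipu_flip_edge[OF that(3)] quipu_flip_flip that by simp
  ultimately show ?thesis
    unfolding graph_iso_def using quipu_flip_edge by (intro exI[of _ "quipu_flip i j"]) blast
qed

section \<open>Positive eigenvectors of the quipus\<close>

text \<open>Glues an eigenvector from two profiles: multiples of \<open>s\<close> on the legs,
  counted from a virtual vertex beyond the leaf where \<open>s 0 = 0\<close>, and \<open>z\<close>
  on the stretch of length \<open>k\<close> between the branching vertices. The conditions on
  \<open>c\<close> and \<open>c'\<close> express agreement and the eigenvalue equation at these
  vertices.\<close>

lemma quipu_eigenvector:
  fixes s z :: "nat \<Rightarrow> real"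
  assumes k: "i + j = k" "k \<ge> 1"
    and s: "s 0 = 0" "\<And>l. 1 \<le> l \<Longrightarrow> l \<le> Suc k \<Longrightarrow> s l > 0"
      "\<And>l. l < k \<Longrightarrow> s l + s (Suc (Suc l)) = lam * s (Suc l)"
    and z: "\<And>d. d \<le> k \<Longrightarrow> z d > 0" "\<And>d. Suc d < k \<Longrightarrow> z d + z (Suc (Suc d)) = lam * z (Suc d)"
    and c: "c * s (Suc i) = z 0" "z 1 + 2 * (c * s i) = lam * z 0"
    and c': "c' * s (Suc j) = z k" "z (k - 1) + 2 * (c' * s j) = lam * z k"
  shows "\<exists>y. (\<forall>v<3 * k + 1. y v > 0) \<and> (\<forall>v<3 * k + 1. (\<Sum>w\<in>nbrs (quipu i j) v. y w) = lam * y v)"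
proof -
  define y where "y v = (if v < i then c * s (v + 1) else if v \<le> 2 * i + j then z (v - i)
     else if v \<le> 2 * k then c' * s (2 * k + 1 - v) else if v \<le> 2 * k + i then c * s (2 * k + i + 1 - v)
     else c' * s (3 * k + 1 - v))" for v
  have cpos: "c > 0" "c' > 0"
  proof -
    have "s (Suc i) > 0" "s (Suc j) > 0" using k by (auto intro!: s(2))
    moreover have "c * s (Suc i) > 0" "c' * s (Suc j) > 0" unfolding c c' using z(1) by auto
    ultimately show "c > 0" "c' > 0" by (auto simp: zero_less_mult_iff)
  qed
  have pos: "y v > 0" if "v < 3 * k + 1" for v
  proof -
    have zs: "v - i \<le> k \<Longrightarrow> z (v - i) > 0" using z(1) by blast
    show ?thesis unfolding y_def using that cpos zs k by (auto intro!: mult_pos_pos s(2))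
  qed
  have mainL: "y v = c * s (v + 1)" if "v \<le> i" for v
    using that c(1) by (cases "v = i") (auto simp: y_def)
  have mainM: "y (i + d) = z d" if "d \<le> k" for d
    using that k by (auto simp: y_def)
  have mainR: "y (2 * k - l) = c' * s (l + 1)" if "l \<le> j" for l
  proof (cases "l = j")
    case True
    have "2 * k - l = i + k" using True k by simp
    then show ?thesis using mainM[of k] c'(1) True by simp
  next
    case False
    then have "\<not> 2 * k - l \<le> 2 * i + j" "2 * k + 1 - (2 * k - l) = l + 1" using that k by auto
    then show ?thesis using k by (auto simp: y_def)
  qed
  have legL: "y (2 * k + i + 1 - l) = c * s l" if "1 \<le> l" "l \<le> i" for l
  proof -
    have "2 * k + i + 1 - (2 * k + i + 1 - l) = l" using that by simp
    moreover have "2 * k < 2 * k + i + 1 - l" "2 * k + i + 1 - l \<le> 2 * k + i" using that by auto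
    ultimately show ?thesis using k by (auto simp: y_def)
  qed
  have legR: "y (3 * k + 1 - l) = c' * s l" if "1 \<le> l" "l \<le> j" for l
  proof -
    have "3 * k + 1 - (3 * k + 1 - l) = l" using that k by simp
    moreover have "2 * k + i < 3 * k + 1 - l" using that k by auto
    ultimately show ?thesis using k by (auto simp: y_def)
  qed
  have scale: "a * s l + a * s (Suc (Suc l)) = lam * (a * s (Suc l))" if "l < k" for a l
    using arg_cong[OF s(3)[OF that], of "\<lambda>x. a * x"] by (simp add: algebra_simps)
  have nbr: "nbrs (quipu i j) v = {w. quipu_base i j v w} \<union> {w. quipu_base i j w v}" for v
    by (auto simp: nbrs_def quipu_def)
  have eig: "(\<Sum>w\<in>nbrs (quipu i j) v. y w) = lam * y v" if v: "v < 3 * k + 1" for v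
  proof -
    consider "v < i" | "v = i" | "i < v" "v < 2 * i + j" | "v = 2 * i + j" | "2 * i + j < v" "v \<le> 2 * k"
      | "2 * k < v" "v \<le> 2 * k + i" | "2 * k + i < v" by linarith
    then show ?thesis
    proof cases
      case 1
      show ?thesis
      proof (cases "v = 0")
        case True
        have "nbrs (quipu i j) v = {1}"
          unfolding nbr quipu_base_iff using 1 True k by auto
        then show ?thesis using mainL[of 0] mainL[of 1] scale[of 0 c] 1 True s(1) k by simp
      next
        case False
        have "nbrs (quipu i j) v = {v - 1, v + 1}"
          unfolding nbr quipu_base_iff using 1 False k by auto
        moreover have "v - 1 \<noteq> v + 1" by simp
        ultimately show ?thesis
          using mainL[of "v - 1"] mainL[of v] mainL[of "v + 1"] scale[of v c] 1 False k by simp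
      qed
    next
      case 2
      show ?thesis
      proof (cases "i = 0")
        case True
        have "nbrs (quipu i j) v = {1}"
          unfolding nbr quipu_base_iff using 2 True k by auto
        then show ?thesis using mainM[of 0] mainM[of 1] 2 True c(2) s(1) k by simp
      next
        case False
        have "nbrs (quipu i j) v = {i - 1, i + 1, 2 * k + 1}"
          unfolding nbr quipu_base_iff using 2 False k by auto
        moreover have "i - 1 \<noteq> i + 1" "i - 1 \<noteq> 2 * k + 1" "i + 1 \<noteq> 2 * k + 1" using k by auto
        moreover have "y (2 * k + 1) = c * s i" using legL[of i] False by simp
        ultimately show ?thesis
          using mainL[of "i - 1"] mainM[of 0] mainM[of 1] 2 False c(2) k by simp
      qed
    next
      case 3
      define d where "d = v - i - 1"
      have d: "v = i + Suc d" "Suc d < k" using 3 k by (auto simp: d_def)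
      have "nbrs (quipu i j) v = {i + d, i + Suc (Suc d)}"
        unfolding nbr quipu_base_iff using d 3 k by auto
      then show ?thesis using mainM[of d] mainM[of "Suc d"] mainM[of "Suc (Suc d)"] z(2)[OF d(2)] d by simp
    next
      case 4
      have vk: "v = i + k" using 4 k by simp
      show ?thesis
      proof (cases "j = 0")
        case True
        have "nbrs (quipu i j) v = {i + (k - 1)}"
          unfolding nbr quipu_base_iff using 4 True k by auto
        then show ?thesis using mainM[of "k - 1"] mainM[of k] True c'(2) s(1) k vk by simp
      next
        case False
        have "nbrs (quipu i j) v = {v - 1, v + 1, 2 * k + i + 1}"
          unfolding nbr quipu_base_iff using 4 False k by auto
        moreover have "v - 1 = i + (k - 1)" "v + 1 = 2 * k - (j - 1)" "2 * k + i + 1 = 3 * k + 1 - j"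
          using 4 False k by auto
        ultimately have nn: "nbrs (quipu i j) v = {i + (k - 1), 2 * k - (j - 1), 3 * k + 1 - j}" by simp
        have ne: "i + (k - 1) \<noteq> 2 * k - (j - 1)" "i + (k - 1) \<noteq> 3 * k + 1 - j" "2 * k - (j - 1) \<noteq> 3 * k + 1 - j"
          using k False by linarith+
        have "(\<Sum>w\<in>nbrs (quipu i j) v. y w) = y (i + (k - 1)) + y (2 * k - (j - 1)) + y (3 * k + 1 - j)"
          unfolding nn using ne by (simp add: add.assoc)
        also have "\<dots> = z (k - 1) + c' * s j + c' * s j"
          using mainM[of "k - 1"] mainR[of "j - 1"] legR[of j] False by simp
        finally show ?thesis using c'(2) mainM[of k] vk by simp
      qed
    next
      case 5
      define l where "l = 2 * k - v"
      have l: "v = 2 * k - l" "l < j" using 5 k by (auto simp: l_def)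
      show ?thesis
      proof (cases "l = 0")
        case True
        have "nbrs (quipu i j) v = {2 * k - 1}"
          unfolding nbr quipu_base_iff using 5 True l k by auto
        then show ?thesis using mainR[of 0] mainR[of 1] scale[of 0 c'] l True s(1) k by simp
      next
        case False
        have "v < 2 * k" using False l k by simp
        then have "nbrs (quipu i j) v = {v - 1, v + 1}"
          unfolding nbr quipu_base_iff using 5 k by auto
        moreover have "v - 1 = 2 * k - (l + 1)" "v + 1 = 2 * k - (l - 1)" using l False k by auto
        ultimately have nn: "nbrs (quipu i j) v = {2 * k - (l + 1), 2 * k - (l - 1)}" by simp
        have ne: "2 * k - (l + 1) \<noteq> 2 * k - (l - 1)" using l False k by linarith
        have "(\<Sum>w\<in>nbrs (quipu i j) v. y w) = y (2 * k - (l + 1)) + y (2 * k - (l - 1))"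
          unfolding nn using ne by simp
        also have "\<dots> = c' * s (Suc (Suc l)) + c' * s l" using mainR[of "l + 1"] mainR[of "l - 1"] l False by simp
        finally show ?thesis using mainR[of l] scale[of l c'] l k by simp
      qed
    next
      case 6
      define l where "l = 2 * k + i + 1 - v"
      have l: "v = 2 * k + i + 1 - l" "1 \<le> l" "l \<le> i" using 6 k by (auto simp: l_def)
      have lv: "v = 2 * k + 1 \<longleftrightarrow> l = i" using l by auto
      have up: "y (if l = i then i else v - 1) = c * s (Suc l)"
        using legL[of "l + 1"] mainL[of i] l by auto
      show ?thesis
      proof (cases "l = 1")
        case True
        have "v = 2 * k + i" using True l by simp
        then have "nbrs (quipu i j) v = {if v = 2 * k + 1 then i else v - 1}"
          unfolding nbr quipu_base_iff using 6 k(1) by auto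
        then have "nbrs (quipu i j) v = {if l = i then i else v - 1}" by (simp only: lv)
        then show ?thesis using up legL[of l] scale[of 0 c] l True s(1) k by simp
      next
        case False
        have "v < 2 * k + i" using False l by simp
        then have "nbrs (quipu i j) v = {if v = 2 * k + 1 then i else v - 1, v + 1}"
          unfolding nbr quipu_base_iff using 6 k(1) by auto
        then have nn: "nbrs (quipu i j) v = {if l = i then i else v - 1, v + 1}" by (simp only: lv)
        have ne: "(if l = i then i else v - 1) \<noteq> v + 1" using 6 k by auto
        have "v + 1 = 2 * k + i + 1 - (l - 1)" using l False by simp
        then have "y (v + 1) = c * s (l - 1)" using legL[of "l - 1"] l False by simp
        moreover have "l - 1 < k" using l k by simp
        ultimately show ?thesis unfolding nn using ne up legL[of l] scale[of "l - 1" c] l False by simp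
      qed
    next
      case 7
      define l where "l = 3 * k + 1 - v"
      have l: "v = 3 * k + 1 - l" "1 \<le> l" "l \<le> j" using 7 v k by (auto simp: l_def)
      have lv: "v = 2 * k + i + 1 \<longleftrightarrow> l = j" using l k by auto
      have up: "y (if l = j then 2 * i + j else v - 1) = c' * s (Suc l)"
      proof (cases "l = j")
        case True
        have "2 * i + j = 2 * k - j" using k by simp
        then show ?thesis using mainR[of j] True by simp
      next
        case False
        then show ?thesis using legR[of "l + 1"] l by simp
      qed
      show ?thesis
      proof (cases "l = 1")
        case True
        have "v = 2 * k + i + j" using True l k by simp
        then have "nbrs (quipu i j) v = {if v = 2 * k + i + 1 then 2 * i + j else v - 1}"
          unfolding nbr quipu_base_iff using 7 k(1) by auto
        then have "nbrs (quipu i j) v = {if l = j then 2 * i + j else v - 1}" by (simp only: lv)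
        then show ?thesis using up legR[of l] scale[of 0 c'] l True s(1) k by simp
      next
        case False
        have "v < 2 * k + i + j" using False l k by simp
        then have "nbrs (quipu i j) v = {if v = 2 * k + i + 1 then 2 * i + j else v - 1, v + 1}"
          unfolding nbr quipu_base_iff using 7 k(1) by auto
        then have nn: "nbrs (quipu i j) v = {if l = j then 2 * i + j else v - 1, v + 1}" by (simp only: lv)
        have ne: "(if l = j then 2 * i + j else v - 1) \<noteq> v + 1" using 7 k by auto
        have "v + 1 = 3 * k + 1 - (l - 1)" using l False k by simp
        then have "y (v + 1) = c' * s (l - 1)" using legR[of "l - 1"] l False by simp
        moreover have "l - 1 < k" using l k by simp
        ultimately show ?thesis unfolding nn using ne up legR[of l] scale[of "l - 1" c'] l False by simp
      qed
    qed
  qed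
  show ?thesis using pos eig by blast
qed

definition has_pos_eigenvector :: "nat \<Rightarrow> (nat \<Rightarrow> nat \<Rightarrow> bool) \<Rightarrow> real \<Rightarrow> bool" where
  "has_pos_eigenvector n E r \<longleftrightarrow>
     (\<exists>y. (\<forall>v<n. y v > 0) \<and> (\<forall>v<n. (\<Sum>w\<in>nbrs E v. y w) = r * y v))"

text \<open>Both quipus are the starlike tree with three legs of length \<open>k\<close>; the
  branching vertex without legs is the leaf of the third one. Hence \<open>z\<close> is the leg
  profile again, shifted by one or reversed.\<close>

lemma starlike_eigenvector:
  fixes s :: "nat \<Rightarrow> real"
  assumes k: "k \<ge> 1"
    and s: "s 0 = 0" "\<And>l. 1 \<le> l \<Longrightarrow> l \<le> Suc k \<Longrightarrow> s l > 0"
      "\<And>l. l < k \<Longrightarrow> s l + s (Suc (Suc l)) = lam * s (Suc l)"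
    and center: "3 * s k = lam * s (Suc k)"
  shows "has_pos_eigenvector (3 * k + 1) (quipu 0 k) lam"
    and "has_pos_eigenvector (3 * k + 1) (quipu k 0) lam"
proof -
  have s2: "s 2 = lam * s 1" using s(3)[of 0] s(1) k by (simp add: numeral_2_eq_2)
  show "has_pos_eigenvector (3 * k + 1) (quipu 0 k) lam"
    unfolding has_pos_eigenvector_def
  proof (rule quipu_eigenvector[where s = s and z = "\<lambda>d. s (Suc d)" and c = 1 and c' = 1])
    show "s (Suc 1) + 2 * (1 * s 0) = lam * s (Suc 0)" using s2 s(1) by (simp add: numeral_2_eq_2)
    show "s (Suc (k - 1)) + 2 * (1 * s k) = lam * s (Suc k)" using center k by simp
  qed (use k s in auto)
  have rec: "s (Suc k - d) + s (Suc k - Suc (Suc d)) = lam * s (Suc k - Suc d)" if "Suc d < k" for d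
  proof -
    have "Suc k - Suc d = Suc (k - Suc d)" "Suc k - d = Suc (Suc (k - Suc d))" using that by auto
    then show ?thesis using s(3)[of "k - Suc d"] that by (simp add: add.commute)
  qed
  show "has_pos_eigenvector (3 * k + 1) (quipu k 0) lam"
    unfolding has_pos_eigenvector_def
  proof (rule quipu_eigenvector[where s = s and z = "\<lambda>d. s (Suc k - d)" and c = 1 and c' = 1])
    have "Suc k - (k - 1) = 2" using k by simp
    then show "s (Suc k - (k - 1)) + 2 * (1 * s 0) = lam * s (Suc k - k)"
      using s2 s(1) k by (simp add: Suc_diff_le numeral_2_eq_2)
    show "s (Suc k - 1) + 2 * (1 * s k) = lam * s (Suc k - 0)" using center k by simp
  qed (use k s rec in auto)
qed

lemma quipu_eigenvector_1:
  assumes "i + j = 1"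
  shows "has_pos_eigenvector (3 * 1 + 1) (quipu i j) (sqrt 3)"
proof -
  define s :: "nat \<Rightarrow> real" where "s l = (if l = 0 then 0 else if l = 1 then 1 else sqrt 3)" for l
  have "has_pos_eigenvector (3 * 1 + 1) (quipu 0 1) (sqrt 3)"
    "has_pos_eigenvector (3 * 1 + 1) (quipu 1 0) (sqrt 3)"
    by (rule starlike_eigenvector[where s = s]; simp add: s_def)+
  moreover have "i = 0 \<and> j = 1 \<or> i = 1 \<and> j = 0" using assms by auto
  ultimately show ?thesis by auto
qed

lemma quipu_eigenvector_2:
  assumes "i + j = 2"
  shows "has_pos_eigenvector (3 * 2 + 1) (quipu i j) 2"
proof -
  have "has_pos_eigenvector (3 * 2 + 1) (quipu 0 2) 2" "has_pos_eigenvector (3 * 2 + 1) (quipu 2 0) 2"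
    by (rule starlike_eigenvector[where s = real]; simp)+
  \<comment> \<open>Value 2 on the stretch and 1 on the four leaves.\<close>
  moreover have "has_pos_eigenvector (3 * 2 + 1) (quipu 1 1) 2"
    unfolding has_pos_eigenvector_def
    by (rule quipu_eigenvector[where s = real and z = "\<lambda>_. 2" and c = 1 and c' = 1]) auto
  moreover have "i = 0 \<and> j = 2 \<or> i = 1 \<and> j = 1 \<or> i = 2 \<and> j = 0" using assms by auto
  ultimately show ?thesis by auto
qed

context extremal_base
begin

text \<open>Proportional to \<open>t ^ l - 1 / t ^ l\<close>, the solution along a path that
  vanishes at 0.\<close>

definition leg where "leg l = qnum T l / t ^ l" for l
text \<open>The combination of \<open>t ^ d\<close> and \<open>1 / t ^ d\<close> that fits the legs
  at both branching vertices, scaled so that exchanging \<open>i\<close> and \<open>j\<close>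
  amounts to reversing the stretch.\<close>

definition mid where "mid i j d = qexc T j * t ^ d / t ^ j + qexc T i * t ^ j / t ^ d" for i j d

lemma t1: "t > 1"
proof (rule ccontr)
  assume "\<not> t > 1"
  then have "t * t \<le> 1 * 1" using t by (intro mult_mono) auto
  then show False using T1 t by simp
qed

lemma leg_pos: "l \<ge> 1 \<Longrightarrow> leg l > 0"
  using qnum_strict_mono[of T 0 l] T1 t by (simp add: leg_def)

lemma lam_t: "lam * t = T + 1" using t by (simp add: lam_def)

lemma leg_rec: "leg l + leg (Suc (Suc l)) = lam * leg (Suc l)"
proof -
  have "leg l = T * qnum T l / t ^ Suc (Suc l)"
  proof -
    have "leg l = (t * t) * qnum T l / t ^ Suc (Suc l)" using t(1) by (simp add: leg_def)
    then show ?thesis by (simp only: t(2))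
  qed
  moreover have "lam * leg (Suc l) = (lam * t) * qnum T (Suc l) / t ^ Suc (Suc l)"
    using t(1) by (simp add: leg_def del: qnum.simps)
  moreover have "T * qnum T l + qnum T (Suc (Suc l)) = (lam * t) * qnum T (Suc l)"
    unfolding lam_t by (simp add: algebra_simps)
  ultimately show ?thesis unfolding leg_def[of "Suc (Suc l)"] by (metis add_divide_distrib)
qed

lemma leg_ratio: "leg i / leg (Suc i) = g i"
  using t(1) by (simp add: leg_def g_eq)

lemma mid_flip: "i + j = k \<Longrightarrow> d \<le> k \<Longrightarrow> mid i j (k - d) = mid j i d"
proof -
  assume k: "i + j = k" "d \<le> k"
  have "t ^ (k - d) * t ^ d = t ^ i * t ^ j" using k by (simp flip: power_add)
  then have "t ^ (k - d) / t ^ j = t ^ i / t ^ d" "t ^ j / t ^ (k - d) = t ^ d / t ^ i"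
    using t(1) by (simp_all add: field_simps)
  then show ?thesis unfolding mid_def by (simp only: times_divide_eq_right[symmetric] add.commute)
qed

lemma qexc_k: "qexc T k = T ^ (k + 1)"
proof -
  have "(T - 1) * qexc T k = (T - 1) * T ^ (k + 1)"
    using Teq unfolding qexc_closed by (simp add: algebra_simps)
  then show ?thesis using T1 by simp
qed

lemma mid_pos_0: "d \<le> k \<Longrightarrow> mid 0 k d > 0"
proof -
  assume "d \<le> k"
  have "t ^ k / t ^ d \<le> t ^ k" using t1 by (simp add: divide_le_eq)
  also have "t ^ k < t ^ k * (t * t)" using t1 by (simp add: less_1_mult)
  also have "\<dots> \<le> t ^ k * (t * t) * t ^ d" using t1 by simp
  also have "\<dots> = T ^ (k + 1) * t ^ d / t ^ k"
  proof -
    have "T ^ (k + 1) = (t ^ k * (t * t)) * t ^ k"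
      unfolding t(2)[symmetric] by (simp add: power_mult_distrib)
    then show ?thesis using t(1) by simp
  qed
  finally show ?thesis by (simp add: mid_def qexc_k[simplified] qexc_def[of T 0])
qed

text \<open>For \<open>i = 0\<close> the coefficient \<open>qexc T 0 = - 1\<close> is negative, and
  positivity rests on \<open>qexc T k = T ^ (k + 1)\<close>; \<open>j = 0\<close> is the mirror
  image.\<close>

lemma mid_pos:
  assumes k: "i + j = k" and d: "d \<le> k"
  shows "mid i j d > 0"
proof -
  consider "i = 0" | "j = 0" | "1 \<le> i" "1 \<le> j" by linarith
  then show ?thesis
  proof cases
    case 1 then show ?thesis using mid_pos_0[OF d] k by simp
  next
    case 2
    then have "mid i j d = mid 0 k (k - d)" using mid_flip[of 0 k d] k d by simp
    then show ?thesis using mid_pos_0[of "k - d"] by simp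
  next
    case 3 then show ?thesis using qexc_pos[OF T1] t(1) by (simp add: mid_def add_pos_pos)
  qed
qed

lemma mid_rec: "mid i j d + mid i j (Suc (Suc d)) = lam * mid i j (Suc d)"
proof -
  define a where "a = qexc T j / t ^ j"
  define b where "b = qexc T i * t ^ j"
  have m: "mid i j e = a * t ^ e + b / t ^ e" for e by (simp add: mid_def a_def b_def)
  have l: "lam = t + 1 / t" using t by (simp add: lam_def field_simps)
  show ?thesis unfolding m l using t(1) by (simp add: field_simps)
qed

text \<open>The reason why the whole family shares one spectral radius: after
  \<open>qexc_complement\<close> the length \<open>j\<close> enters only through the common factor
  \<open>t ^ j\<close>, and the remaining identity holds for every \<open>i\<close>.\<close>

lemma mid_end:
  assumes k: "i + j = k"
  shows "mid i j 1 + 2 * (g i * mid i j 0) = lam * mid i j 0"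
proof -
  define A where "A = t ^ j"
  define S where "S = qnum T (Suc i)"
  have A: "A > 0" "A * A = T ^ j"
    using t(1) by (auto simp: A_def t(2)[symmetric] power_mult_distrib)
  have S: "S > 0" using qn_pos by (simp add: S_def)
  have ei: "qexc T i = S - 2" by (simp add: qexc_def S_def)
  have ej: "qexc T j = A * A * (2 - (2 - T) * S)"
  proof -
    have "k - i = j" "i \<le> k" using k by auto
    then show ?thesis using qexc_complement[OF T1 Teq, of i] unfolding A(2) S_def by (simp del: qnum.simps)
  qed
  have gi: "g i = (S - 1) / (t * S)"
  proof -
    have "t * g i = qrat T i" using t by (simp add: g_def)
    then have "t * g i = (S - 1) / S" using S by (simp add: qrat_def diff_divide_distrib flip: S_def del: qnum.simps)
    then show ?thesis using t(1) S by (simp add: field_simps)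
  qed
  have m0: "mid i j 0 = A * (S * (T - 1))"
    unfolding mid_def ei ej A_def[symmetric] using A(1) by (simp add: field_simps)
  have m1: "t * mid i j 1 = A * ((2 - (2 - T) * S) * T + (S - 2))"
  proof -
    have "mid i j 1 = A * (2 - (2 - T) * S) * t + (S - 2) * A / t"
      unfolding mid_def ei ej A_def[symmetric] using A(1) by simp
    then have "t * mid i j 1 = A * (2 - (2 - T) * S) * (t * t) + (S - 2) * A"
      using t(1) by (simp add: distrib_left)
    then show ?thesis unfolding t(2) by (simp add: algebra_simps)
  qed
  have "t * (mid i j 1 + 2 * (g i * mid i j 0)) = t * mid i j 1 + 2 * ((S - 1) / S * mid i j 0)"
    unfolding gi using t(1) by (simp add: distrib_left)
  also have "\<dots> = A * ((2 - (2 - T) * S) * T + (S - 2)) + 2 * A * (S - 1) * (T - 1)"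
    unfolding m0 m1 using S by simp
  also have "\<dots> = (T + 1) * (A * (S * (T - 1)))" by (simp add: algebra_simps)
  also have "\<dots> = t * (lam * mid i j 0)" unfolding m0 lam_t[symmetric] by simp
  finally show ?thesis using t(1) by simp
qed

lemma quipu_eigenvector_base:
  assumes k: "i + j = k"
  shows "has_pos_eigenvector (3 * k + 1) (quipu i j) lam"
  unfolding has_pos_eigenvector_def
proof (rule quipu_eigenvector[where s = leg and z = "mid i j"
      and c = "mid i j 0 / leg (Suc i)" and c' = "mid i j k / leg (Suc j)"])
  show "k \<ge> 1" using k3 by simp
  have "mid i j 0 / leg (Suc i) * leg i = g i * mid i j 0" for i j
    unfolding leg_ratio[symmetric] by simp
  then show "mid i j 1 + 2 * (mid i j 0 / leg (Suc i) * leg i) = lam * mid i j 0"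
    using mid_end[OF k] by simp
  have "mid i j k / leg (Suc j) * leg j = g j * mid i j k"
    unfolding leg_ratio[symmetric] by simp
  moreover have "mid i j k = mid j i 0" "mid i j (k - 1) = mid j i 1"
    using mid_flip[of i j 0] mid_flip[of i j 1] k k3 by auto
  ultimately show "mid i j (k - 1) + 2 * (mid i j k / leg (Suc j) * leg j) = lam * mid i j k"
    using mid_end[of j i] k by simp
  show "mid i j 0 / leg (Suc i) * leg (Suc i) = mid i j 0" using leg_pos[of "Suc i"] by simp
  show "mid i j k / leg (Suc j) * leg (Suc j) = mid i j k" using leg_pos[of "Suc j"] by simp
qed (use k mid_pos mid_rec leg_pos leg_rec in \<open>auto simp: leg_def[of 0]\<close>)

end

lemma extremal_eigenvalue_exists:
  assumes "k \<ge> 1"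
  shows "\<exists>lam g f. extremal_values k lam g f \<and>
    (\<forall>i j. i + j = k \<longrightarrow> has_pos_eigenvector (3 * k + 1) (quipu i j) lam)"
proof -
  consider "k = 1" | "k = 2" | "k \<ge> 3" using assms by linarith
  then show ?thesis
  proof cases
    case 1 then show ?thesis using extremal_values_1 quipu_eigenvector_1 by blast
  next
    case 2 then show ?thesis using extremal_values_2 quipu_eigenvector_2 by blast
  next
    case 3
    then obtain T :: real where "17 / 10 < T" "T < 2" "T ^ (k + 1) * (2 - T) = 2 * T - 1"
      using extremal_base_exists by blast
    then interpret extremal_base k T "sqrt T" by unfold_locales (use 3 in auto)
    show ?thesis using extremal_values_axioms quipu_eigenvector_base by blast
  qed
qed

section \<open>The minimisers\<close>

lemma connected_diameter:
  assumes G: "simple_graph n G" "connected_graph n G" and n: "n > 0"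
  shows "\<And>u v. u < n \<Longrightarrow> v < n \<Longrightarrow> graph_dist G u v \<le> diameter n G"
    and "\<exists>u<n. \<exists>v<n. graph_dist G u v = diameter n G"
proof -
  let ?S = "{graph_dist G u v |u v. u < n \<and> v < n}"
  have "?S = (\<lambda>(u, v). graph_dist G u v) ` ({..<n} \<times> {..<n})" by auto
  then have fin: "finite ?S" by simp
  show "graph_dist G u v \<le> diameter n G" if "u < n" "v < n" for u v
    unfolding diameter_def using fin that by (intro Max_ge) auto
  have "?S \<noteq> {}" using n by auto
  then have "diameter n G \<in> ?S" unfolding diameter_def using fin by (intro Max_in)
  then show "\<exists>u<n. \<exists>v<n. graph_dist G u v = diameter n G" by force
qed

lemma pos_eigenvector_iso:
  assumes G: "simple_graph n G" and H: "simple_graph n H" and iso: "graph_iso n G H"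
    and ev: "has_pos_eigenvector n H r"
  shows "has_pos_eigenvector n G r"
proof -
  obtain f where f: "bij_betw f {0..<n} {0..<n}" "\<And>u v. u < n \<Longrightarrow> v < n \<Longrightarrow> G u v \<longleftrightarrow> H (f u) (f v)"
    using iso by (auto simp: graph_iso_def)
  obtain y where y: "\<And>v. v < n \<Longrightarrow> y v > 0" "\<And>v. v < n \<Longrightarrow> (\<Sum>w\<in>nbrs H v. y w) = r * y v"
    using ev by (auto simp: has_pos_eigenvector_def)
  have fn: "f v < n" if "v < n" for v using bij_betwE[OF f(1)] that by auto
  have "(\<Sum>w\<in>nbrs G v. y (f w)) = r * y (f v)" if v: "v < n" for v
  proof -
    have "bij_betw f (nbrs G v) (nbrs H (f v))"
    proof (rule bij_betw_imageI)
      show "inj_on f (nbrs G v)"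
        using bij_betw_imp_inj_on[OF f(1)] by (rule inj_on_subset) (use nbrs_subset[OF G, of v] in auto)
      show "f ` nbrs G v = nbrs H (f v)"
      proof safe
        fix w assume "w \<in> nbrs G v"
        then show "f w \<in> nbrs H (f v)" using f(2)[OF v, of w] simple_graph_edgeD(2)[OF G] by (auto simp: nbrs_def)
      next
        fix w assume w: "w \<in> nbrs H (f v)"
        then have "w < n" using nbrs_subset[OF H, of "f v"] by auto
        then obtain u where u: "u < n" "w = f u" using f(1) by (auto simp: bij_betw_def image_iff) (metis atLeastLessThan_iff imageE le0)
        then have "u \<in> nbrs G v" using w f(2)[OF v u(1)] by (simp add: nbrs_def)
        then show "w \<in> f ` nbrs G v" using u by blast
      qed
    qed
    then have "(\<Sum>w\<in>nbrs G v. y (f w)) = (\<Sum>w\<in>nbrs H (f v). y w)" by (rule sum.reindex_bij_betw)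
    then show ?thesis using y(2) fn v by simp
  qed
  then show ?thesis unfolding has_pos_eigenvector_def using y(1) fn by (intro exI[of _ "\<lambda>v. y (f v)"]) auto
qed

lemma graph_iso_trans:
  assumes "graph_iso n G H" "graph_iso n H K"
  shows "graph_iso n G K"
proof -
  obtain f where f: "bij_betw f {0..<n} {0..<n}" "\<And>u v. u < n \<Longrightarrow> v < n \<Longrightarrow> G u v \<longleftrightarrow> H (f u) (f v)"
    using assms(1) by (auto simp: graph_iso_def)
  obtain h where h: "bij_betw h {0..<n} {0..<n}" "\<And>u v. u < n \<Longrightarrow> v < n \<Longrightarrow> H u v \<longleftrightarrow> K (h u) (h v)"
    using assms(2) by (auto simp: graph_iso_def)
  have "f v < n" if "v < n" for v using bij_betwE[OF f(1)] that by auto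
  then show ?thesis unfolding graph_iso_def
    using bij_betw_trans[OF f(1) h(1)] f(2) h(2) by (intro exI[of _ "h \<circ> f"]) auto
qed

text \<open>Pulling \<open>G\<close> back along \<open>\<phi>\<close> makes the quipu a subgraph on
  the same labels. \<open>F\<close> is cut off at \<open>n\<close> because nothing is known about
  \<open>\<phi>\<close> beyond; \<open>quipu_swap\<close> finally restores
  \<open>i \<le> j\<close>.\<close>

lemma small_radius_imp_quipu:
  assumes vals: "extremal_values k lam g f"
    and ev: "\<And>i j. i + j = k \<Longrightarrow> has_pos_eigenvector (3 * k + 1) (quipu i j) lam"
    and n: "n = 3 * k + 1"
    and G: "simple_graph n G" "connected_graph n G" "diameter n G = 2 * k"
    and r: "spectral_radius_graph n G \<le> lam"
  shows "\<exists>i j. i \<le> j \<and> i + j = k \<and> graph_iso n G (quipu i j)"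
proof -
  have n0: "n > 0" using n by simp
  obtain x where x: "\<And>v. v < n \<Longrightarrow> x v > 0"
    "\<And>v. v < n \<Longrightarrow> (\<Sum>w\<in>nbrs G v. x w) = spectral_radius_graph n G * x v"
    using perron_vector_exists[OF G(1,2) n0] by blast
  have xs: "(\<Sum>w\<in>nbrs G v. x w) \<le> lam * x v" if "v < n" for v
    using x[OF that] r by (simp add: mult_right_mono)
  interpret C: conn_graph n G by unfold_locales (use G in auto)
  obtain u v where uv: "u < n" "v < n" "graph_dist G u v = 2 * k"
    using connected_diameter(2)[OF G(1,2) n0] G(3) by auto
  obtain P where P: "C.geodesic P (2 * k)" using C.geodesic_exists[OF uv(1,2)] uv(3) by metis
  interpret extremal_values k lam g f by (rule vals)
  interpret E: extremal_graph k lam g f n G x P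
    by unfold_locales (use n x xs P connected_diameter(1)[OF G(1,2) n0] G(3) in auto)
  obtain i j \<phi> where ij: "i + j = k" and \<phi>: "bij_betw \<phi> {..<n} {..<n}"
    and emb: "\<And>a b. quipu i j a b \<Longrightarrow> G (\<phi> a) (\<phi> b)"
    using E.quipu_embedding by blast
  define F where "F a b \<longleftrightarrow> a < n \<and> b < n \<and> G (\<phi> a) (\<phi> b)" for a b
  have \<phi>n: "\<phi> a < n" if "a < n" for a using bij_betwE[OF \<phi>] that by auto
  have Q: "simple_graph n (quipu i j)" using quipu_simple[of i j] ij n by simp
  have \<phi>i: "a = b" if "\<phi> a = \<phi> b" "a < n" "b < n" for a b
    using bij_betw_imp_inj_on[OF \<phi>] that by (auto dest: inj_onD)
  have F: "simple_graph n F"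
    unfolding simple_graph_def F_def using simple_graph_edgeD(3,4)[OF G(1)] by blast
  have "F = quipu i j"
  proof -
    obtain y where y: "\<And>v. v < n \<Longrightarrow> y v > 0" "\<And>v. v < n \<Longrightarrow> (\<Sum>w\<in>nbrs (quipu i j) v. y w) = lam * y v"
      using ev[OF ij] n by (auto simp: has_pos_eigenvector_def)
    have sub: "F a b" if "quipu i j a b" for a b
      unfolding F_def using emb[OF that] simple_graph_edgeD(1,2)[OF Q that] by simp
    have xF: "(\<Sum>b\<in>nbrs F a. x (\<phi> b)) \<le> lam * x (\<phi> a)" if a: "a < n" for a
    proof -
      have inj: "inj_on \<phi> (nbrs F a)" using \<phi>i by (auto intro!: inj_onI simp: nbrs_def F_def)
      have "(\<Sum>b\<in>nbrs F a. x (\<phi> b)) = (\<Sum>w\<in>\<phi> ` nbrs F a. x w)"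
        by (simp add: sum.reindex[OF inj])
      also have "\<dots> \<le> (\<Sum>w\<in>nbrs G (\<phi> a). x w)"
        using x(1) simple_graph_edgeD(2)[OF G(1)]
        by (intro sum_mono2 finite_nbrs[OF G(1)]) (auto simp: nbrs_def F_def less_imp_le)
      also have "\<dots> \<le> lam * x (\<phi> a)" using xs \<phi>n[OF a] by simp
      finally show ?thesis .
    qed
    show ?thesis
      by (rule spanning_subgraph_eqI[where x = "\<lambda>a. x (\<phi> a)" and y = y, OF F Q n0 sub x(1)[OF \<phi>n] xF y])
  qed
  then have FQ: "quipu i j a b \<longleftrightarrow> G (\<phi> a) (\<phi> b)" if "a < n" "b < n" for a b
    using that by (metis F_def)
  define \<psi> where "\<psi> = the_inv_into {..<n} \<phi>"
  have \<psi>: "bij_betw \<psi> {..<n} {..<n}" unfolding \<psi>_def by (rule bij_betw_the_inv_into[OF \<phi>])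
  have \<phi>\<psi>: "\<phi> (\<psi> v) = v" "\<psi> v < n" if "v < n" for v
    using f_the_inv_into_f_bij_betw[OF \<phi>, of v] bij_betwE[OF \<psi>] that by (auto simp: \<psi>_def)
  have iso: "graph_iso n G (quipu i j)"
    unfolding graph_iso_def
    by (intro exI[of _ \<psi>]) (use \<psi> FQ \<phi>\<psi> in \<open>auto simp: atLeast0LessThan\<close>)
  show ?thesis
  proof (cases "i \<le> j")
    case True then show ?thesis using iso ij by blast
  next
    case False
    moreover have "graph_iso n G (quipu j i)"
      using graph_iso_trans[OF iso] quipu_swap[of i j] ij n by simp
    ultimately show ?thesis using ij by (intro exI[of _ j] exI[of _ i]) auto
  qed
qed

theorem theorem1p2:
  fixes k :: nat
  assumes "k \<ge> 1"
  defines "n \<equiv> 3 * k + 1"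
  shows "(\<forall>i j. i \<le> j \<and> i + j = k \<longrightarrow>
            simple_graph n (quipu i j) \<and> connected_graph n (quipu i j) \<and>
            diameter n (quipu i j) = 2 * k)
       \<and> (\<forall>G. simple_graph n G \<and> connected_graph n G \<and> diameter n G = 2 * k \<longrightarrow>
            ((\<forall>H. simple_graph n H \<and> connected_graph n H \<and> diameter n H = 2 * k \<longrightarrow>
                   spectral_radius_graph n G \<le> spectral_radius_graph n H)
             \<longleftrightarrow> (\<exists>i j. i \<le> j \<and> i + j = k \<and> graph_iso n G (quipu i j))))"
proof -
  have n: "n = 3 * k + 1" "n > 0" by (auto simp: n_def)
  obtain lam g f where vals: "extremal_values k lam g f"
    and ev: "\<And>i j. i + j = k \<Longrightarrow> has_pos_eigenvector (3 * k + 1) (quipu i j) lam"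
    using extremal_eigenvalue_exists[OF assms(1)] by blast
  have Q: "simple_graph n (quipu i j) \<and> connected_graph n (quipu i j) \<and> diameter n (quipu i j) = 2 * k"
    if "i + j = k" for i j
    unfolding n(1) that[symmetric] using quipu_simple quipu_connected quipu_diameter by blast
  have radius: "spectral_radius_graph n E = lam"
    if "simple_graph n E" "has_pos_eigenvector n E lam" for E
    using that spectral_radius_eqI[OF that(1) n(2)] by (auto simp: has_pos_eigenvector_def)
  have iso_radius: "spectral_radius_graph n G = lam"
    if "simple_graph n G" "i + j = k" "graph_iso n G (quipu i j)" for G i j
    using radius[OF that(1)] pos_eigenvector_iso[OF that(1) _ that(3)] Q[OF that(2)] ev[OF that(2)] n(1) by simp
  have small: "\<exists>i j. i \<le> j \<and> i + j = k \<and> graph_iso n G (quipu i j)"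
    if "simple_graph n G" "connected_graph n G" "diameter n G = 2 * k" "spectral_radius_graph n G \<le> lam" for G
    by (rule small_radius_imp_quipu[OF vals ev n(1) that])
  \<comment> \<open>A graph with smaller radius would be a quipu and so have radius
    \<open>lam\<close>; the lower bound thus comes from the same lemma as the description of the
    minimisers.\<close>
  have lower: "lam \<le> spectral_radius_graph n H"
    if H: "simple_graph n H" "connected_graph n H" "diameter n H = 2 * k" for H
  proof (rule ccontr)
    assume less: "\<not> lam \<le> spectral_radius_graph n H"
    then obtain i j where "i + j = k" "graph_iso n H (quipu i j)" using small[OF H] by auto
    then show False using iso_radius[OF H(1)] less by simp
  qed
  show ?thesis
  proof (intro conjI allI impI)
    fix G assume G: "simple_graph n G \<and> connected_graph n G \<and> diameter n G = 2 * k"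
    show "(\<forall>H. simple_graph n H \<and> connected_graph n H \<and> diameter n H = 2 * k \<longrightarrow>
             spectral_radius_graph n G \<le> spectral_radius_graph n H)
          \<longleftrightarrow> (\<exists>i j. i \<le> j \<and> i + j = k \<and> graph_iso n G (quipu i j))"
    proof
      assume min: "\<forall>H. simple_graph n H \<and> connected_graph n H \<and> diameter n H = 2 * k \<longrightarrow>
             spectral_radius_graph n G \<le> spectral_radius_graph n H"
      have "spectral_radius_graph n (quipu 0 k) = lam"
        using Q[of 0 k] ev[of 0 k] n(1) by (intro radius) auto
      then have "spectral_radius_graph n G \<le> lam" using min Q[of 0 k] by force
      then show "\<exists>i j. i \<le> j \<and> i + j = k \<and> graph_iso n G (quipu i j)" using small G by blast
    next
      assume "\<exists>i j. i \<le> j \<and> i + j = k \<and> graph_iso n G (quipu i j)"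
      then have "spectral_radius_graph n G = lam" using iso_radius G by blast
      then show "\<forall>H. simple_graph n H \<and> connected_graph n H \<and> diameter n H = 2 * k \<longrightarrow>
             spectral_radius_graph n G \<le> spectral_radius_graph n H"
        using lower by blast
    qed
  qed (use Q in auto)
qed

end
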